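(* Let $L=\{+,-,1,R_r(x,y): r\in\mathbb{Q}^+\}$ and $T=\operatorname{Th}(\mathbb{R},+,-,1,R_r)_{r\in\mathbb{Q}^+}$, where $R_r(x,y)$ holds iff $0\le y-x\le r$. Let $\mathfrak{C}\prec\mathfrak{C}'$ be as in the context and let $p\in S_x(\mathfrak{C})$ ($x$ a single variable) be the complete type determined by $\{\neg R_r(x,c)\wedge\neg R_r(c,x): c\in\mathfrak{C}, r\in\mathbb{Q}^+\}$. Then the only equivalence relations on $p(\mathfrak{C}')$ relatively type-definable over a $\mathfrak{C}$-small subset of $\mathfrak{C}$ are: the total equivalence relation, equality, $E$, the relations $E_c$ and $E^\mu_c$ for $c\in\mathfrak{C}$, and the relations $E_A$ and $E_{A,c}$ for non-empty $\mathfrak{C}$-small sets $A$ of positive infinitesimals in $\mathfrak{C}$ and $c\in\mathfrak{C}$.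
   Context: $\mathfrak{C}\prec\mathfrak{C}'$ are models of $T$, $\mathfrak{C}$ being $\kappa$-saturated for a strong limit $\kappa>|T|$ and $\mathfrak{C}'$ being $\kappa'$-saturated and strongly $\kappa'$-homogeneous for a strong limit $\kappa'>|\mathfrak{C}|$; $\mathfrak{C}$-small means of size $<\kappa$. Let $S_r(x,y):=R_r(x,y)\vee R_r(y,x)$. The set $\mu$ of infinitesimals of $\mathfrak{C}'$ is $\{e: \bigwedge_{r\in\mathbb{Q}^+}S_r(e,0)\}$; a positive infinitesimal in $\mathfrak{C}$ is a nonzero $a\in\mathfrak{C}$ with $R_r(0,a)$ for all $r\in\mathbb{Q}^+$. For a set $A$ of positive infinitesimals, $\mu_A:=\{e\in\mathfrak{C}': \bigwedge_{a\in A}\bigwedge_{n\in\mathbb{N}^+}R_1(ne,a)\wedge R_1(-ne,a)\}$ (i.e. $|e|\le a/n$ for all $a\in A$, $n\ge1$). The relations on $p(\mathfrak{C}')$: $xEy$ iff $x-y\in\mu$; $xE_cy$ iff $x=y$ or $x+y=c$; $xE^\mu_cy$ iff $x-y\in\mu$ or $x+y-c\in\mu$; $xE_Ay$ iff $x-y\in\mu_A$; $xE_{A,c}y$ iff $x-y\in\mu_A$ or $x+y-c\in\mu_A$. An equivalence relation $F$ on $p(\mathfrak{C}')$ is relatively type-definable over $D$ if $F=\pi(\mathfrak{C}',\mathfrak{C}')\cap p(\mathfrak{C}')^2$ for a partial type $\pi$ over $D$. *)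

theory Defs
  imports Complex_Main
begin

unbundle cardinal_syntax

typedef posrat = "{r :: rat. 0 < r}"
  by (rule exI[of _ 1]) simp

datatype tm = Var nat | One | Minus tm | Plus tm tm

datatype fm =
    Eq tm tm
  | Rel posrat tm tm
  | Neg fm
  | Conj fm fm
  | Ex nat fm

record 'a Lstruct =
  universe :: "'a set"
  add :: "'a \<Rightarrow> 'a \<Rightarrow> 'a"
  neg :: "'a \<Rightarrow> 'a"
  one :: 'a
  rel :: "posrat \<Rightarrow> 'a \<Rightarrow> 'a \<Rightarrow> bool"

definition Lstructure :: "'a Lstruct \<Rightarrow> bool" where
  "Lstructure M \<longleftrightarrow> one M \<in> universe M
     \<and> (\<forall>x\<in>universe M. neg M x \<in> universe M)
     \<and> (\<forall>x\<in>universe M. \<forall>y\<in>universe M. add M x y \<in> universe M)"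

primrec tm_vars :: "tm \<Rightarrow> nat set" where
  "tm_vars (Var i) = {i}"
| "tm_vars One = {}"
| "tm_vars (Minus t) = tm_vars t"
| "tm_vars (Plus s t) = tm_vars s \<union> tm_vars t"

primrec free_vars :: "fm \<Rightarrow> nat set" where
  "free_vars (Eq s t) = tm_vars s \<union> tm_vars t"
| "free_vars (Rel r s t) = tm_vars s \<union> tm_vars t"
| "free_vars (Neg \<phi>) = free_vars \<phi>"
| "free_vars (Conj \<phi> \<psi>) = free_vars \<phi> \<union> free_vars \<psi>"
| "free_vars (Ex i \<phi>) = free_vars \<phi> - {i}"

primrec tm_val :: "'a Lstruct \<Rightarrow> (nat \<Rightarrow> 'a) \<Rightarrow> tm \<Rightarrow> 'a" where
  "tm_val M v (Var i) = v i"
| "tm_val M v One = one M"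
| "tm_val M v (Minus t) = neg M (tm_val M v t)"
| "tm_val M v (Plus s t) = add M (tm_val M v s) (tm_val M v t)"

primrec sat :: "'a Lstruct \<Rightarrow> (nat \<Rightarrow> 'a) \<Rightarrow> fm \<Rightarrow> bool" where
  "sat M v (Eq s t) \<longleftrightarrow> tm_val M v s = tm_val M v t"
| "sat M v (Rel r s t) \<longleftrightarrow> rel M r (tm_val M v s) (tm_val M v t)"
| "sat M v (Neg \<phi>) \<longleftrightarrow> \<not> sat M v \<phi>"
| "sat M v (Conj \<phi> \<psi>) \<longleftrightarrow> sat M v \<phi> \<and> sat M v \<psi>"
| "sat M v (Ex i \<phi>) \<longleftrightarrow> (\<exists>a\<in>universe M. sat M (v(i := a)) \<phi>)"

text \<open>A finite tuple is a list \<open>as\<close>, substituted for the variables with indices below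
  \<open>length as\<close>. The value of \<open>nth as\<close> beyond the length of \<open>as\<close> is unspecified, so
  \<open>holds M as \<phi>\<close> is only meaningful when the free variables of \<open>\<phi>\<close> lie below that length.\<close>

definition holds :: "'a Lstruct \<Rightarrow> 'a list \<Rightarrow> fm \<Rightarrow> bool" where
  "holds M as \<phi> \<longleftrightarrow> sat M (nth as) \<phi>"

definition Th :: "'a Lstruct \<Rightarrow> fm set" where
  "Th M = {\<phi>. free_vars \<phi> = {} \<and> holds M [] \<phi>}"

definition is_model :: "'a Lstruct \<Rightarrow> fm set \<Rightarrow> bool" where
  "is_model M \<Gamma> \<longleftrightarrow> Lstructure M \<and> (\<forall>\<phi>\<in>\<Gamma>. holds M [] \<phi>)"

definition real_struct :: "real Lstruct" where
  "real_struct = \<lparr> universe = UNIV, add = (+), neg = uminus, one = 1,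
     rel = (\<lambda>r x y. 0 \<le> y - x \<and> y - x \<le> of_rat (Rep_posrat r)) \<rparr>"

definition T :: "fm set" where
  "T = Th real_struct"

definition substructure :: "'a Lstruct \<Rightarrow> 'a Lstruct \<Rightarrow> bool" where
  "substructure M N \<longleftrightarrow> Lstructure M \<and> Lstructure N \<and> universe M \<subseteq> universe N
     \<and> one M = one N
     \<and> (\<forall>x\<in>universe M. neg M x = neg N x)
     \<and> (\<forall>x\<in>universe M. \<forall>y\<in>universe M. add M x y = add N x y)
     \<and> (\<forall>r. \<forall>x\<in>universe M. \<forall>y\<in>universe M. rel M r x y = rel N r x y)"

definition elementary_substructure :: "'a Lstruct \<Rightarrow> 'a Lstruct \<Rightarrow> bool" where
  "elementary_substructure M N \<longleftrightarrow> substructure M N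
     \<and> (\<forall>\<phi> as. set as \<subseteq> universe M \<and> free_vars \<phi> \<subseteq> {..<length as}
          \<longrightarrow> (holds M as \<phi> \<longleftrightarrow> holds N as \<phi>))"

text \<open>A formula with parameters is a pair \<open>(\<phi>, ds)\<close>: in \<open>n\<close> type variables, the
  variables \<open>0, \<dots>, n - 1\<close> of \<open>\<phi>\<close> are the type variables, and the next
  \<open>length ds\<close> variables stand for the parameters \<open>ds\<close>.\<close>

type_synonym 'a pfm = "fm \<times> 'a list"

definition formulas_over :: "nat \<Rightarrow> 'a set \<Rightarrow> 'a pfm set" where
  "formulas_over n A = {(\<phi>, ds). set ds \<subseteq> A \<and> free_vars \<phi> \<subseteq> {..<n + length ds}}"

definition realizes :: "'a Lstruct \<Rightarrow> 'a list \<Rightarrow> 'a pfm set \<Rightarrow> bool" where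
  "realizes M xs \<pi> \<longleftrightarrow> (\<forall>(\<phi>, ds)\<in>\<pi>. holds M (xs @ ds) \<phi>)"

definition partial_type :: "'a Lstruct \<Rightarrow> nat \<Rightarrow> 'a set \<Rightarrow> 'a pfm set \<Rightarrow> bool" where
  "partial_type M n A \<pi> \<longleftrightarrow> \<pi> \<subseteq> formulas_over n A
     \<and> (\<forall>\<pi>\<^sub>0. finite \<pi>\<^sub>0 \<and> \<pi>\<^sub>0 \<subseteq> \<pi> \<longrightarrow>
          (\<exists>xs. length xs = n \<and> set xs \<subseteq> universe M \<and> realizes M xs \<pi>\<^sub>0))"

definition complete_types :: "'a Lstruct \<Rightarrow> nat \<Rightarrow> 'a set \<Rightarrow> 'a pfm set set" where
  "complete_types M n A = {p. partial_type M n A p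
     \<and> (\<forall>(\<phi>, ds)\<in>formulas_over n A. (\<phi>, ds) \<in> p \<or> (Neg \<phi>, ds) \<in> p)}"

definition saturated :: "'a Lstruct \<Rightarrow> 'k rel \<Rightarrow> bool" where
  "saturated M \<kappa> \<longleftrightarrow>
     (\<forall>n A. A \<subseteq> universe M \<and> |A| <o \<kappa> \<longrightarrow>
        (\<forall>p\<in>complete_types M n A.
           \<exists>xs. length xs = n \<and> set xs \<subseteq> universe M \<and> realizes M xs p))"

definition automorphism :: "'a Lstruct \<Rightarrow> ('a \<Rightarrow> 'a) \<Rightarrow> bool" where
  "automorphism M \<sigma> \<longleftrightarrow> bij_betw \<sigma> (universe M) (universe M)
     \<and> \<sigma> (one M) = one M
     \<and> (\<forall>x\<in>universe M. \<sigma> (neg M x) = neg M (\<sigma> x))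
     \<and> (\<forall>x\<in>universe M. \<forall>y\<in>universe M. \<sigma> (add M x y) = add M (\<sigma> x) (\<sigma> y))
     \<and> (\<forall>r. \<forall>x\<in>universe M. \<forall>y\<in>universe M. rel M r (\<sigma> x) (\<sigma> y) = rel M r x y)"

definition partial_elementary :: "'a Lstruct \<Rightarrow> 'a set \<Rightarrow> ('a \<Rightarrow> 'a) \<Rightarrow> bool" where
  "partial_elementary M A f \<longleftrightarrow> A \<subseteq> universe M \<and> f ` A \<subseteq> universe M
     \<and> (\<forall>\<phi> as. set as \<subseteq> A \<and> free_vars \<phi> \<subseteq> {..<length as}
          \<longrightarrow> (holds M as \<phi> \<longleftrightarrow> holds M (map f as) \<phi>))"

definition strongly_homogeneous :: "'a Lstruct \<Rightarrow> 'k rel \<Rightarrow> bool" where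
  "strongly_homogeneous M \<kappa> \<longleftrightarrow>
     (\<forall>A f. |A| <o \<kappa> \<and> partial_elementary M A f \<longrightarrow>
        (\<exists>\<sigma>. automorphism M \<sigma> \<and> (\<forall>a\<in>A. \<sigma> a = f a)))"

text \<open>Every cardinal below a cardinal \<open>\<kappa>\<close> on the type \<open>'k\<close> is the cardinality of a set
  over \<open>'k\<close>, so quantifying over such sets ranges over all of them.\<close>

definition strong_limit :: "'k rel \<Rightarrow> bool" where
  "strong_limit \<kappa> \<longleftrightarrow> Card_order \<kappa> \<and> infinite (Field \<kappa>)
     \<and> (\<forall>A :: 'k set. |A| <o \<kappa> \<longrightarrow> |Pow A| <o \<kappa>)"

definition rel_type_definable ::
  "'a Lstruct \<Rightarrow> 'a set \<Rightarrow> 'a set \<Rightarrow> ('a \<times> 'a) set \<Rightarrow> bool" where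
  "rel_type_definable M P D F \<longleftrightarrow>
     (\<exists>\<pi>. partial_type M 2 D \<pi> \<and> F = {(x, y) \<in> P \<times> P. realizes M [x, y] \<pi>})"

text \<open>The language has a unary minus and no symbol for zero; both \<open>zero\<close> and subtraction
  are terms.\<close>

definition zero :: "'a Lstruct \<Rightarrow> 'a" where
  "zero M = add M (one M) (neg M (one M))"

definition diff :: "'a Lstruct \<Rightarrow> 'a \<Rightarrow> 'a \<Rightarrow> 'a" where
  "diff M x y = add M x (neg M y)"

primrec mult :: "'a Lstruct \<Rightarrow> nat \<Rightarrow> 'a \<Rightarrow> 'a" where
  "mult M 0 x = zero M"
| "mult M (Suc n) x = add M (mult M n x) x"

definition S :: "'a Lstruct \<Rightarrow> posrat \<Rightarrow> 'a \<Rightarrow> 'a \<Rightarrow> bool" where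
  "S M r x y \<longleftrightarrow> rel M r x y \<or> rel M r y x"

definition infinitesimals :: "'a Lstruct \<Rightarrow> 'a set" where
  "infinitesimals M = {e \<in> universe M. \<forall>r. S M r e (zero M)}"

definition positive_infinitesimals :: "'a Lstruct \<Rightarrow> 'a set" where
  "positive_infinitesimals M = {a \<in> universe M. a \<noteq> zero M \<and> (\<forall>r. rel M r (zero M) a)}"

definition infinitesimals_below :: "'a Lstruct \<Rightarrow> 'a set \<Rightarrow> 'a set" where
  "infinitesimals_below M A = {e \<in> universe M. \<forall>a\<in>A. \<forall>n\<ge>1.
     rel M (Abs_posrat 1) (mult M n e) a \<and> rel M (Abs_posrat 1) (neg M (mult M n e)) a}"

definition infinity_conditions :: "'a Lstruct \<Rightarrow> 'a pfm set" where
  "infinity_conditions M =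
     {(Conj (Neg (Rel r (Var 0) (Var 1))) (Neg (Rel r (Var 1) (Var 0))), [c]) | r c. c \<in> universe M}"

text \<open>\<open>infinity_conditions\<close> determines a complete type when \<open>M\<close> is a model of \<open>T\<close>;
  for other structures there may be no such type or several.\<close>

definition type_at_infinity :: "'a Lstruct \<Rightarrow> 'a pfm set" where
  "type_at_infinity M =
     (THE p. p \<in> complete_types M 1 (universe M) \<and> infinity_conditions M \<subseteq> p)"

definition realizations :: "'a Lstruct \<Rightarrow> 'a pfm set \<Rightarrow> 'a set" where
  "realizations M p = {x \<in> universe M. realizes M [x] p}"

text \<open>The suffix \<open>_refl\<close> refers to identifying \<open>x\<close> with its reflection \<open>c - x\<close>.\<close>

definition E_inf :: "'a Lstruct \<Rightarrow> 'a set \<Rightarrow> ('a \<times> 'a) set" where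
  "E_inf M P = {(x, y) \<in> P \<times> P. diff M x y \<in> infinitesimals M}"

definition E_refl :: "'a Lstruct \<Rightarrow> 'a set \<Rightarrow> 'a \<Rightarrow> ('a \<times> 'a) set" where
  "E_refl M P c = {(x, y) \<in> P \<times> P. x = y \<or> add M x y = c}"

definition E_inf_refl :: "'a Lstruct \<Rightarrow> 'a set \<Rightarrow> 'a \<Rightarrow> ('a \<times> 'a) set" where
  "E_inf_refl M P c = {(x, y) \<in> P \<times> P.
     diff M x y \<in> infinitesimals M \<or> diff M (add M x y) c \<in> infinitesimals M}"

definition E_below :: "'a Lstruct \<Rightarrow> 'a set \<Rightarrow> 'a set \<Rightarrow> ('a \<times> 'a) set" where
  "E_below M P A = {(x, y) \<in> P \<times> P. diff M x y \<in> infinitesimals_below M A}"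

definition E_below_refl :: "'a Lstruct \<Rightarrow> 'a set \<Rightarrow> 'a set \<Rightarrow> 'a \<Rightarrow> ('a \<times> 'a) set" where
  "E_below_refl M P A c = {(x, y) \<in> P \<times> P.
     diff M x y \<in> infinitesimals_below M A \<or> diff M (add M x y) c \<in> infinitesimals_below M A}"

end

theory Submission
  imports Defs "HOL-Library.Countable_Set"
begin

text \<open>Virtual substitution eliminates quantifiers in \<open>T\<close>: the witnesses to try for an existential
  quantifier are the midpoints of breakpoints, and infinity, where every atom containing the
  variable is false. Hence the type of a pair \<open>(x, y)\<close> of realizations of \<open>p\<close> is determined by
  whether some \<open>y - a x\<close>, with \<open>a\<close> rational, is at bounded distance from \<open>C\<close>, and if so by \<open>a\<close> and
  the type of \<open>e = y - a x\<close>.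

  Let \<open>F\<close> be type-definable and not total. By compactness, finitely many bounded neighbourhoods of
  lines \<open>y = a x + d\<close> cover \<open>F\<close>. The affine maps \<open>x \<mapsto> a x + e\<close> that preserve all classes form a group,
  so finiteness forces \<open>a = 1\<close> or \<open>a = -1\<close> and makes the group \<open>H\<close> of translations consist of
  infinitesimals. A compactness argument shows that \<open>H\<close> is convex, and then \<open>H\<close> is trivial, or \<open>\<mu>\<close>, or
  \<open>\<mu>\<^sub>A\<close> for the set \<open>A\<close> of definable bounds of \<open>H\<close>. If \<open>a = -1\<close> occurs, saturation of \<open>C\<close> moves the
  centre \<open>e\<close> of the reflection into \<open>C\<close>.\<close>

text \<open>The relations \<open>R_r\<close> compare only elements at bounded distance, so the
  language cannot order two elements that are infinitely far apart, and \<open>x\<close> and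
  \<open>c - x\<close> have the same type over \<open>C\<close>. That is why reflections stand
  beside translations in the list. The finite cover is strong because \<open>F\<close> is
  transitive: a slope \<open>a\<close> brings all its powers, and a translation by \<open>e\<close>
  brings all multiples of \<open>e\<close>. Powers in a finite set repeat, and multiples of
  \<open>e\<close> that return to the same bounded neighbourhood force \<open>e\<close> to be
  infinitesimal. Among infinitesimals \<open>R_1\<close> is a linear order, and a formula of the
  type, read as a condition on \<open>e\<close>, changes its truth value at only finitely many
  points, all in \<open>C\<close>. These critical points yield the convexity of \<open>H\<close>,
  and those above \<open>H\<close> form the set \<open>A\<close>. Smallness of \<open>D\<close>
  enters twice: it bounds the number of critical points, which keeps \<open>A\<close> small, and it
  lets \<open>C\<close> realize the type over \<open>D\<close> of the centre of a
  reflection.\<close>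

lemma finite_tm_vars [simp]: "finite (tm_vars t)"
  by (induction t) auto

lemma finite_free_vars [simp]: "finite (free_vars \<phi>)"
  by (induction \<phi>) auto

section \<open>Dependence on free variables, and transfer of valid formulas from the reals\<close>

lemma tm_val_cong: "(\<And>i. i \<in> tm_vars t \<Longrightarrow> v i = w i) \<Longrightarrow> tm_val M v t = tm_val M w t"
  by (induction t) auto

lemma sat_cong: "(\<And>i. i \<in> free_vars \<phi> \<Longrightarrow> v i = w i) \<Longrightarrow> sat M v \<phi> \<longleftrightarrow> sat M w \<phi>"
proof (induction \<phi> arbitrary: v w)
  case (Eq s t)
  then show ?case using tm_val_cong[of s v w M] tm_val_cong[of t v w M] by simp
next
  case (Rel r s t)
  then show ?case using tm_val_cong[of s v w M] tm_val_cong[of t v w M] by simp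
next
  case (Neg \<phi>)
  then show ?case by (metis free_vars.simps(3) sat.simps(3))
next
  case (Conj \<phi> \<psi>)
  then show ?case by (metis UnCI free_vars.simps(4) sat.simps(4))
next
  case (Ex i \<phi>)
  have "sat M (v(i := a)) \<phi> \<longleftrightarrow> sat M (w(i := a)) \<phi>" for a
    by (rule Ex.IH) (use Ex.prems in auto)
  then show ?case by simp
qed

primrec closure_over :: "nat list \<Rightarrow> fm \<Rightarrow> fm" where
  "closure_over [] \<phi> = \<phi>"
| "closure_over (i # is) \<phi> = Neg (Ex i (Neg (closure_over is \<phi>)))"

lemma free_vars_closure_over [simp]: "free_vars (closure_over is \<phi>) = free_vars \<phi> - set is"
  by (induction "is") auto

lemma sat_closure_overI: "(\<And>w. sat M w \<phi>) \<Longrightarrow> sat M v (closure_over is \<phi>)"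
  by (induction "is" arbitrary: v) auto

lemma sat_closure_overD:
  "\<lbrakk>sat M v (closure_over is \<phi>); \<And>i. i \<notin> set is \<Longrightarrow> w i = v i; \<And>i. i \<in> set is \<Longrightarrow> w i \<in> universe M\<rbrakk>
    \<Longrightarrow> sat M w \<phi>"
proof (induction "is" arbitrary: v)
  case Nil
  then have "w = v" by auto
  with Nil show ?case by simp
next
  case (Cons j js)
  show ?case
    by (rule Cons.IH[of "v(j := w j)"]) (use Cons.prems in \<open>auto simp del: fun_upd_apply\<close>, use Cons.prems in auto)
qed

text \<open>\<open>T\<close> contains only sentences, so the formula is first closed universally.
  The new quantifiers range over the universe of \<open>M\<close>, whence the condition on the
  values of \<open>v\<close>.\<close>

lemma transfer:
  assumes "is_model M T" "\<And>w. sat real_struct w \<phi>" "\<And>i. i \<in> free_vars \<phi> \<Longrightarrow> v i \<in> universe M"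
  shows "sat M v \<phi>"
proof -
  define js where "js = sorted_list_of_set (free_vars \<phi>)"
  have js: "set js = free_vars \<phi>" by (simp add: js_def)
  have "closure_over js \<phi> \<in> T"
    using assms(2) by (simp add: T_def Th_def js holds_def sat_closure_overI)
  then have "sat M (nth []) (closure_over js \<phi>)"
    using assms(1) by (auto simp: is_model_def holds_def)
  \<comment> \<open>Sentences are evaluated under the unspecified assignment \<open>nth []\<close>,
    so these values have to be kept at all variables that are not free.\<close>
  then have "sat M (\<lambda>i. if i \<in> free_vars \<phi> then v i else [] ! i) \<phi>"
    by (rule sat_closure_overD) (use assms(3) js in auto)
  then show ?thesis
    by (rule iffD1[OF sat_cong, rotated]) auto
qed

abbreviation rval :: "(nat \<Rightarrow> real) \<Rightarrow> tm \<Rightarrow> real" where "rval \<equiv> tm_val real_struct"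
abbreviation rsat :: "(nat \<Rightarrow> real) \<Rightarrow> fm \<Rightarrow> bool" where "rsat \<equiv> sat real_struct"

definition rad :: "posrat \<Rightarrow> real" where "rad r = of_rat (Rep_posrat r)"

lemma rad_pos [simp]: "0 < rad r"
  using Rep_posrat[of r] by (simp add: rad_def)

lemma obtain_rad:
  assumes "0 < q" obtains r where "rad r = of_rat q"
  using assms Abs_posrat_inverse[of q] unfolding rad_def by (metis mem_Collect_eq)

lemma real_struct_simps [simp]:
  "universe real_struct = UNIV" "add real_struct = (+)" "neg real_struct = uminus"
  "one real_struct = 1" "rel real_struct r x y \<longleftrightarrow> 0 \<le> y - x \<and> y - x \<le> rad r"
  by (simp_all add: real_struct_def rad_def)

lemma zero_real_struct [simp]: "zero real_struct = 0"
  by (simp add: zero_def)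

lemma mult_real_struct [simp]: "mult real_struct n x = real n * x"
  by (induction n) (auto simp: algebra_simps)

section \<open>Quantifier elimination\<close>

primrec qf :: "fm \<Rightarrow> bool" where
  "qf (Eq s t) = True"
| "qf (Rel r s t) = True"
| "qf (Neg \<phi>) = qf \<phi>"
| "qf (Conj \<phi> \<psi>) = (qf \<phi> \<and> qf \<psi>)"
| "qf (Ex i \<phi>) = False"

definition Bot :: fm where "Bot = Neg (Eq One One)"
definition Disj :: "fm \<Rightarrow> fm \<Rightarrow> fm" where "Disj \<phi> \<psi> = Neg (Conj (Neg \<phi>) (Neg \<psi>))"

lemma Bot_simps [simp]: "qf Bot" "\<not> sat M v Bot" "free_vars Bot = {}"
  by (auto simp: Bot_def)

lemma Disj_simps [simp]:
  "qf (Disj \<phi> \<psi>) \<longleftrightarrow> qf \<phi> \<and> qf \<psi>" "sat M v (Disj \<phi> \<psi>) \<longleftrightarrow> sat M v \<phi> \<or> sat M v \<psi>"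
  "free_vars (Disj \<phi> \<psi>) = free_vars \<phi> \<union> free_vars \<psi>"
  by (auto simp: Disj_def)

definition Zero :: tm where "Zero = Plus One (Minus One)"
definition Diff :: "tm \<Rightarrow> tm \<Rightarrow> tm" where "Diff s t = Plus s (Minus t)"

lemma Zero_simps [simp]: "tm_vars Zero = {}" "tm_val M v Zero = zero M"
  by (auto simp: Zero_def zero_def)

lemma Diff_simps [simp]:
  "tm_vars (Diff s t) = tm_vars s \<union> tm_vars t"
  "tm_val M v (Diff s t) = diff M (tm_val M v s) (tm_val M v t)"
  by (auto simp: Diff_def diff_def)

lemma diff_real_struct [simp]: "diff real_struct x y = x - y"
  by (simp add: diff_def)

primrec Nmul :: "nat \<Rightarrow> tm \<Rightarrow> tm" where
  "Nmul 0 t = Zero"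
| "Nmul (Suc n) t = Plus (Nmul n t) t"

lemma Nmul_simps [simp]:
  "tm_vars (Nmul n t) \<subseteq> tm_vars t" "tm_val M v (Nmul n t) = mult M n (tm_val M v t)"
  by (induction n) auto

text \<open>The coefficient of an unknown \<open>X\<close> in \<open>t\<close> after substituting \<open>a k * X + b k\<close> for each
  variable \<open>k\<close>.\<close>

primrec lincoeff :: "(nat \<Rightarrow> 'b::comm_ring_1) \<Rightarrow> tm \<Rightarrow> 'b" where
  "lincoeff a (Var i) = a i"
| "lincoeff a One = 0"
| "lincoeff a (Minus t) = - lincoeff a t"
| "lincoeff a (Plus s t) = lincoeff a s + lincoeff a t"

lemma lincoeff_of_int: "lincoeff (\<lambda>i. of_int (a i)) t = of_int (lincoeff a t)"
  by (induction t) auto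

lemma rval_upd: "rval (v(x := c)) t = of_int (lincoeff (\<lambda>i. if i = x then 1 else 0) t) * c + rval (v(x := 0)) t"
  by (induction t) (auto simp: algebra_simps)

text \<open>The formula obtained by letting \<open>X\<close> tend to infinity: every atom in which \<open>X\<close> survives
  becomes false, because bounded differences are all the language can express.\<close>

primrec drop_unbounded :: "(nat \<Rightarrow> rat) \<Rightarrow> fm \<Rightarrow> fm" where
  "drop_unbounded a (Eq s t) = (if lincoeff a s = lincoeff a t then Eq s t else Bot)"
| "drop_unbounded a (Rel r s t) = (if lincoeff a s = lincoeff a t then Rel r s t else Bot)"
| "drop_unbounded a (Neg \<phi>) = Neg (drop_unbounded a \<phi>)"
| "drop_unbounded a (Conj \<phi> \<psi>) = Conj (drop_unbounded a \<phi>) (drop_unbounded a \<psi>)"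
| "drop_unbounded a (Ex i \<phi>) = Bot"

lemma qf_drop_unbounded [simp]: "qf \<phi> \<Longrightarrow> qf (drop_unbounded a \<phi>)"
  by (induction \<phi>) auto

text \<open>Substitution of \<open>t / k\<close> for the variable \<open>x\<close>, with denominators cleared.\<close>

primrec subst_tm :: "nat \<Rightarrow> nat \<Rightarrow> tm \<Rightarrow> tm \<Rightarrow> tm" where
  "subst_tm x k t (Var i) = (if i = x then t else Nmul k (Var i))"
| "subst_tm x k t One = Nmul k One"
| "subst_tm x k t (Minus s) = Minus (subst_tm x k t s)"
| "subst_tm x k t (Plus s s') = Plus (subst_tm x k t s) (subst_tm x k t s')"

primrec subst_fm :: "nat \<Rightarrow> nat \<Rightarrow> tm \<Rightarrow> fm \<Rightarrow> fm" where
  "subst_fm x k t (Eq s s') = Eq (subst_tm x k t s) (subst_tm x k t s')"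
| "subst_fm x k t (Rel r s s') =
     Rel (Abs_posrat (of_nat k * Rep_posrat r)) (subst_tm x k t s) (subst_tm x k t s')"
| "subst_fm x k t (Neg \<phi>) = Neg (subst_fm x k t \<phi>)"
| "subst_fm x k t (Conj \<phi> \<psi>) = Conj (subst_fm x k t \<phi>) (subst_fm x k t \<psi>)"
| "subst_fm x k t (Ex i \<phi>) = Bot"

lemma qf_subst_fm [simp]: "qf \<phi> \<Longrightarrow> qf (subst_fm x k t \<phi>)"
  by (induction \<phi>) auto

lemma rval_subst_tm: "0 < k \<Longrightarrow> rval v (subst_tm x k t s) = real k * rval (v(x := rval v t / real k)) s"
  by (induction s) (auto simp: algebra_simps)

lemma rsat_subst_fm:
  assumes "0 < k" "qf \<phi>"
  shows "rsat v (subst_fm x k t \<phi>) \<longleftrightarrow> rsat (v(x := rval v t / real k)) \<phi>"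
  using assms(2)
proof (induction \<phi>)
  case (Rel r s s')
  let ?w = "v(x := rval v t / real k)"
  have "rad (Abs_posrat (of_nat k * Rep_posrat r)) = real k * rad r"
    using assms Rep_posrat[of r] by (simp add: rad_def Abs_posrat_inverse of_rat_mult)
  moreover have "real k * rval ?w s' - real k * rval ?w s = real k * (rval ?w s' - rval ?w s)"
    by (simp add: algebra_simps)
  ultimately show ?case
    using assms(1) by (simp add: rval_subst_tm zero_le_mult_iff del: fun_upd_apply)
qed (use assms(1) in \<open>auto simp: rval_subst_tm\<close>)

lemma rval_subst_zero: "rval v (subst_tm x 1 Zero s) = rval (v(x := 0)) s"
  using rval_subst_tm[of 1 v x Zero s] by simp

text \<open>For \<open>q = a / b\<close> the root of \<open>m X + u = q\<close> is
  \<open>(a - b u) / (b m)\<close>. Terms have integer coefficients and \<open>subst_fm\<close>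
  wants a positive denominator, so the sign of \<open>m\<close> goes into the numerator
  \<open>t\<close>.\<close>

lemma linear_root:
  assumes "m \<noteq> (0::int)"
  obtains t k where "0 < k" "\<And>v. real_of_int m * (rval v t / real k) + rval v u = of_rat q"
proof -
  obtain a b where ab: "quotient_of q = (a, b)" by fastforce
  then have b: "b > 0" and q: "q = of_int a / of_int b"
    using quotient_of_denom_pos quotient_of_div by auto
  define sg where "sg = (\<lambda>n::int. \<lambda>t. if n \<ge> 0 then Nmul (nat n) t else Minus (Nmul (nat (- n)) t))"
  have sg: "rval v (sg n t) = of_int n * rval v t" for v n t
    by (simp add: sg_def)
  define s where "s = Plus (sg a One) (Minus (sg b u))"
  define t where "t = sg (sgn m) s"
  have "rval v t = of_int (sgn m) * (of_int a - of_int b * rval v u)" for v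
    by (simp add: t_def sg s_def)
  moreover have "real (nat (b * \<bar>m\<bar>)) = of_int b * of_int \<bar>m\<bar>" using b by (simp add: nat_mult_distrib)
  moreover have "real_of_int m * of_int (sgn m) = of_int \<bar>m\<bar>"
    by (simp flip: of_int_mult add: abs_sgn)
  ultimately have "real_of_int m * (rval v t / real (nat (b * \<bar>m\<bar>))) + rval v u = of_rat q" for v
  proof -
    have "real_of_int m * rval v t = of_int \<bar>m\<bar> * (of_int a - of_int b * rval v u)"
      by (metis \<open>\<And>v. rval v t = _\<close> \<open>real_of_int m * of_int (sgn m) = of_int \<bar>m\<bar>\<close> mult.assoc)
    then have "real_of_int m * (rval v t / real (nat (b * \<bar>m\<bar>))) = (of_int a - of_int b * rval v u) / of_int b"
      unfolding \<open>real (nat (b * \<bar>m\<bar>)) = _\<close> times_divide_eq_right using b assms by simp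
    then show ?thesis using b by (simp add: q of_rat_divide diff_divide_distrib)
  qed
  moreover have "0 < nat (b * \<bar>m\<bar>)" using b assms by simp
  ultimately show ?thesis using that by blast
qed

text \<open>These coefficients single out the variable \<open>x\<close> as the unknown. The type is
  left open because \<open>drop_unbounded\<close> computes with rationals and the breakpoints with
  integers.\<close>

definition delta :: "nat \<Rightarrow> nat \<Rightarrow> 'b::comm_ring_1" where
  "delta x = (\<lambda>i. if i = x then 1 else 0)"

lemma lincoeff_delta_eq_iff:
  "lincoeff (delta x :: nat \<Rightarrow> rat) s = lincoeff (delta x) t \<longleftrightarrow>
     (lincoeff (delta x) s :: int) = lincoeff (delta x) t"
proof -
  have "(delta x :: nat \<Rightarrow> rat) = (\<lambda>i. of_int (delta x i))"
    by (auto simp: delta_def)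
  then show ?thesis by (simp add: lincoeff_of_int)
qed

lemma rval_upd_eq:
  assumes "lincoeff (delta x :: nat \<Rightarrow> rat) s = lincoeff (delta x) t"
  shows "rval (v(x := c)) t - rval (v(x := c)) s = rval v t - rval v s"
proof -
  have "rval (v(x := c)) t - rval (v(x := c)) s = rval (v(x := 0)) t - rval (v(x := 0)) s" for c
    using assms unfolding lincoeff_delta_eq_iff
    by (simp add: rval_upd[of v x c] delta_def)
  from this[of c] this[of "v x"] show ?thesis by simp
qed

text \<open>The points \<open>t / k\<close> cut the line into cells on which the truth value is
  constant. Both unbounded cells carry the value given by \<open>drop_unbounded\<close>: an atom
  bounds a difference, so plus and minus infinity look alike.\<close>

definition breakpoints :: "nat \<Rightarrow> fm \<Rightarrow> (tm \<times> nat) set \<Rightarrow> bool" where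
  "breakpoints x \<phi> L \<longleftrightarrow> finite L \<and> (\<forall>(t, k)\<in>L. 0 < k)
     \<and> (\<forall>v c c'. c \<le> c' \<and> (\<forall>(t, k)\<in>L. \<not> (c \<le> rval v t / real k \<and> rval v t / real k \<le> c'))
          \<longrightarrow> (rsat (v(x := c)) \<phi> \<longleftrightarrow> rsat (v(x := c')) \<phi>))
     \<and> (\<forall>v c. ((\<forall>(t, k)\<in>L. c < rval v t / real k) \<or> (\<forall>(t, k)\<in>L. c > rval v t / real k))
          \<longrightarrow> (rsat (v(x := c)) \<phi> \<longleftrightarrow> rsat v (drop_unbounded (delta x) \<phi>)))"

text \<open>An atom in which \<open>x\<close> survives holds at a single point, for
  \<open>Eq\<close>, or exactly on the closed interval between the roots of \<open>t - s = 0\<close>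
  and \<open>t - s = r\<close>, for \<open>Rel\<close>. Negation keeps the breakpoints and
  conjunction unites them.\<close>

lemma ex_breakpoints:
  assumes "qf \<phi>"
  shows "\<exists>L. breakpoints x \<phi> L"
  using assms
proof (induction \<phi>)
  case (Eq s t)
  define m :: int where "m = lincoeff (delta x) t - lincoeff (delta x) s"
  define u where "u = subst_tm x 1 Zero (Diff t s)"
  have g: "rval (v(x := c)) t - rval (v(x := c)) s = of_int m * c + rval v u" for v c
    unfolding u_def rval_subst_zero m_def delta_def using rval_upd[of v x c t] rval_upd[of v x c s]
    by (simp add: algebra_simps)
  show ?case
  proof (cases "m = 0")
    case True
    then have "lincoeff (delta x :: nat \<Rightarrow> rat) s = lincoeff (delta x) t"
      unfolding lincoeff_delta_eq_iff m_def by simp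
    with rval_upd_eq[of x s t] have "breakpoints x (Eq s t) {}"
      by (simp add: breakpoints_def) (metis eq_iff_diff_eq_0)
    then show ?thesis by blast
  next
    case False
    then have ne: "lincoeff (delta x :: nat \<Rightarrow> rat) s \<noteq> lincoeff (delta x) t"
      unfolding lincoeff_delta_eq_iff m_def by simp
    obtain t0 k0 where k0: "0 < k0" and t0: "\<And>v. of_int m * (rval v t0 / real k0) + rval v u = of_rat 0"
      using linear_root[OF False] by metis
    have "rsat (v(x := c)) (Eq s t) \<longleftrightarrow> c = rval v t0 / real k0" for v c
    proof -
      have "rval (v(x := c)) t - rval (v(x := c)) s = of_int m * (c - rval v t0 / real k0)"
        unfolding g using t0[of v] by (simp add: algebra_simps)
      then show ?thesis using False by (metis eq_iff_diff_eq_0 mult_eq_0_iff of_int_eq_0_iff sat.simps(1))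
    qed
    then have "breakpoints x (Eq s t) {(t0, k0)}"
      using k0 ne unfolding breakpoints_def by auto
    then show ?thesis by blast
  qed
next
  case (Rel r s t)
  define m :: int where "m = lincoeff (delta x) t - lincoeff (delta x) s"
  define u where "u = subst_tm x 1 Zero (Diff t s)"
  have g: "rval (v(x := c)) t - rval (v(x := c)) s = of_int m * c + rval v u" for v c
    unfolding u_def rval_subst_zero m_def delta_def using rval_upd[of v x c t] rval_upd[of v x c s]
    by (simp add: algebra_simps)
  show ?case
  proof (cases "m = 0")
    case True
    then have "lincoeff (delta x :: nat \<Rightarrow> rat) s = lincoeff (delta x) t"
      unfolding lincoeff_delta_eq_iff m_def by simp
    with rval_upd_eq[of x s t] have "breakpoints x (Rel r s t) {}"
      by (simp add: breakpoints_def del: diff_ge_0_iff_ge)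
    then show ?thesis by blast
  next
    case False
    then have ne: "lincoeff (delta x :: nat \<Rightarrow> rat) s \<noteq> lincoeff (delta x) t"
      unfolding lincoeff_delta_eq_iff m_def by simp
    obtain t0 k0 where k0: "0 < k0" and t0: "\<And>v. of_int m * (rval v t0 / real k0) + rval v u = of_rat 0"
      using linear_root[OF False] by metis
    obtain t1 k1 where k1: "0 < k1"
      and t1: "\<And>v. of_int m * (rval v t1 / real k1) + rval v u = of_rat (Rep_posrat r)"
      using linear_root[OF False] by metis
    have *: "rsat (v(x := c)) (Rel r s t) \<longleftrightarrow>
        (if m > 0 then c \<ge> rval v t0 / real k0 \<and> c \<le> rval v t1 / real k1
         else c \<le> rval v t0 / real k0 \<and> c \<ge> rval v t1 / real k1)" for v c
    proof -
      have 0: "rval (v(x := c)) t - rval (v(x := c)) s = of_int m * (c - rval v t0 / real k0)"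
        unfolding g using t0[of v] by (simp add: algebra_simps)
      have 1: "rval (v(x := c)) t - rval (v(x := c)) s - rad r = of_int m * (c - rval v t1 / real k1)"
        unfolding g using t1[of v] by (simp add: algebra_simps rad_def)
      have "rsat (v(x := c)) (Rel r s t) \<longleftrightarrow>
          0 \<le> of_int m * (c - rval v t0 / real k0) \<and> of_int m * (c - rval v t1 / real k1) \<le> 0"
        unfolding 0[symmetric] 1[symmetric] by (simp del: fun_upd_apply)
      then show ?thesis using False by (auto simp: zero_le_mult_iff mult_le_0_iff)
    qed
    \<comment> \<open>The roots differ by \<open>rad r / m\<close>, so the sign of \<open>m\<close>
      tells which one is the left end of the interval.\<close>
    have "rval v t0 / real k0 < rval v t1 / real k1 \<longleftrightarrow> m > 0" for v
    proof -
      have "of_int m * (rval v t1 / real k1 - rval v t0 / real k0) = rad r"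
        using t0[of v] t1[of v] by (simp add: algebra_simps rad_def)
      then have "0 < of_int m * (rval v t1 / real k1 - rval v t0 / real k0)" by simp
      then show ?thesis unfolding zero_less_mult_iff by auto
    qed
    then have "breakpoints x (Rel r s t) {(t0, k0), (t1, k1)}"
      using k0 k1 ne unfolding breakpoints_def *
      by (simp del: sat.simps) (smt (verit))
    then show ?thesis by blast
  qed
next
  case (Neg \<phi>)
  then show ?case unfolding breakpoints_def by simp
next
  case (Conj \<phi> \<psi>)
  then obtain K L where "breakpoints x \<phi> K" "breakpoints x \<psi> L" by auto
  then have "breakpoints x (Conj \<phi> \<psi>) (K \<union> L)"
    unfolding breakpoints_def by (simp add: ball_Un) meson
  then show ?case by blast
qed simp

lemma ex_disjunction:
  assumes "finite X" "\<And>\<theta>. \<theta> \<in> X \<Longrightarrow> qf \<theta>"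
  shows "\<exists>\<chi>. qf \<chi> \<and> (\<forall>v. rsat v \<chi> \<longleftrightarrow> (\<exists>\<theta>\<in>X. rsat v \<theta>))"
  using assms
proof (induction X)
  case empty
  show ?case by (rule exI[of _ Bot]) simp
next
  case (insert \<theta> X)
  then obtain \<chi> where "qf \<chi>" "\<forall>v. rsat v \<chi> \<longleftrightarrow> (\<exists>\<theta>\<in>X. rsat v \<theta>)" by auto
  with insert.prems show ?case by (intro exI[of _ "Disj \<theta> \<chi>"]) auto
qed

lemma ex_greater_finite:
  assumes "finite (B :: real set)" shows "\<exists>c. \<forall>b\<in>B. b < c"
  using assms by (metis Max_ge gt_ex order_le_less_trans)

text \<open>A witness that is not beyond all breakpoints can be moved, inside its cell, to the
  midpoint of the two neighbouring breakpoints. Pairs with equal components are included, and they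
  account for witnesses that are breakpoints themselves.\<close>

theorem quantifier_elimination: "\<exists>\<psi>. qf \<psi> \<and> (\<forall>v. rsat v \<phi> \<longleftrightarrow> rsat v \<psi>)"
proof (induction \<phi>)
  case (Ex x \<phi>)
  then obtain \<psi> where \<psi>: "qf \<psi>" "\<forall>v. rsat v \<phi> \<longleftrightarrow> rsat v \<psi>" by blast
  obtain L where L: "breakpoints x \<psi> L" using ex_breakpoints[OF \<psi>(1)] by blast
  then have fin: "finite L" and pos: "\<And>t k. (t, k) \<in> L \<Longrightarrow> 0 < k"
    and cell: "\<And>v c c'. \<lbrakk>c \<le> c'; \<forall>(t, k)\<in>L. \<not> (c \<le> rval v t / real k \<and> rval v t / real k \<le> c')\<rbrakk>
          \<Longrightarrow> rsat (v(x := c)) \<psi> \<longleftrightarrow> rsat (v(x := c')) \<psi>"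
    and inf: "\<And>v c. (\<forall>(t, k)\<in>L. c < rval v t / real k) \<or> (\<forall>(t, k)\<in>L. c > rval v t / real k)
          \<Longrightarrow> rsat (v(x := c)) \<psi> \<longleftrightarrow> rsat v (drop_unbounded (delta x) \<psi>)"
    unfolding breakpoints_def by (blast, blast, blast, blast)
  \<comment> \<open>The midpoint of \<open>t / k\<close> and \<open>t' / k'\<close> is
    \<open>(k' t + k t') / (2 k k')\<close>.\<close>
  define mid where "mid = (\<lambda>((t, k), (t', k')). subst_fm x (2 * k * k') (Plus (Nmul k' t) (Nmul k t')) \<psi>)"
  have mid: "rsat v (mid ((t, k), (t', k'))) \<longleftrightarrow>
      rsat (v(x := (rval v t / real k + rval v t' / real k') / 2)) \<psi>"
    if "(t, k) \<in> L" "(t', k') \<in> L" for v t k t' k'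
  proof -
    have *: "rval v (Plus (Nmul k' t) (Nmul k t')) / real (2 * k * k')
        = (rval v t / real k + rval v t' / real k') / 2"
      using pos[OF that(1)] pos[OF that(2)] by (simp add: field_simps)
    have "0 < 2 * k * k'" using pos[OF that(1)] pos[OF that(2)] by simp
    from rsat_subst_fm[OF this \<psi>(1), of v x "Plus (Nmul k' t) (Nmul k t')"]
    show ?thesis unfolding mid_def prod.case * .
  qed
  obtain \<chi> where \<chi>: "qf \<chi>" "\<And>v. rsat v \<chi> \<longleftrightarrow> (\<exists>\<theta>\<in>mid ` (L \<times> L). rsat v \<theta>)"
  proof -
    have "qf \<theta>" if "\<theta> \<in> mid ` (L \<times> L)" for \<theta>
      using that \<psi>(1) by (auto simp: mid_def)
    with ex_disjunction[of "mid ` (L \<times> L)"] fin that show ?thesis by blast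
  qed
  have "(\<exists>c. rsat (v(x := c)) \<psi>) \<longleftrightarrow> rsat v (Disj (drop_unbounded (delta x) \<psi>) \<chi>)" for v
  proof
    assume "\<exists>c. rsat (v(x := c)) \<psi>"
    then obtain c where c: "rsat (v(x := c)) \<psi>" by blast
    define B where "B = (\<lambda>(t, k). rval v t / real k) ` L"
    have B: "finite B" using fin by (simp add: B_def)
    define lo where "lo = {b\<in>B. b \<le> c}"
    define hi where "hi = {b\<in>B. b \<ge> c}"
    show "rsat v (Disj (drop_unbounded (delta x) \<psi>) \<chi>)"
    proof (cases "lo = {} \<or> hi = {}")
      case True
      then have "(\<forall>(t, k)\<in>L. c < rval v t / real k) \<or> (\<forall>(t, k)\<in>L. c > rval v t / real k)"
        unfolding lo_def hi_def B_def by force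
      with inf c show ?thesis by auto
    next
      case False
      define l where "l = Max lo" define h where "h = Min hi"
      have "finite lo" "finite hi" using B by (auto simp: lo_def hi_def)
      then have "l \<in> lo" "h \<in> hi" using False by (simp_all add: l_def h_def)
      then have lh: "l \<in> B" "h \<in> B" "l \<le> c" "c \<le> h" by (auto simp: lo_def hi_def)
      have ext: "h \<le> b" if "b \<in> B" "c \<le> b" for b
        using that B by (auto simp: h_def hi_def)
      have ext': "b \<le> l" if "b \<in> B" "b \<le> c" for b
        using that B by (auto simp: l_def lo_def)
      have gap: "b \<le> l \<or> b \<ge> h" if "b \<in> B" for b
        using that ext ext' by fastforce
      obtain t k t' k' where tk: "(t, k) \<in> L" "(t', k') \<in> L"
        and l: "l = rval v t / real k" and h: "h = rval v t' / real k'"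
        using lh by (auto simp: B_def)
      have "rsat (v(x := (l + h) / 2)) \<psi>"
      proof (cases "c = l \<or> c = h")
        case True
        then have "l = h" using ext[of c] ext'[of c] lh by auto
        then show ?thesis using c lh by auto
      next
        case False
        have "b < min c ((l + h) / 2) \<or> b > max c ((l + h) / 2)" if "b \<in> B" for b
          using gap[OF that] lh False by auto
        then have "\<forall>(t, k)\<in>L. \<not> (min c ((l + h) / 2) \<le> rval v t / real k \<and> rval v t / real k \<le> max c ((l + h) / 2))"
          unfolding B_def by fastforce
        then have "rsat (v(x := min c ((l + h) / 2))) \<psi> \<longleftrightarrow> rsat (v(x := max c ((l + h) / 2))) \<psi>"
          by (intro cell) auto
        with c show ?thesis by (simp add: min_def max_def split: if_splits)
      qed
      with tk have "rsat v (mid ((t, k), (t', k')))" by (simp add: mid l h)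
      with tk \<chi>(2) show ?thesis by force
    qed
  next
    assume "rsat v (Disj (drop_unbounded (delta x) \<psi>) \<chi>)"
    then consider "rsat v (drop_unbounded (delta x) \<psi>)" | "rsat v \<chi>" by auto
    then show "\<exists>c. rsat (v(x := c)) \<psi>"
    proof cases
      case 1
      obtain c where "\<forall>b\<in>(\<lambda>(t, k). rval v t / real k) ` L. b < c"
        using ex_greater_finite fin by blast
      then have "\<forall>(t, k)\<in>L. c > rval v t / real k" by auto
      with 1 inf show ?thesis by blast
    next
      case 2
      with \<chi>(2) mid show ?thesis by fastforce
    qed
  qed
  with \<psi> \<chi>(1) show ?case
    by (intro exI[of _ "Disj (drop_unbounded (delta x) \<psi>) \<chi>"]) simp
next
  case (Eq s t)
  show ?case by (rule exI[of _ "Eq s t"]) simp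
next
  case (Rel r s t)
  show ?case by (rule exI[of _ "Rel r s t"]) simp
next
  case (Neg \<phi>)
  then obtain \<psi> where "qf \<psi>" "\<forall>v. rsat v \<phi> \<longleftrightarrow> rsat v \<psi>" by blast
  then show ?case by (intro exI[of _ "Neg \<psi>"]) simp
next
  case (Conj \<phi>1 \<phi>2)
  then obtain \<psi>1 \<psi>2 where "qf \<psi>1" "\<forall>v. rsat v \<phi>1 \<longleftrightarrow> rsat v \<psi>1"
    "qf \<psi>2" "\<forall>v. rsat v \<phi>2 \<longleftrightarrow> rsat v \<psi>2" by blast
  then show ?case by (intro exI[of _ "Conj \<psi>1 \<psi>2"]) simp
qed

section \<open>Representation by filtered families of reals\<close>

text \<open>The literals over \<open>X\<close> that are true in \<open>M\<close> have a conjunction.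
  If it were unsatisfiable in the reals, its negation would transfer to \<open>M\<close>.\<close>

lemma finite_agreement:
  assumes "is_model M T" "finite X" "\<And>i. v i \<in> universe M"
  shows "\<exists>u. \<forall>a\<in>X. rsat u a \<longleftrightarrow> sat M v a"
proof -
  have "\<exists>\<theta>. (\<forall>w. rsat w \<theta> \<longleftrightarrow> (\<forall>a\<in>Y. rsat w a)) \<and> (\<forall>w. sat M w \<theta> \<longleftrightarrow> (\<forall>a\<in>Y. sat M w a))"
    if "finite Y" for Y
    using that
  proof (induction Y)
    case empty
    show ?case by (rule exI[of _ "Eq One One"]) simp
  next
    case (insert a Y)
    then obtain \<theta> where "\<forall>w. rsat w \<theta> \<longleftrightarrow> (\<forall>a\<in>Y. rsat w a)" "\<forall>w. sat M w \<theta> \<longleftrightarrow> (\<forall>a\<in>Y. sat M w a)"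
      by auto
    then show ?case by (intro exI[of _ "Conj a \<theta>"]) auto
  qed
  from this[OF finite_imageI[OF assms(2), of "\<lambda>a. if sat M v a then a else Neg a"]]
  obtain \<theta> where \<theta>: "\<And>w. rsat w \<theta> \<longleftrightarrow> (\<forall>a\<in>X. rsat w (if sat M v a then a else Neg a))"
    "sat M v \<theta> \<longleftrightarrow> (\<forall>a\<in>X. sat M v (if sat M v a then a else Neg a))" unfolding ball_simps by blast
  have "sat M v \<theta>" using \<theta>(2) by auto
  then have "\<exists>u. rsat u \<theta>"
    using transfer[OF assms(1), of "Neg \<theta>" v] assms(3) by auto
  then show ?thesis using \<theta>(1) by (metis sat.simps(3))
qed

text \<open>A finite \<open>E\<close> is not closed under the operations, so they are respected only
  as far as their values stay in \<open>E\<close>.\<close>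

definition represents :: "'a Lstruct \<Rightarrow> 'a set \<Rightarrow> posrat set \<Rightarrow> ('a \<Rightarrow> real) \<Rightarrow> bool" where
  "represents M E R w \<longleftrightarrow> (one M \<in> E \<longrightarrow> w (one M) = 1) \<and>
     (\<forall>x\<in>E. \<forall>y\<in>E. (w x = w y \<longrightarrow> x = y) \<and> (neg M x \<in> E \<longrightarrow> w (neg M x) = - w x) \<and>
       (add M x y \<in> E \<longrightarrow> w (add M x y) = w x + w y) \<and>
       (\<forall>r\<in>R. rel M r x y \<longleftrightarrow> 0 \<le> w y - w x \<and> w y - w x \<le> rad r))"

lemma representsD:
  assumes "represents M E R w"
  shows "one M \<in> E \<Longrightarrow> w (one M) = 1"
    and "\<lbrakk>x \<in> E; y \<in> E; x \<noteq> y\<rbrakk> \<Longrightarrow> w x \<noteq> w y"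
    and "\<lbrakk>x \<in> E; neg M x \<in> E\<rbrakk> \<Longrightarrow> w (neg M x) = - w x"
    and "\<lbrakk>x \<in> E; y \<in> E; add M x y \<in> E\<rbrakk> \<Longrightarrow> w (add M x y) = w x + w y"
    and "\<lbrakk>x \<in> E; y \<in> E; r \<in> R\<rbrakk> \<Longrightarrow> rel M r x y \<longleftrightarrow> 0 \<le> w y - w x \<and> w y - w x \<le> rad r"
  using assms unfolding represents_def by meson+

text \<open>This is \<open>finite_agreement\<close> for the atomic diagram of \<open>E\<close> with
  radii in \<open>R\<close>; every element gets a variable, chosen by \<open>ix\<close>.\<close>

lemma ex_represents:
  assumes M: "is_model M T" and "finite E" "finite R" "E \<subseteq> universe M"
  shows "\<exists>w. represents M E R w"
proof -
  obtain es where es: "set es = E" using assms(2) finite_list by blast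
  have one: "one M \<in> universe M" using M by (simp add: is_model_def Lstructure_def)
  define v where "v = (\<lambda>i. if i < length es then es ! i else one M)"
  have v: "v i \<in> universe M" for i using one assms(4) es by (auto simp: v_def)
  define X where "X = (\<lambda>(i, j, k). Eq (Plus (Var i) (Var j)) (Var k)) ` ({..<length es} \<times> {..<length es} \<times> {..<length es})
    \<union> (\<lambda>(i, j). Eq (Minus (Var i)) (Var j)) ` ({..<length es} \<times> {..<length es})
    \<union> (\<lambda>i. Eq (Var i) One) ` {..<length es}
    \<union> (\<lambda>(i, j). Eq (Var i) (Var j)) ` ({..<length es} \<times> {..<length es})
    \<union> (\<lambda>(r, i, j). Rel r (Var i) (Var j)) ` (R \<times> {..<length es} \<times> {..<length es})"
  have "finite X" using assms(3) by (simp add: X_def)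
  then obtain u where u: "\<And>a. a \<in> X \<Longrightarrow> rsat u a \<longleftrightarrow> sat M v a"
    using finite_agreement[of M X v, OF M _ v] by blast
  define ix where "ix = (\<lambda>x. SOME i. i < length es \<and> es ! i = x)"
  have ix: "ix x < length es" "es ! ix x = x" if "x \<in> E" for x
  proof -
    have "\<exists>i. i < length es \<and> es ! i = x" using that unfolding es[symmetric] by (simp add: in_set_conv_nth)
    from someI_ex[OF this] show "ix x < length es" "es ! ix x = x" unfolding ix_def by blast+
  qed
  then have vix: "v (ix x) = x" if "x \<in> E" for x using ix[OF that] by (simp add: v_def)
  have add: "u (ix x) + u (ix y) = u (ix z) \<longleftrightarrow> add M x y = z" if "x \<in> E" "y \<in> E" "z \<in> E" for x y z
  proof -
    have "Eq (Plus (Var (ix x)) (Var (ix y))) (Var (ix z)) \<in> X"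
      using that ix unfolding X_def by (auto simp: image_iff)
    from u[OF this] show ?thesis using that by (simp add: vix)
  qed
  have neg: "- u (ix x) = u (ix y) \<longleftrightarrow> neg M x = y" if "x \<in> E" "y \<in> E" for x y
  proof -
    have "Eq (Minus (Var (ix x))) (Var (ix y)) \<in> X"
      using that ix unfolding X_def by (auto simp: image_iff)
    from u[OF this] show ?thesis using that by (simp add: vix)
  qed
  have eq: "u (ix x) = u (ix y) \<longleftrightarrow> x = y" if "x \<in> E" "y \<in> E" for x y
  proof -
    have "Eq (Var (ix x)) (Var (ix y)) \<in> X"
      using that ix unfolding X_def by (auto simp: image_iff)
    from u[OF this] show ?thesis using that by (simp add: vix)
  qed
  have one: "u (ix x) = 1 \<longleftrightarrow> x = one M" if "x \<in> E" for x
  proof -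
    have "Eq (Var (ix x)) One \<in> X"
      using that ix unfolding X_def by (auto simp: image_iff)
    from u[OF this] show ?thesis using that by (simp add: vix)
  qed
  have rel: "0 \<le> u (ix y) - u (ix x) \<and> u (ix y) - u (ix x) \<le> rad r \<longleftrightarrow> rel M r x y"
    if "x \<in> E" "y \<in> E" "r \<in> R" for x y r
  proof -
    have "Rel r (Var (ix x)) (Var (ix y)) \<in> X"
      using that ix unfolding X_def by (auto simp: image_iff)
    from u[OF this] show ?thesis using that by (simp add: vix)
  qed
  have "represents M E R (\<lambda>x. u (ix x))"
    unfolding represents_def
  proof (intro conjI impI ballI)
    show "u (ix (one M)) = 1" if "one M \<in> E" using one that by blast
    fix x y assume xy: "x \<in> E" "y \<in> E"
    show "x = y" if "u (ix x) = u (ix y)" using eq xy that by blast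
    show "u (ix (neg M x)) = - u (ix x)" if "neg M x \<in> E" using neg xy that by metis
    show "u (ix (add M x y)) = u (ix x) + u (ix y)" if "add M x y \<in> E" using add xy that by metis
    show "rel M r x y \<longleftrightarrow> 0 \<le> u (ix y) - u (ix x) \<and> u (ix y) - u (ix x) \<le> rad r" if "r \<in> R" for r
      using rel xy that by blast
  qed
  then show ?thesis by blast
qed

text \<open>A model of \<open>T\<close> carries only a local order, so no ordered group is at hand for calculations. They
  are instead carried out pointwise: every element of \<open>M\<close> is represented by a family of reals,
  modulo a filter that decides all atomic formulas.\<close>

locale hyperreal =
  fixes M :: "'a Lstruct" and U :: "'i filter" and \<rho> :: "'a \<Rightarrow> 'i \<Rightarrow> real"
  assumes model: "is_model M T" and U [simp]: "U \<noteq> bot"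
    and ev_one: "\<forall>\<^sub>F i in U. \<rho> (one M) i = 1"
    and ev_neg: "x \<in> universe M \<Longrightarrow> \<forall>\<^sub>F i in U. \<rho> (neg M x) i = - \<rho> x i"
    and ev_add: "\<lbrakk>x \<in> universe M; y \<in> universe M\<rbrakk> \<Longrightarrow> \<forall>\<^sub>F i in U. \<rho> (add M x y) i = \<rho> x i + \<rho> y i"
    and ev_neq: "\<lbrakk>x \<in> universe M; y \<in> universe M; x \<noteq> y\<rbrakk> \<Longrightarrow> \<forall>\<^sub>F i in U. \<rho> x i \<noteq> \<rho> y i"
    and ev_rel: "\<lbrakk>x \<in> universe M; y \<in> universe M; rel M r x y\<rbrakk>
        \<Longrightarrow> \<forall>\<^sub>F i in U. 0 \<le> \<rho> y i - \<rho> x i \<and> \<rho> y i - \<rho> x i \<le> rad r"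
    and ev_not_rel: "\<lbrakk>x \<in> universe M; y \<in> universe M; \<not> rel M r x y\<rbrakk>
        \<Longrightarrow> \<forall>\<^sub>F i in U. \<not> (0 \<le> \<rho> y i - \<rho> x i \<and> \<rho> y i - \<rho> x i \<le> rad r)"

text \<open>An index is a finite set of pairs; its projections are the elements and the radii that
  the representation chosen there has to respect. Each representation agrees with \<open>M\<close>
  outright on the atoms it covers, so this filter decides all atoms although it need not be an
  ultrafilter.\<close>

lemma ex_hyperreal:
  assumes M: "is_model M (T :: fm set)"
  shows "\<exists>(U :: ('a \<times> posrat) set filter) \<rho>. hyperreal (M :: 'a Lstruct) U \<rho>"
proof -
  define U where "U = finite_subsets_at_top (universe M \<times> (UNIV :: posrat set))"
  have cl: "one M \<in> universe M" "\<And>x. x \<in> universe M \<Longrightarrow> neg M x \<in> universe M"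
      "\<And>x y. \<lbrakk>x \<in> universe M; y \<in> universe M\<rbrakk> \<Longrightarrow> add M x y \<in> universe M"
    using M by (auto simp: is_model_def Lstructure_def)
  define \<rho> where "\<rho> = (\<lambda>x i. (SOME w. represents M (fst ` i) (snd ` i) w) x)"
  have "represents M (fst ` i) (snd ` i) (\<lambda>x. \<rho> x i)" if "finite i" "i \<subseteq> universe M \<times> UNIV" for i
    unfolding \<rho>_def using someI_ex[OF ex_represents[OF M, of "fst ` i" "snd ` i"]] that by force
  then have rep: "\<forall>\<^sub>F i in U. represents M (fst ` i) (snd ` i) (\<lambda>x. \<rho> x i)"
    unfolding U_def eventually_finite_subsets_at_top by auto
  have inE: "\<forall>\<^sub>F i in U. x \<in> fst ` i" if "x \<in> universe M" for x
    unfolding U_def eventually_finite_subsets_at_top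
    by (rule exI[of _ "{(x, undefined)}"]) (use that in force)
  have inR: "\<forall>\<^sub>F i in U. r \<in> snd ` i" for r
    unfolding U_def eventually_finite_subsets_at_top
    by (rule exI[of _ "{(one M, r)}"]) (use cl in force)
  have "hyperreal M U \<rho>"
  proof
    show "U \<noteq> bot" by (simp add: U_def)
    show "\<forall>\<^sub>F i in U. \<rho> (one M) i = 1"
      using rep inE[OF cl(1)] by eventually_elim (rule representsD)
    fix x assume x: "x \<in> universe M"
    show "\<forall>\<^sub>F i in U. \<rho> (neg M x) i = - \<rho> x i"
      using rep inE[OF x] inE[OF cl(2)[OF x]] by eventually_elim (rule representsD)
    fix y assume y: "y \<in> universe M"
    show "\<forall>\<^sub>F i in U. \<rho> (add M x y) i = \<rho> x i + \<rho> y i"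
      using rep inE[OF x] inE[OF y] inE[OF cl(3)[OF x y]]
      by eventually_elim (rule representsD)
    show "\<forall>\<^sub>F i in U. \<rho> x i \<noteq> \<rho> y i" if "x \<noteq> y"
      using rep inE[OF x] inE[OF y] by eventually_elim (use that in \<open>metis representsD(2)\<close>)
    fix r
    show "\<forall>\<^sub>F i in U. 0 \<le> \<rho> y i - \<rho> x i \<and> \<rho> y i - \<rho> x i \<le> rad r" if "rel M r x y"
      using rep inE[OF x] inE[OF y] inR[of r]
      by eventually_elim (use that in \<open>simp add: representsD\<close>)
    show "\<forall>\<^sub>F i in U. \<not> (0 \<le> \<rho> y i - \<rho> x i \<and> \<rho> y i - \<rho> x i \<le> rad r)" if "\<not> rel M r x y"
      using rep inE[OF x] inE[OF y] inR[of r]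
      by eventually_elim (use that in \<open>simp add: representsD\<close>)
  qed fact
  then show ?thesis by blast
qed

definition qe :: "fm \<Rightarrow> fm" where
  "qe \<phi> = (SOME \<psi>. qf \<psi> \<and> (\<forall>v. rsat v \<phi> \<longleftrightarrow> rsat v \<psi>))"

lemma qf_qe [simp]: "qf (qe \<phi>)" and rsat_qe: "rsat v (qe \<phi>) \<longleftrightarrow> rsat v \<phi>"
  using someI_ex[OF quantifier_elimination[of \<phi>]] unfolding qe_def by blast+

text \<open>The choice of \<open>qe\<close> leaves its free variables open, so every value of
  \<open>v\<close>, not only those at the free variables of \<open>\<phi>\<close>, has to lie in
  \<open>M\<close>.\<close>

lemma sat_qe:
  assumes "is_model M T" "\<And>i. v i \<in> universe M"
  shows "sat M v (qe \<phi>) \<longleftrightarrow> sat M v \<phi>"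
  using transfer[OF assms(1), of "Disj (Conj \<phi> (qe \<phi>)) (Conj (Neg \<phi>) (Neg (qe \<phi>)))" v] assms(2)
  by (auto simp: rsat_qe)

lemma ex_divide:
  assumes "is_model M T" "x \<in> universe M" "0 < n"
  shows "\<exists>z\<in>universe M. mult M n z = x"
proof -
  have "sat M (\<lambda>_. x) (Ex 1 (Eq (Nmul n (Var 1)) (Var 0)))"
  proof (rule transfer[OF assms(1)])
    fix w
    show "rsat w (Ex 1 (Eq (Nmul n (Var 1)) (Var 0)))"
      using assms(3) by (auto intro!: exI[of _ "w 0 / real n"])
  qed (use assms(2) in auto)
  then show ?thesis by simp
qed

section \<open>Rational linear algebra and bounded distance in a model\<close>

context hyperreal
begin

abbreviation lincomb :: "'a \<Rightarrow> rat \<Rightarrow> 'a \<Rightarrow> rat \<Rightarrow> 'a \<Rightarrow> bool" where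
  "lincomb z p x q y \<equiv> \<forall>\<^sub>F i in U. \<rho> z i = of_rat p * \<rho> x i + of_rat q * \<rho> y i"

abbreviation affine :: "'a \<Rightarrow> rat \<Rightarrow> 'a \<Rightarrow> 'a \<Rightarrow> bool" where
  "affine y a x e \<equiv> \<forall>\<^sub>F i in U. \<rho> y i = of_rat a * \<rho> x i + \<rho> e i"

abbreviation close :: "'a \<Rightarrow> 'a \<Rightarrow> nat \<Rightarrow> bool" where
  "close x y n \<equiv> \<forall>\<^sub>F i in U. \<bar>\<rho> x i - \<rho> y i\<bar> \<le> real n"

lemma one_closed [simp]: "one M \<in> universe M"
  and neg_closed [simp]: "x \<in> universe M \<Longrightarrow> neg M x \<in> universe M"
  and add_closed [simp]: "\<lbrakk>x \<in> universe M; y \<in> universe M\<rbrakk> \<Longrightarrow> add M x y \<in> universe M"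
  using model by (auto simp: is_model_def Lstructure_def)

lemma zero_closed [simp]: "zero M \<in> universe M"
  and diff_closed [simp]: "\<lbrakk>x \<in> universe M; y \<in> universe M\<rbrakk> \<Longrightarrow> diff M x y \<in> universe M"
  by (simp_all add: zero_def diff_def)

lemma mult_closed [simp]: "x \<in> universe M \<Longrightarrow> mult M n x \<in> universe M"
  by (induction n) auto

lemma tm_val_in [simp]: "(\<And>i. v i \<in> universe M) \<Longrightarrow> tm_val M v t \<in> universe M"
  by (induction t) auto

lemma ev_zero: "\<forall>\<^sub>F i in U. \<rho> (zero M) i = 0"
  using ev_add[OF one_closed neg_closed[OF one_closed]] ev_neg[OF one_closed]
  unfolding zero_def by eventually_elim simp

lemma ev_diff: "\<lbrakk>x \<in> universe M; y \<in> universe M\<rbrakk> \<Longrightarrow> \<forall>\<^sub>F i in U. \<rho> (diff M x y) i = \<rho> x i - \<rho> y i"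
  using ev_add[of x "neg M y"] ev_neg[of y] unfolding diff_def by simp (elim eventually_rev_mp, simp)

lemma ev_mult: "x \<in> universe M \<Longrightarrow> \<forall>\<^sub>F i in U. \<rho> (mult M n x) i = real n * \<rho> x i"
proof (induction n)
  case 0
  then show ?case using ev_zero by simp
next
  case (Suc n)
  have "\<forall>\<^sub>F i in U. \<rho> (mult M n x) i = real n * \<rho> x i" using Suc by blast
  then show ?case using ev_add[OF mult_closed[OF Suc.prems, of n] Suc.prems]
    by eventually_elim (simp add: algebra_simps)
qed

lemma eq_if_ev_eq:
  assumes "x \<in> universe M" "y \<in> universe M" "\<forall>\<^sub>F i in U. \<rho> x i = \<rho> y i"
  shows "x = y"
proof (rule ccontr)
  assume "x \<noteq> y"
  from ev_neq[OF assms(1,2) this] assms(3) have "\<forall>\<^sub>F i in U. False" by eventually_elim simp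
  then show False by simp
qed

lemma eq_iff_ev: "\<lbrakk>x \<in> universe M; y \<in> universe M\<rbrakk> \<Longrightarrow> x = y \<longleftrightarrow> (\<forall>\<^sub>F i in U. \<rho> x i = \<rho> y i)"
  using eq_if_ev_eq by auto

lemma rel_iff_ev:
  assumes "x \<in> universe M" "y \<in> universe M"
  shows "rel M r x y \<longleftrightarrow> (\<forall>\<^sub>F i in U. 0 \<le> \<rho> y i - \<rho> x i \<and> \<rho> y i - \<rho> x i \<le> rad r)"
proof (cases "rel M r x y")
  case False
  have "\<not> (\<forall>\<^sub>F i in U. 0 \<le> \<rho> y i - \<rho> x i \<and> \<rho> y i - \<rho> x i \<le> rad r)"
  proof
    assume "\<forall>\<^sub>F i in U. 0 \<le> \<rho> y i - \<rho> x i \<and> \<rho> y i - \<rho> x i \<le> rad r"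
    with ev_not_rel[OF assms False] have "\<forall>\<^sub>F i in U. False" by eventually_elim simp
    then show False by simp
  qed
  with False show ?thesis by simp
qed (use ev_rel[OF assms] in auto)

lemma ev_tm_val:
  assumes "\<And>k. v k \<in> universe M"
  shows "\<forall>\<^sub>F i in U. \<rho> (tm_val M v t) i = rval (\<lambda>k. \<rho> (v k) i) t"
proof (induction t)
  case One
  show ?case using ev_one by simp
next
  case (Minus t)
  then show ?case using ev_neg[OF tm_val_in[of v t]] assms by simp (elim eventually_rev_mp, simp)
next
  case (Plus s t)
  then show ?case using ev_add[OF tm_val_in[of v s] tm_val_in[of v t]] assms
    by simp (elim eventually_rev_mp, simp)
qed simp

lemma ev_rsat_iff_sat_qf:
  assumes "\<And>k. v k \<in> universe M" "qf \<phi>"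
  shows "\<forall>\<^sub>F i in U. rsat (\<lambda>k. \<rho> (v k) i) \<phi> \<longleftrightarrow> sat M v \<phi>"
  using assms(2)
proof (induction \<phi>)
  case (Eq s t)
  have in_M: "tm_val M v s \<in> universe M" "tm_val M v t \<in> universe M" using assms(1) by auto
  show ?case
  proof (cases "tm_val M v s = tm_val M v t")
    case True
    then show ?thesis using ev_tm_val[of v s, OF assms(1)] ev_tm_val[of v t, OF assms(1)]
      by simp (elim eventually_rev_mp, simp)
  next
    case False
    from ev_neq[OF in_M False] show ?thesis
      using ev_tm_val[of v s, OF assms(1)] ev_tm_val[of v t, OF assms(1)] False
      by simp (elim eventually_rev_mp, simp)
  qed
next
  case (Rel r s t)
  have in_M: "tm_val M v s \<in> universe M" "tm_val M v t \<in> universe M" using assms(1) by auto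
  show ?case
  proof (cases "rel M r (tm_val M v s) (tm_val M v t)")
    case True
    from ev_rel[OF in_M this] show ?thesis
      using ev_tm_val[of v s, OF assms(1)] ev_tm_val[of v t, OF assms(1)] True
      by simp (elim eventually_rev_mp, simp)
  next
    case False
    from ev_not_rel[OF in_M False] show ?thesis
      using ev_tm_val[of v s, OF assms(1)] ev_tm_val[of v t, OF assms(1)] False
      by simp (elim eventually_rev_mp, simp)
  qed
next
  case (Neg \<phi>)
  then have "\<forall>\<^sub>F i in U. rsat (\<lambda>k. \<rho> (v k) i) \<phi> \<longleftrightarrow> sat M v \<phi>" by simp
  then show ?case by eventually_elim simp
next
  case (Conj \<phi> \<psi>)
  then have "\<forall>\<^sub>F i in U. rsat (\<lambda>k. \<rho> (v k) i) \<phi> \<longleftrightarrow> sat M v \<phi>"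
    "\<forall>\<^sub>F i in U. rsat (\<lambda>k. \<rho> (v k) i) \<psi> \<longleftrightarrow> sat M v \<psi>" by simp_all
  then show ?case by eventually_elim simp
qed simp

text \<open>A form of the theorem of Los for a filter that need not be maximal: atoms are decided,
  hence all quantifier-free formulas, and \<open>qe\<close> reduces the others to these.\<close>

lemma ev_rsat_iff_sat:
  assumes "\<And>k. v k \<in> universe M"
  shows "\<forall>\<^sub>F i in U. rsat (\<lambda>k. \<rho> (v k) i) \<phi> \<longleftrightarrow> sat M v \<phi>"
  using ev_rsat_iff_sat_qf[of v "qe \<phi>"] sat_qe[OF model, of v \<phi>] assms by (simp add: rsat_qe)

text \<open>These are the rational vector subspaces that contain 1. The structure has no scalar
  multiplication, so a combination is recognized by its representing family.\<close>

definition subspace :: "'a set \<Rightarrow> bool" where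
  "subspace X \<longleftrightarrow> X \<subseteq> universe M \<and> one M \<in> X \<and>
     (\<forall>x\<in>X. \<forall>y\<in>X. \<forall>z\<in>universe M. \<forall>p q :: rat.
        (lincomb z p x q y) \<longrightarrow> z \<in> X)"

lemma subspaceD:
  assumes "subspace X"
  shows "x \<in> X \<Longrightarrow> x \<in> universe M" "one M \<in> X"
    "\<lbrakk>x \<in> X; y \<in> X; z \<in> universe M; \<forall>\<^sub>F i in U. \<rho> z i = of_rat p * \<rho> x i + of_rat q * \<rho> y i\<rbrakk> \<Longrightarrow> z \<in> X"
  using assms unfolding subspace_def by blast+

lemma ex_scale:
  assumes X: "X \<subseteq> universe M" "one M \<in> X" "\<And>x. x \<in> X \<Longrightarrow> neg M x \<in> X"
    "\<And>x y. \<lbrakk>x \<in> X; y \<in> X\<rbrakk> \<Longrightarrow> add M x y \<in> X"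
    "\<And>x n. \<lbrakk>x \<in> X; 0 < n\<rbrakk> \<Longrightarrow> \<exists>z\<in>X. mult M n z = x"
    and x: "x \<in> X"
  shows "\<exists>z\<in>X. \<forall>\<^sub>F i in U. \<rho> z i = of_rat p * \<rho> x i"
proof -
  obtain a b where ab: "quotient_of p = (a, b)" by fastforce
  then have b: "b > 0" and p: "p = of_int a / of_int b"
    using quotient_of_denom_pos quotient_of_div by auto
  obtain u where u: "u \<in> X" "mult M (nat b) u = x" using X(5)[OF x, of "nat b"] b by auto
  have uM: "u \<in> universe M" using u X by auto
  have "zero M \<in> X" using X unfolding zero_def by blast
  then have mult: "mult M n u \<in> X" for n by (induction n) (auto intro: X u)
  define z where "z = (if a \<ge> 0 then mult M (nat a) u else neg M (mult M (nat (- a)) u))"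
  have zX: "z \<in> X" using mult X by (simp add: z_def)
  have *: "\<forall>\<^sub>F i in U. \<rho> x i = of_int b * \<rho> u i" using ev_mult[OF uM, of "nat b"] b u by simp
  have "\<forall>\<^sub>F i in U. \<rho> z i = of_int a * \<rho> u i"
  proof (cases "a \<ge> 0")
    case True
    then show ?thesis using ev_mult[OF uM, of "nat a"] by (simp add: z_def)
  next
    case False
    then show ?thesis using ev_mult[OF uM, of "nat (- a)"] ev_neg[OF mult_closed[OF uM, of "nat (- a)"]]
      unfolding z_def by simp (elim eventually_rev_mp, simp)
  qed
  with * have "\<forall>\<^sub>F i in U. \<rho> z i = of_rat p * \<rho> x i"
    by eventually_elim (use b in \<open>simp add: p of_rat_divide\<close>)
  with zX show ?thesis by blast
qed

lemma subspaceI: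
  assumes X: "X \<subseteq> universe M" "one M \<in> X" "\<And>x. x \<in> X \<Longrightarrow> neg M x \<in> X"
    "\<And>x y. \<lbrakk>x \<in> X; y \<in> X\<rbrakk> \<Longrightarrow> add M x y \<in> X"
    "\<And>x n. \<lbrakk>x \<in> X; 0 < n\<rbrakk> \<Longrightarrow> \<exists>z\<in>X. mult M n z = x"
  shows "subspace X"
  unfolding subspace_def
proof (intro conjI ballI allI impI)
  fix x y z p q assume xyz: "x \<in> X" "y \<in> X" "z \<in> universe M"
    and z: "lincomb z p x q y"
  obtain u where u: "u \<in> X" "\<forall>\<^sub>F i in U. \<rho> u i = of_rat p * \<rho> x i"
    using ex_scale[OF X xyz(1)] by blast
  obtain w where w: "w \<in> X" "\<forall>\<^sub>F i in U. \<rho> w i = of_rat q * \<rho> y i"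
    using ex_scale[OF X xyz(2)] by blast
  have uw: "u \<in> universe M" "w \<in> universe M" using u w X(1) by auto
  have "\<forall>\<^sub>F i in U. \<rho> z i = \<rho> (add M u w) i"
    using ev_add[OF uw] u(2) w(2) z by eventually_elim simp
  then have "z = add M u w" by (rule eq_if_ev_eq[OF xyz(3) add_closed[OF uw]])
  then show "z \<in> X" using X u w by blast
qed (use X in auto)

lemma ex_comb:
  assumes "x \<in> universe M" "y \<in> universe M"
  obtains z where "z \<in> universe M" "lincomb z p x q y"
proof -
  obtain u where u: "u \<in> universe M" "\<forall>\<^sub>F i in U. \<rho> u i = of_rat p * \<rho> x i"
    using ex_scale[of "universe M" x p] ex_divide[OF model] assms by auto
  obtain w where w: "w \<in> universe M" "\<forall>\<^sub>F i in U. \<rho> w i = of_rat q * \<rho> y i"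
    using ex_scale[of "universe M" y q] ex_divide[OF model] assms by auto
  have "lincomb (add M u w) p x q y"
    using ev_add[OF u(1) w(1)] u(2) w(2) by eventually_elim simp
  from that[OF add_closed[OF u(1) w(1)] this] show ?thesis .
qed

lemma ex_comb_in:
  assumes "subspace X" "x \<in> X" "y \<in> X"
  obtains z where "z \<in> X" "lincomb z p x q y"
  using ex_comb[of x y p q] subspaceD[OF assms(1)] assms(2,3) by metis

lemma subspace_add:
  assumes "subspace X" "x \<in> X" "y \<in> X" shows "add M x y \<in> X"
proof -
  have "x \<in> universe M" "y \<in> universe M" using subspaceD(1) assms by blast+
  with ev_add[of x y] show ?thesis by (intro subspaceD(3)[OF assms, of _ 1 1]) auto
qed

lemma subspace_neg:
  assumes "subspace X" "x \<in> X" shows "neg M x \<in> X"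
proof -
  have "x \<in> universe M" using subspaceD(1) assms by blast
  with ev_neg[of x] show ?thesis by (intro subspaceD(3)[OF assms(1) assms(2,2), of _ "-1" 0]) auto
qed

lemma subspace_tm_val: "\<lbrakk>subspace X; \<And>k. v k \<in> X\<rbrakk> \<Longrightarrow> tm_val M v t \<in> X"
  by (induction t) (simp_all add: subspace_add subspace_neg subspaceD(2))

text \<open>For a subspace \<open>V\<close>, elements outside \<open>nearby V\<close> play the role of the unknown tending to
  infinity in \<open>drop_unbounded\<close>.\<close>

definition nearby :: "'a set \<Rightarrow> 'a set" where
  "nearby V = {x \<in> universe M. \<exists>w\<in>V. \<exists>n. (close x w n)}"

lemma subset_nearby: "V \<subseteq> universe M \<Longrightarrow> V \<subseteq> nearby V"
proof
  fix x assume "V \<subseteq> universe M" "x \<in> V"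
  moreover have "close x x 0" by simp
  ultimately show "x \<in> nearby V" unfolding nearby_def by blast
qed

lemma subspace_nearby:
  assumes V: "subspace V"
  shows "subspace (nearby V)"
  unfolding subspace_def
proof (intro conjI ballI allI impI)
  show "one M \<in> nearby V" using subset_nearby[of V] subspaceD(1,2)[OF V] by blast
  fix x y z p q assume x: "x \<in> nearby V" and y: "y \<in> nearby V" and "z \<in> universe M"
    and z: "lincomb z p x q y"
  from x obtain x' m where x': "x' \<in> V" "close x x' m" by (auto simp: nearby_def)
  from y obtain y' n where y': "y' \<in> V" "close y y' n" by (auto simp: nearby_def)
  obtain z' where z': "z' \<in> V" "lincomb z' p x' q y'"
    using ex_comb_in[OF V x'(1) y'(1)] by blast
  define k where "k = nat \<lceil>\<bar>of_rat p\<bar> * real m + \<bar>of_rat q\<bar> * real n\<rceil>"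
  have k: "\<bar>of_rat p\<bar> * real m + \<bar>of_rat q\<bar> * real n \<le> real k" unfolding k_def by linarith
  have "close z z' k"
    using z z'(2) x'(2) y'(2)
  proof eventually_elim
    case (elim i)
    have "\<bar>\<rho> z i - \<rho> z' i\<bar> = \<bar>of_rat p * (\<rho> x i - \<rho> x' i) + of_rat q * (\<rho> y i - \<rho> y' i)\<bar>"
      using elim by (simp add: algebra_simps)
    also have "\<dots> \<le> \<bar>of_rat p\<bar> * \<bar>\<rho> x i - \<rho> x' i\<bar> + \<bar>of_rat q\<bar> * \<bar>\<rho> y i - \<rho> y' i\<bar>"
      unfolding abs_mult[symmetric] by (rule abs_triangle_ineq)
    also have "\<dots> \<le> \<bar>of_rat p\<bar> * real m + \<bar>of_rat q\<bar> * real n"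
      using elim by (intro add_mono mult_left_mono) auto
    finally show ?case using k by linarith
  qed
  with z'(1) \<open>z \<in> universe M\<close> show "z \<in> nearby V" by (auto simp: nearby_def)
qed (simp add: nearby_def)

text \<open>A rational bound can be stated with \<open>rel\<close> and \<open>zero M\<close>, and
  the filter decides \<open>rel\<close>. For arbitrary statements about representing families there
  is no such dichotomy.\<close>

lemma ev_abs_le_cases:
  assumes "x \<in> universe M" "0 < q"
  shows "(\<forall>\<^sub>F i in U. \<bar>\<rho> x i\<bar> \<le> of_rat q) \<or> (\<forall>\<^sub>F i in U. \<bar>\<rho> x i\<bar> > of_rat q)"
proof -
  obtain r where r: "rad r = of_rat q" using obtain_rad[OF assms(2)] by blast
  consider "rel M r (zero M) x" | "rel M r x (zero M)" | "\<not> rel M r (zero M) x" "\<not> rel M r x (zero M)"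
    by blast
  then show ?thesis
  proof cases
    case 1
    have "\<forall>\<^sub>F i in U. \<bar>\<rho> x i\<bar> \<le> of_rat q"
      using ev_rel[OF zero_closed assms(1) 1] ev_zero by eventually_elim (use r in auto)
    then show ?thesis ..
  next
    case 2
    have "\<forall>\<^sub>F i in U. \<bar>\<rho> x i\<bar> \<le> of_rat q"
      using ev_rel[OF assms(1) zero_closed 2] ev_zero by eventually_elim (use r in auto)
    then show ?thesis ..
  next
    case 3
    have "\<forall>\<^sub>F i in U. \<bar>\<rho> x i\<bar> > of_rat q"
      using ev_not_rel[OF zero_closed assms(1) 3(1)] ev_not_rel[OF assms(1) zero_closed 3(2)] ev_zero
      by eventually_elim (use r in auto)
    then show ?thesis ..
  qed
qed

text \<open>If \<open>z = a x + b\<close> were bounded, it would be close to 0 and thus in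
  \<open>nearby V\<close>, and so would \<open>x = (z - b) / a\<close>.\<close>

lemma unbounded_outside_nearby:
  assumes V: "subspace V" and x: "x \<in> universe M" "x \<notin> nearby V" and b: "b \<in> nearby V" and "a \<noteq> 0"
  shows "\<forall>\<^sub>F i in U. \<bar>of_rat a * \<rho> x i + \<rho> b i\<bar> > real n"
proof -
  have bM: "b \<in> universe M" using b by (simp add: nearby_def)
  obtain z where z: "z \<in> universe M" "lincomb z a x 1 b"
    using ex_comb[OF x(1) bM] by blast
  \<comment> \<open>Radii are positive and \<open>n\<close> may be 0, so \<open>n + 1\<close> is
    used as the bound.\<close>
  have q: "0 < rat_of_nat n + 1" by (simp add: add_pos_nonneg add.commute)
  have "\<not> (\<forall>\<^sub>F i in U. \<bar>\<rho> z i\<bar> \<le> of_rat (of_nat n + 1))"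
  proof
    assume le: "\<forall>\<^sub>F i in U. \<bar>\<rho> z i\<bar> \<le> of_rat (of_nat n + 1)"
    have "zero M \<in> V" using V unfolding zero_def by (simp add: subspace_add subspace_neg subspaceD(2))
    moreover have "close z (zero M) (Suc n)"
      using le ev_zero by eventually_elim (simp add: of_rat_add)
    ultimately have "z \<in> nearby V"
      using z(1) unfolding nearby_def by blast
    moreover have "lincomb x (1 / a) z (- 1 / a) b"
      using z(2) by eventually_elim (use \<open>a \<noteq> 0\<close> in \<open>simp add: of_rat_divide of_rat_minus field_simps\<close>)
    ultimately have "x \<in> nearby V" using subspaceD(3)[OF subspace_nearby[OF V]] b x(1) by blast
    with x(2) show False ..
  qed
  then have "\<forall>\<^sub>F i in U. \<bar>\<rho> z i\<bar> > of_rat (of_nat n + 1)"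
    using ev_abs_le_cases[OF z(1) q] by blast
  with z(2) show ?thesis by eventually_elim (simp add: of_rat_add)
qed

text \<open>An atom depends on the difference of its two terms. If the coefficients of
  \<open>x\<close> cancel, the difference is the one computed from the parts \<open>b k\<close>;
  otherwise it is unbounded and the atom is false. Which case occurs depends on \<open>a\<close>
  alone, so truth is read off from \<open>a\<close> and \<open>b\<close>.\<close>

lemma sat_drop_unbounded:
  assumes V: "subspace V" and x: "x \<in> universe M" "x \<notin> nearby V"
    and b: "\<And>k. b k \<in> nearby V" and v: "\<And>k. v k \<in> universe M"
    and vb: "\<And>k. affine (v k) (a k) x (b k)"
    and "qf \<phi>"
  shows "sat M v \<phi> \<longleftrightarrow> sat M b (drop_unbounded a \<phi>)"
proof -
  have bM: "b k \<in> universe M" for k using b[of k] by (simp add: nearby_def)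
  have tm: "affine (tm_val M v t) (lincoeff a t) x (tm_val M b t)" for t
  proof (induction t)
    case (Var k)
    show ?case using vb by simp
  next
    case (Minus t)
    have "tm_val M v t \<in> universe M" "tm_val M b t \<in> universe M" using v bM by auto
    from ev_neg[OF this(1)] ev_neg[OF this(2)] Minus show ?case
      unfolding tm_val.simps by eventually_elim (simp add: of_rat_minus)
  next
    case (Plus s t)
    have st: "tm_val M v s \<in> universe M" "tm_val M b s \<in> universe M"
      "tm_val M v t \<in> universe M" "tm_val M b t \<in> universe M" using v bM by auto
    from ev_add[OF st(1,3)] ev_add[OF st(2,4)] Plus show ?case
      unfolding tm_val.simps by eventually_elim (simp add: of_rat_add algebra_simps)
  qed simp
  have far: "\<forall>\<^sub>F i in U. \<bar>\<rho> (tm_val M v t) i - \<rho> (tm_val M v s) i\<bar> > real n"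
    if "lincoeff a s \<noteq> lincoeff a t" for s t n
  proof -
    have st: "tm_val M b s \<in> nearby V" "tm_val M b t \<in> nearby V"
      using subspace_tm_val[OF subspace_nearby[OF V]] b by blast+
    obtain c where c: "c \<in> nearby V"
      "lincomb c 1 (tm_val M b t) (- 1) (tm_val M b s)"
      using ex_comb_in[OF subspace_nearby[OF V] st(2,1)] by blast
    have "lincoeff a t - lincoeff a s \<noteq> 0" using that by simp
    from unbounded_outside_nearby[OF V x c(1) this, of n] c(2) tm[of s] tm[of t]
    show ?thesis by eventually_elim (simp add: of_rat_diff of_rat_minus algebra_simps)
  qed
  have near: "\<forall>\<^sub>F i in U. \<rho> (tm_val M v t) i - \<rho> (tm_val M v s) i = \<rho> (tm_val M b t) i - \<rho> (tm_val M b s) i"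
    if "lincoeff a s = lincoeff a t" for s t
    using tm[of s] tm[of t] by eventually_elim (simp add: that)
  have inM: "tm_val M v t \<in> universe M" "tm_val M b t \<in> universe M" for t using v bM by auto
  show ?thesis using \<open>qf \<phi>\<close>
  proof (induction \<phi>)
    case (Eq s t)
    show ?case
    proof (cases "lincoeff a s = lincoeff a t")
      case True
      have "(\<forall>\<^sub>F i in U. \<rho> (tm_val M v s) i = \<rho> (tm_val M v t) i) \<longleftrightarrow>
          (\<forall>\<^sub>F i in U. \<rho> (tm_val M b s) i = \<rho> (tm_val M b t) i)"
        by (rule eventually_cong[OF near[OF True]]) auto
      with True show ?thesis by (simp add: eq_iff_ev inM)
    next
      case False
      have "tm_val M v s \<noteq> tm_val M v t"
        using eventually_happens'[OF U far[OF False, of 0]] by auto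
      with False show ?thesis by simp
    qed
  next
    case (Rel r s t)
    show ?case
    proof (cases "lincoeff a s = lincoeff a t")
      case True
      have "(\<forall>\<^sub>F i in U. 0 \<le> \<rho> (tm_val M v t) i - \<rho> (tm_val M v s) i \<and> \<rho> (tm_val M v t) i - \<rho> (tm_val M v s) i \<le> rad r) \<longleftrightarrow>
          (\<forall>\<^sub>F i in U. 0 \<le> \<rho> (tm_val M b t) i - \<rho> (tm_val M b s) i \<and> \<rho> (tm_val M b t) i - \<rho> (tm_val M b s) i \<le> rad r)"
        by (rule eventually_cong[OF near[OF True]]) auto
      with True show ?thesis by (simp add: rel_iff_ev inM)
    next
      case False
      obtain n :: nat where n: "rad r \<le> real n" using real_arch_simple by blast
      have "\<not> rel M r (tm_val M v s) (tm_val M v t)"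
      proof
        assume "rel M r (tm_val M v s) (tm_val M v t)"
        from ev_rel[OF inM(1) inM(1) this] far[OF False, of n] have "\<forall>\<^sub>F i in U. False"
          by eventually_elim (use n in auto)
        then show False by simp
      qed
      with False show ?thesis by simp
    qed
  qed auto
qed

end

section \<open>Types and compactness\<close>

text \<open>Renaming serves to give several formulas a common list of parameters.\<close>

primrec rename_tm :: "(nat \<Rightarrow> nat) \<Rightarrow> tm \<Rightarrow> tm" where
  "rename_tm f (Var i) = Var (f i)"
| "rename_tm f One = One"
| "rename_tm f (Minus t) = Minus (rename_tm f t)"
| "rename_tm f (Plus s t) = Plus (rename_tm f s) (rename_tm f t)"

primrec rename_fm :: "(nat \<Rightarrow> nat) \<Rightarrow> fm \<Rightarrow> fm" where
  "rename_fm f (Eq s t) = Eq (rename_tm f s) (rename_tm f t)"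
| "rename_fm f (Rel r s t) = Rel r (rename_tm f s) (rename_tm f t)"
| "rename_fm f (Neg \<phi>) = Neg (rename_fm f \<phi>)"
| "rename_fm f (Conj \<phi> \<psi>) = Conj (rename_fm f \<phi>) (rename_fm f \<psi>)"
| "rename_fm f (Ex i \<phi>) = Ex (f i) (rename_fm f \<phi>)"

lemma tm_vars_rename [simp]: "tm_vars (rename_tm f t) = f ` tm_vars t"
  by (induction t) auto

lemma free_vars_rename: "inj f \<Longrightarrow> free_vars (rename_fm f \<phi>) = f ` free_vars \<phi>"
  by (induction \<phi>) (auto simp: inj_def)

lemma tm_val_rename [simp]: "tm_val M v (rename_tm f t) = tm_val M (v \<circ> f) t"
  by (induction t) auto

lemma sat_rename: "inj f \<Longrightarrow> sat M v (rename_fm f \<phi>) \<longleftrightarrow> sat M (v \<circ> f) \<phi>"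
proof (induction \<phi> arbitrary: v)
  case (Ex i \<phi>)
  have "v(f i := a) \<circ> f = (v \<circ> f)(i := a)" for a
    using Ex.prems by (auto simp: inj_def)
  then show ?case unfolding rename_fm.simps sat.simps Ex.IH[OF Ex.prems] by simp
qed auto

lemma sat_foldr_Ex:
  "sat M v (foldr Ex is \<phi>) \<longleftrightarrow>
     (\<exists>w. (\<forall>i. i \<notin> set is \<longrightarrow> w i = v i) \<and> (\<forall>i\<in>set is. w i \<in> universe M) \<and> sat M w \<phi>)"
  if "distinct is"
  using that
proof (induction "is" arbitrary: v)
  case Nil
  have "(\<forall>i. w i = v i) \<longleftrightarrow> w = v" for w by auto
  then show ?case by simp
next
  case (Cons j js)
  then have IH: "\<And>v. sat M v (foldr Ex js \<phi>) \<longleftrightarrow>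
     (\<exists>w. (\<forall>i. i \<notin> set js \<longrightarrow> w i = v i) \<and> (\<forall>i\<in>set js. w i \<in> universe M) \<and> sat M w \<phi>)"
    and j: "j \<notin> set js" by auto
  have "sat M v (foldr Ex (j # js) \<phi>) \<longleftrightarrow> (\<exists>a\<in>universe M. \<exists>w. (\<forall>i. i \<notin> set js \<longrightarrow> w i = (v(j := a)) i) \<and>
      (\<forall>i\<in>set js. w i \<in> universe M) \<and> sat M w \<phi>)"
    by (simp add: IH del: fun_upd_apply)
  also have "\<dots> \<longleftrightarrow> (\<exists>w. (\<forall>i. i \<notin> set (j # js) \<longrightarrow> w i = v i) \<and>
      (\<forall>i\<in>set (j # js). w i \<in> universe M) \<and> sat M w \<phi>)" (is "?L \<longleftrightarrow> ?R")
  proof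
    assume ?L
    then obtain a w where "a \<in> universe M" "\<forall>i. i \<notin> set js \<longrightarrow> w i = (v(j := a)) i"
      "\<forall>i\<in>set js. w i \<in> universe M" "sat M w \<phi>" by blast
    with j show ?R by (intro exI[of _ w]) auto
  next
    assume ?R
    then obtain w where "\<forall>i. i \<notin> set (j # js) \<longrightarrow> w i = v i"
      "\<forall>i\<in>set (j # js). w i \<in> universe M" "sat M w \<phi>" by blast
    then show ?L by (intro bexI[of _ "w j"] exI[of _ w]) auto
  qed
  finally show ?case .
qed

lemma free_vars_foldr_Ex [simp]: "free_vars (foldr Ex is \<phi>) = free_vars \<phi> - set is"
  by (induction "is") auto

lemma realizes_simps [simp]:
  "realizes M xs {}"
  "realizes M xs (insert (\<phi>, ds) \<pi>) \<longleftrightarrow> holds M (xs @ ds) \<phi> \<and> realizes M xs \<pi>"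
  "realizes M xs (\<pi> \<union> \<pi>') \<longleftrightarrow> realizes M xs \<pi> \<and> realizes M xs \<pi>'"
  by (auto simp: realizes_def)

lemma realizesD: "\<lbrakk>realizes M xs \<pi>; (\<phi>, ds) \<in> \<pi>\<rbrakk> \<Longrightarrow> holds M (xs @ ds) \<phi>"
  by (auto simp: realizes_def)

lemma realizes_mono: "\<lbrakk>realizes M xs \<pi>; \<pi>' \<subseteq> \<pi>\<rbrakk> \<Longrightarrow> realizes M xs \<pi>'"
  by (auto simp: realizes_def)

lemma holds_Neg [simp]: "holds M xs (Neg \<phi>) \<longleftrightarrow> \<not> holds M xs \<phi>"
  by (simp add: holds_def)

lemma formulas_overD:
  "(\<phi>, ds) \<in> formulas_over n A \<Longrightarrow> set ds \<subseteq> A"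
  "(\<phi>, ds) \<in> formulas_over n A \<Longrightarrow> free_vars \<phi> \<subseteq> {..<n + length ds}"
  by (auto simp: formulas_over_def)

text \<open>The formula is uniform in the structure, so that one and the same \<open>\<chi>\<close>
  can be evaluated in an elementary substructure and in its extension.\<close>

lemma finite_type_single_formula:
  assumes "finite \<pi>" "\<pi> \<subseteq> formulas_over n A"
  shows "\<exists>\<chi> es. (\<chi>, es) \<in> formulas_over n A \<and>
    (\<forall>(M :: 'a Lstruct) xs. length xs = n \<longrightarrow> (holds M (xs @ es) \<chi> \<longleftrightarrow> realizes M xs \<pi>))"
  using assms
proof (induction \<pi>)
  case empty
  show ?case
    by (rule exI[of _ "Eq One One"], rule exI[of _ "[]"]) (simp add: formulas_over_def holds_def)
next
  case (insert F \<pi>)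
  obtain \<phi> ds where F: "F = (\<phi>, ds)" by fastforce
  from insert obtain \<chi> es where \<chi>: "(\<chi>, es) \<in> formulas_over n A"
    "\<And>(M :: 'a Lstruct) xs. length xs = n \<Longrightarrow> holds M (xs @ es) \<chi> \<longleftrightarrow> realizes M xs \<pi>" by auto
  from insert.prems F have \<phi>: "set ds \<subseteq> A" "free_vars \<phi> \<subseteq> {..<n + length ds}"
    by (auto simp: formulas_over_def)
  \<comment> \<open>The \<open>n\<close> type variables stay, and the parameters of
    \<open>\<phi>\<close> move behind the parameters \<open>es\<close> of
    \<open>\<chi>\<close>.\<close>
  define f where "f = (\<lambda>i. if i < n then i else i + length es)"
  have f: "inj f" by (auto simp: f_def inj_def split: if_splits)
  have "free_vars (rename_fm f \<phi>) \<subseteq> {..<n + length (es @ ds)}"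
    unfolding free_vars_rename[OF f] using \<phi> by (fastforce simp: f_def)
  then have "(Conj \<chi> (rename_fm f \<phi>), es @ ds) \<in> formulas_over n A"
    using \<chi>(1) \<phi>(1) by (auto simp: formulas_over_def)
  moreover have "holds M (xs @ es @ ds) (Conj \<chi> (rename_fm f \<phi>)) \<longleftrightarrow> realizes M xs (insert F \<pi>)"
    if "length xs = n" for M :: "'a Lstruct" and xs
  proof -
    have "sat M (nth (xs @ es @ ds)) \<chi> \<longleftrightarrow> sat M (nth (xs @ es)) \<chi>"
      by (rule sat_cong) (use formulas_overD[OF \<chi>(1)] that in \<open>auto simp: nth_append\<close>)
    moreover have "sat M (nth (xs @ es @ ds)) (rename_fm f \<phi>) \<longleftrightarrow> sat M (nth (xs @ ds)) \<phi>"
      unfolding sat_rename[OF f]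
      by (rule sat_cong) (use \<phi> that in \<open>auto simp: nth_append f_def\<close>)
    ultimately show ?thesis using \<chi>(2)[OF that] by (auto simp: F holds_def)
  qed
  ultimately show ?case by blast
qed

lemma elementaryD:
  assumes "elementary_substructure C M"
  shows "universe C \<subseteq> universe M" "one C = one M"
    "x \<in> universe C \<Longrightarrow> neg C x = neg M x"
    "\<lbrakk>x \<in> universe C; y \<in> universe C\<rbrakk> \<Longrightarrow> add C x y = add M x y"
    "\<lbrakk>x \<in> universe C; y \<in> universe C\<rbrakk> \<Longrightarrow> rel C r x y = rel M r x y"
    "\<lbrakk>set as \<subseteq> universe C; free_vars \<phi> \<subseteq> {..<length as}\<rbrakk> \<Longrightarrow> holds C as \<phi> \<longleftrightarrow> holds M as \<phi>"
    "Lstructure C" "Lstructure M"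
  using assms unfolding elementary_substructure_def substructure_def by auto

lemma elementary_realizes:
  assumes "elementary_substructure C M" "set xs \<subseteq> universe C" "\<pi> \<subseteq> formulas_over (length xs) (universe C)"
  shows "realizes C xs \<pi> \<longleftrightarrow> realizes M xs \<pi>"
proof -
  have "holds C (xs @ ds) \<phi> \<longleftrightarrow> holds M (xs @ ds) \<phi>" if "(\<phi>, ds) \<in> \<pi>" for \<phi> ds
    using formulas_overD[of \<phi> ds "length xs" "universe C"] that assms
    by (intro elementaryD(6)[OF assms(1)]) auto
  then show ?thesis unfolding realizes_def by auto
qed

text \<open>The existential closure of the single formula for \<open>\<pi>\<close> passes from
  \<open>M\<close> down to \<open>C\<close>.\<close>

lemma elementary_finite_type:
  assumes el: "elementary_substructure C M" and "finite \<pi>" and \<pi>: "\<pi> \<subseteq> formulas_over n (universe C)"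
    and xs: "length xs = n" "set xs \<subseteq> universe M" "realizes M xs \<pi>"
  shows "\<exists>ys. length ys = n \<and> set ys \<subseteq> universe C \<and> realizes C ys \<pi>"
proof -
  obtain \<chi> es where \<chi>: "(\<chi>, es) \<in> formulas_over n (universe C)"
    "\<And>(K :: 'a Lstruct) xs. length xs = n \<Longrightarrow> holds K (xs @ es) \<chi> \<longleftrightarrow> realizes K xs \<pi>"
    using finite_type_single_formula[OF assms(2) \<pi>] by blast
  have one: "one C \<in> universe C" using elementaryD(7)[OF el] by (simp add: Lstructure_def)
  \<comment> \<open>The first \<open>n\<close> entries are placeholders that the quantifiers
    overwrite.\<close>
  define as where "as = replicate n (one C) @ es"
  have as: "set as \<subseteq> universe C" "length as = n + length es"
    using formulas_overD(1)[OF \<chi>(1)] one by (auto simp: as_def)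
  have fv: "free_vars (foldr Ex [0..<n] \<chi>) \<subseteq> {..<length as}"
    using formulas_overD(2)[OF \<chi>(1)] as by auto
  have nth: "(xs @ es) ! i = as ! i" if "i \<notin> set [0..<n]" for i
    using that xs(1) by (auto simp: as_def nth_append)
  have "holds M as (foldr Ex [0..<n] \<chi>)"
    unfolding holds_def sat_foldr_Ex[OF distinct_upt]
    using \<chi>(2)[OF xs(1), of M] xs nth
    by (intro exI[of _ "nth (xs @ es)"]) (auto simp: holds_def nth_append subset_iff)
  then have "holds C as (foldr Ex [0..<n] \<chi>)"
    using elementaryD(6)[OF el as(1) fv] by simp
  then obtain w where w: "\<forall>i. i \<notin> set [0..<n] \<longrightarrow> w i = as ! i" "\<forall>i\<in>set [0..<n]. w i \<in> universe C" "sat C w \<chi>"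
    unfolding holds_def sat_foldr_Ex[OF distinct_upt] by blast
  have "sat C w \<chi> \<longleftrightarrow> sat C (nth (map w [0..<n] @ es)) \<chi>"
    by (rule sat_cong) (use w(1) in \<open>auto simp: nth_append as_def\<close>)
  with w(3) \<chi>(2)[of "map w [0..<n]" C] have "realizes C (map w [0..<n]) \<pi>"
    by (simp add: holds_def)
  with w(2) show ?thesis by (intro exI[of _ "map w [0..<n]"]) auto
qed

lemma partial_type_elementary:
  assumes el: "elementary_substructure C M" and "A \<subseteq> universe C"
  shows "partial_type C n A \<pi> \<longleftrightarrow> partial_type M n A \<pi>"
proof -
  have "(\<exists>xs. length xs = n \<and> set xs \<subseteq> universe C \<and> realizes C xs \<pi>0) \<longleftrightarrow>
      (\<exists>xs. length xs = n \<and> set xs \<subseteq> universe M \<and> realizes M xs \<pi>0)" (is "?L \<longleftrightarrow> ?R")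
    if "\<pi> \<subseteq> formulas_over n A" "finite \<pi>0" "\<pi>0 \<subseteq> \<pi>" for \<pi>0
  proof
    have sub: "\<pi>0 \<subseteq> formulas_over n (universe C)"
      using that assms(2) by (fastforce simp: formulas_over_def)
    show ?R if ?L
      using that elementary_realizes[OF el] elementaryD(1)[OF el] sub by blast
    show ?L if ?R
      using that elementary_finite_type[OF el \<open>finite \<pi>0\<close> sub] by blast
  qed
  then show ?thesis unfolding partial_type_def by meson
qed

lemma complete_types_elementary:
  "\<lbrakk>elementary_substructure C M; A \<subseteq> universe C\<rbrakk> \<Longrightarrow> complete_types C n A = complete_types M n A"
  unfolding complete_types_def by (simp add: partial_type_elementary)

definition type_of :: "'a Lstruct \<Rightarrow> 'a set \<Rightarrow> 'a list \<Rightarrow> 'a pfm set" where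
  "type_of M A xs = {(\<phi>, ds) \<in> formulas_over (length xs) A. holds M (xs @ ds) \<phi>}"

lemma realizes_type_of [simp]: "realizes M xs (type_of M A xs)"
  by (auto simp: realizes_def type_of_def)

lemma type_of_complete:
  assumes "set xs \<subseteq> universe M"
  shows "type_of M A xs \<in> complete_types M (length xs) A"
  unfolding complete_types_def partial_type_def mem_Collect_eq
proof (intro conjI allI impI ballI)
  show "type_of M A xs \<subseteq> formulas_over (length xs) A" by (auto simp: type_of_def)
  show "\<exists>ys. length ys = length xs \<and> set ys \<subseteq> universe M \<and> realizes M ys \<pi>0"
    if "finite \<pi>0 \<and> \<pi>0 \<subseteq> type_of M A xs" for \<pi>0
    using that assms realizes_mono[OF realizes_type_of] by blast
  fix F assume "F \<in> formulas_over (length xs) A"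
  then show "case F of (\<phi>, ds) \<Rightarrow> (\<phi>, ds) \<in> type_of M A xs \<or> (Neg \<phi>, ds) \<in> type_of M A xs"
    by (auto simp: type_of_def formulas_over_def)
qed

lemma complete_type_realized:
  assumes "p \<in> complete_types M n A" "length xs = n" "realizes M xs p"
  shows "p = type_of M A xs"
proof -
  have sub: "p \<subseteq> formulas_over n A" using assms(1) by (simp add: complete_types_def partial_type_def)
  have "(\<phi>, ds) \<in> p" if "(\<phi>, ds) \<in> type_of M A xs" for \<phi> ds
  proof (rule ccontr)
    assume "(\<phi>, ds) \<notin> p"
    then have "(Neg \<phi>, ds) \<in> p"
      using assms(1,2) that by (auto simp: complete_types_def type_of_def)
    from realizesD[OF assms(3) this] that show False by (auto simp: type_of_def)
  qed
  moreover have "(\<phi>, ds) \<in> type_of M A xs" if "(\<phi>, ds) \<in> p" for \<phi> ds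
    using that sub realizesD[OF assms(3) that] assms(2) by (auto simp: type_of_def)
  ultimately show ?thesis by auto
qed

text \<open>\<open>saturated\<close> speaks of complete types. This extension by Zorn's lemma makes
  it applicable to partial types.\<close>

lemma ex_complete_type:
  assumes "partial_type M n A \<pi>"
  shows "\<exists>p\<in>complete_types M n A. \<pi> \<subseteq> p"
proof -
  define Q where "Q = {p. partial_type M n A p \<and> \<pi> \<subseteq> p}"
  have "\<Union>\<C> \<in> Q" if "\<C> \<noteq> {}" "subset.chain Q \<C>" for \<C>
  proof -
    have sub: "\<C> \<subseteq> Q" using that(2) by (simp add: subset.chain_def)
    have "\<exists>xs. length xs = n \<and> set xs \<subseteq> universe M \<and> realizes M xs \<pi>0" if \<pi>0: "finite \<pi>0" "\<pi>0 \<subseteq> \<Union>\<C>" for \<pi>0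
    proof -
      obtain p where "p \<in> \<C>" "\<pi>0 \<subseteq> p"
        using finite_subset_Union_chain[OF \<pi>0 \<open>\<C> \<noteq> {}\<close> \<open>subset.chain Q \<C>\<close>] by blast
      with sub \<pi>0(1) show ?thesis by (auto simp: Q_def partial_type_def)
    qed
    moreover have "\<Union>\<C> \<subseteq> formulas_over n A"
    proof (rule Union_least)
      fix p assume "p \<in> \<C>"
      then have "p \<in> Q" using sub by blast
      then show "p \<subseteq> formulas_over n A" by (simp add: Q_def partial_type_def)
    qed
    moreover have "\<pi> \<subseteq> \<Union>\<C>"
    proof -
      obtain p where "p \<in> \<C>" using \<open>\<C> \<noteq> {}\<close> by blast
      then show ?thesis using sub by (auto simp: Q_def)
    qed
    ultimately show ?thesis by (simp add: Q_def partial_type_def)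
  qed
  moreover have "\<pi> \<in> Q" using assms by (simp add: Q_def)
  ultimately obtain p where p: "p \<in> Q" and max: "\<And>p'. \<lbrakk>p' \<in> Q; p \<subseteq> p'\<rbrakk> \<Longrightarrow> p' = p"
    using subset_Zorn_nonempty[of Q] by blast
  have part: "partial_type M n A p" using p by (simp add: Q_def)
  have "(\<phi>, ds) \<in> p \<or> (Neg \<phi>, ds) \<in> p" if F: "(\<phi>, ds) \<in> formulas_over n A" for \<phi> ds
  proof (rule ccontr)
    assume neither: "\<not> ((\<phi>, ds) \<in> p \<or> (Neg \<phi>, ds) \<in> p)"
    have unsat: "\<exists>\<pi>0. finite \<pi>0 \<and> \<pi>0 \<subseteq> p \<and>
        \<not> (\<exists>xs. length xs = n \<and> set xs \<subseteq> universe M \<and> realizes M xs (insert (\<psi>, ds) \<pi>0))"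
      if \<psi>: "(\<psi>, ds) \<notin> p" "(\<psi>, ds) \<in> formulas_over n A" for \<psi>
    proof -
      have "insert (\<psi>, ds) p \<notin> Q" using max[of "insert (\<psi>, ds) p"] that by blast
      then have "\<not> partial_type M n A (insert (\<psi>, ds) p)" using p by (auto simp: Q_def)
      then obtain \<pi>0 where \<pi>0: "finite \<pi>0" "\<pi>0 \<subseteq> insert (\<psi>, ds) p"
        "\<not> (\<exists>xs. length xs = n \<and> set xs \<subseteq> universe M \<and> realizes M xs \<pi>0)"
        using \<psi>(2) part unfolding partial_type_def by (metis insert_subset)
      have "realizes M xs \<pi>0" if "realizes M xs (insert (\<psi>, ds) (\<pi>0 - {(\<psi>, ds)}))" for xs
        by (rule realizes_mono[OF that]) auto
      with \<pi>0 show ?thesis by (intro exI[of _ "\<pi>0 - {(\<psi>, ds)}"]) auto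
    qed
    have F': "(Neg \<phi>, ds) \<in> formulas_over n A" using F by (simp add: formulas_over_def)
    obtain \<pi>1 \<pi>2 where "finite \<pi>1" "\<pi>1 \<subseteq> p" "finite \<pi>2" "\<pi>2 \<subseteq> p"
      and 1: "\<not> (\<exists>xs. length xs = n \<and> set xs \<subseteq> universe M \<and> realizes M xs (insert (\<phi>, ds) \<pi>1))"
      and 2: "\<not> (\<exists>xs. length xs = n \<and> set xs \<subseteq> universe M \<and> realizes M xs (insert (Neg \<phi>, ds) \<pi>2))"
      using unsat[OF _ F] unsat[OF _ F'] neither by blast
    then have "finite (\<pi>1 \<union> \<pi>2)" "\<pi>1 \<union> \<pi>2 \<subseteq> p" by auto
    then obtain xs where "length xs = n" "set xs \<subseteq> universe M" "realizes M xs (\<pi>1 \<union> \<pi>2)"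
      using part unfolding partial_type_def by blast
    with 1 2 show False by auto
  qed
  with part p show ?thesis
    by (intro bexI[of _ p]) (auto simp: Q_def complete_types_def)
qed

lemma saturated_realizes:
  assumes "saturated M \<kappa>" "A \<subseteq> universe M" "|A| <o \<kappa>" "partial_type M n A \<pi>"
  shows "\<exists>xs. length xs = n \<and> set xs \<subseteq> universe M \<and> realizes M xs \<pi>"
proof -
  obtain p where p: "p \<in> complete_types M n A" "\<pi> \<subseteq> p" using ex_complete_type[OF assms(4)] by blast
  then obtain xs where "length xs = n" "set xs \<subseteq> universe M" "realizes M xs p"
    using assms(1-3) unfolding saturated_def by blast
  with realizes_mono p(2) show ?thesis by blast
qed

text \<open>A finite part of \<open>\<pi>\<close> excludes only finitely many indices, so some
  \<open>f k\<close> realizes it. This is how infinite sequences, of integers and later of multiples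
  of an infinitesimal, enter the compactness arguments.\<close>

lemma saturated_realizes_limit:
  assumes "saturated M \<kappa>" "A \<subseteq> universe M" "|A| <o \<kappa>" "\<pi> \<subseteq> formulas_over n A"
    and f: "\<And>k :: nat. length (f k) = n \<and> set (f k) \<subseteq> universe M"
    and fin: "\<And>\<phi> ds. (\<phi>, ds) \<in> \<pi> \<Longrightarrow> finite {k. \<not> holds M (f k @ ds) \<phi>}"
  shows "\<exists>xs. length xs = n \<and> set xs \<subseteq> universe M \<and> realizes M xs \<pi>"
proof (rule saturated_realizes[OF assms(1-3)])
  have "\<exists>xs. length xs = n \<and> set xs \<subseteq> universe M \<and> realizes M xs \<pi>0"
    if \<pi>0: "finite \<pi>0" "\<pi>0 \<subseteq> \<pi>" for \<pi>0
  proof -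
    have "finite (\<Union>(\<phi>, ds)\<in>\<pi>0. {k. \<not> holds M (f k @ ds) \<phi>})"
      using \<pi>0 fin by auto
    then obtain k where k: "k \<notin> (\<Union>(\<phi>, ds)\<in>\<pi>0. {k. \<not> holds M (f k @ ds) \<phi>})"
      using ex_new_if_finite[OF infinite_UNIV_nat] by blast
    then have "realizes M (f k) \<pi>0" by (auto simp: realizes_def)
    with f show ?thesis by blast
  qed
  then show "partial_type M n A \<pi>" using assms(4) by (simp add: partial_type_def)
qed

lemma holds_simps:
  "holds M xs (Eq s t) \<longleftrightarrow> tm_val M (nth xs) s = tm_val M (nth xs) t"
  "holds M xs (Rel r s t) \<longleftrightarrow> rel M r (tm_val M (nth xs) s) (tm_val M (nth xs) t)"
  "holds M xs (Conj \<phi> \<psi>) \<longleftrightarrow> holds M xs \<phi> \<and> holds M xs \<psi>"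
  "holds M xs (Disj \<phi> \<psi>) \<longleftrightarrow> holds M xs \<phi> \<or> holds M xs \<psi>"
  by (auto simp: holds_def)

section \<open>The type at infinity\<close>

locale saturated_pair = hyperreal M U \<rho>
  for C M :: "'a Lstruct" and U :: "'i filter" and \<rho> +
  fixes \<kappa> :: "'k rel" and \<kappa>' :: "'l rel"
  assumes model_C: "is_model C T" and el: "elementary_substructure C M"
    and Card_\<kappa>: "Card_order \<kappa>" "infinite (Field \<kappa>)" and T_less: "|T| <o \<kappa>"
    and sat_C: "saturated C \<kappa>"
    and Card_\<kappa>': "Card_order \<kappa>'" "infinite (Field \<kappa>')" and C_less: "|universe C| <o \<kappa>'"
    and sat_M: "saturated M \<kappa>'"
begin

lemmas C_sub = elementaryD(1)[OF el]

lemma subspace_C: "subspace (universe C)"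
proof (rule subspaceI)
  have L: "Lstructure C" using model_C by (simp add: is_model_def)
  show "universe C \<subseteq> universe M" by (rule C_sub)
  show one: "one M \<in> universe C"
    using L elementaryD(2)[OF el] by (simp add: Lstructure_def)
  show neg: "neg M x \<in> universe C" if "x \<in> universe C" for x
    using L elementaryD(3)[OF el that] that by (auto simp: Lstructure_def)
  show add: "add M x y \<in> universe C" if "x \<in> universe C" "y \<in> universe C" for x y
    using L elementaryD(4)[OF el that] that unfolding Lstructure_def by metis
  fix x and n :: nat assume x: "x \<in> universe C" "0 < n"
  have zero: "zero C = zero M" "zero M \<in> universe C"
    using one neg add elementaryD(2-4)[OF el] by (simp_all add: zero_def)
  have mult: "mult C k z = mult M k z \<and> mult M k z \<in> universe C" if "z \<in> universe C" for k z
    by (induction k) (use that zero add elementaryD(4)[OF el] in auto)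
  show "\<exists>z\<in>universe C. mult M n z = x"
    using ex_divide[OF model_C x] mult by auto
qed

lemmas C_one = subspaceD(2)[OF subspace_C]

lemma C_zero: "zero M \<in> universe C"
  unfolding zero_def using subspace_C by (simp add: subspace_add subspace_neg C_one)

definition W :: "'a set" where "W = nearby (universe C)"

lemma subspace_W: "subspace W"
  unfolding W_def by (rule subspace_nearby[OF subspace_C])

lemma C_sub_W: "universe C \<subseteq> W"
  unfolding W_def by (rule subset_nearby[OF C_sub])

lemma W_sub: "W \<subseteq> universe M"
  by (auto simp: W_def nearby_def)

text \<open>By \<open>realizations_eq_Q\<close> this is the set of realizations of \<open>p\<close>,
  the set \<open>P\<close> of the theorem.\<close>

definition Q :: "'a set" where "Q = universe M - W"

lemma Q_M: "x \<in> Q \<Longrightarrow> x \<in> universe M"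
  by (simp add: Q_def)

text \<open>Two integers within \<open>B\<close> of the same point differ by at most
  \<open>2 * B\<close>.\<close>

lemma finite_multiples_near:
  assumes "c \<in> universe M"
  shows "finite {k. \<forall>\<^sub>F i in U. \<bar>\<rho> (mult M k (one M)) i - \<rho> c i\<bar> \<le> B}"
proof (cases "{k. \<forall>\<^sub>F i in U. \<bar>\<rho> (mult M k (one M)) i - \<rho> c i\<bar> \<le> B} = {}")
  case False
  then obtain k where k: "\<forall>\<^sub>F i in U. \<bar>\<rho> (mult M k (one M)) i - \<rho> c i\<bar> \<le> B" by auto
  have m: "\<forall>\<^sub>F i in U. \<rho> (mult M l (one M)) i = real l" for l
    using ev_mult[OF one_closed, of l] ev_one by eventually_elim simp
  have "real l \<le> real k + 2 * B" if l: "\<forall>\<^sub>F i in U. \<bar>\<rho> (mult M l (one M)) i - \<rho> c i\<bar> \<le> B" for l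
  proof -
    have "\<forall>\<^sub>F i in U. real l \<le> real k + 2 * B"
      using k l m[of k] m[of l] by eventually_elim linarith
    then show ?thesis by simp
  qed
  moreover obtain N :: nat where "real k + 2 * B \<le> real N" using real_arch_simple by blast
  ultimately have "{k. \<forall>\<^sub>F i in U. \<bar>\<rho> (mult M k (one M)) i - \<rho> c i\<bar> \<le> B} \<subseteq> {..N}"
    by force
  then show ?thesis using finite_subset by blast
qed simp

lemma nearby_iff_rel:
  assumes x: "x \<in> universe M" and X: "X \<subseteq> universe M"
  shows "x \<notin> nearby X \<longleftrightarrow> (\<forall>c\<in>X. \<forall>r. \<not> rel M r x c \<and> \<not> rel M r c x)"
proof
  assume *: "\<forall>c\<in>X. \<forall>r. \<not> rel M r x c \<and> \<not> rel M r c x"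
  show "x \<notin> nearby X"
  proof
    assume "x \<in> nearby X"
    then obtain c n where c: "c \<in> X" and n: "close x c n" by (auto simp: nearby_def)
    have "0 < rat_of_nat n + 1" by (metis add_nonneg_pos of_nat_0_le_iff zero_less_one)
    then obtain r where r: "rad r = of_rat (of_nat n + 1)" using obtain_rad by blast
    have cM: "c \<in> universe M" using c X by blast
    have "\<not> rel M r x c" "\<not> rel M r c x" using * c by auto
    from ev_not_rel[OF x cM this(1)] ev_not_rel[OF cM x this(2)] n
    have "\<forall>\<^sub>F i in U. False" by eventually_elim (simp add: r of_rat_add, linarith)
    then show False by simp
  qed
next
  assume far: "x \<notin> nearby X"
  show "\<forall>c\<in>X. \<forall>r. \<not> rel M r x c \<and> \<not> rel M r c x"
  proof (intro ballI allI, rule ccontr)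
    fix c r assume c: "c \<in> X" and "\<not> (\<not> rel M r x c \<and> \<not> rel M r c x)"
    then have r: "rel M r x c \<or> rel M r c x" by blast
    have cM: "c \<in> universe M" using c X by blast
    obtain n :: nat where n: "rad r \<le> real n" using real_arch_simple by blast
    have "close x c n"
      using r
    proof
      assume "rel M r x c"
      from ev_rel[OF x cM this] show ?thesis by eventually_elim (use n in linarith)
    next
      assume "rel M r c x"
      from ev_rel[OF cM x this] show ?thesis by eventually_elim (use n in linarith)
    qed
    with far c x show False by (auto simp: nearby_def)
  qed
qed

definition far_fm :: "posrat \<Rightarrow> fm" where
  "far_fm r = Conj (Neg (Rel r (Var 0) (Var 1))) (Neg (Rel r (Var 1) (Var 0)))"

lemma realizes_far_fm:
  assumes "x \<in> universe M" "X \<subseteq> universe M"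
  shows "realizes M [x] {(far_fm r, [c]) | r c. c \<in> X} \<longleftrightarrow> x \<notin> nearby X"
proof -
  have "holds M ([x] @ [c]) (far_fm r) \<longleftrightarrow> \<not> rel M r x c \<and> \<not> rel M r c x" for r c
    by (simp add: far_fm_def holds_simps)
  then show ?thesis unfolding nearby_iff_rel[OF assms] realizes_def by fastforce
qed

text \<open>The integers approximate such a \<open>z\<close>: only finitely many of them lie within
  a given radius of a given point of \<open>X\<close>.\<close>

lemma ex_far:
  assumes X: "X \<subseteq> universe M" "|X| <o \<kappa>'"
  shows "\<exists>z\<in>universe M. z \<notin> nearby X"
proof -
  define \<pi> where "\<pi> = {(far_fm r, [c]) | r c. c \<in> X}"
  have "\<exists>xs. length xs = 1 \<and> set xs \<subseteq> universe M \<and> realizes M xs \<pi>"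
  proof (rule saturated_realizes_limit[OF sat_M X])
    show "\<pi> \<subseteq> formulas_over 1 X" by (auto simp: \<pi>_def formulas_over_def far_fm_def)
    show "length [mult M k (one M)] = 1 \<and> set [mult M k (one M)] \<subseteq> universe M" for k by simp
    fix \<phi> ds assume "(\<phi>, ds) \<in> \<pi>"
    then obtain r c where \<phi>: "\<phi> = far_fm r" "ds = [c]" and c: "c \<in> universe M" using X(1) by (auto simp: \<pi>_def)
    have "\<forall>\<^sub>F i in U. \<bar>\<rho> (mult M k (one M)) i - \<rho> c i\<bar> \<le> rad r"
      if "rel M r (mult M k (one M)) c \<or> rel M r c (mult M k (one M))" for k
      using that
    proof
      assume "rel M r (mult M k (one M)) c"
      from ev_rel[OF _ c this] show ?thesis by simp (elim eventually_rev_mp, simp)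
    next
      assume "rel M r c (mult M k (one M))"
      from ev_rel[OF c _ this] show ?thesis by simp (elim eventually_rev_mp, simp)
    qed
    then have "{k. \<not> holds M ([mult M k (one M)] @ ds) \<phi>} \<subseteq>
        {k. \<forall>\<^sub>F i in U. \<bar>\<rho> (mult M k (one M)) i - \<rho> c i\<bar> \<le> rad r}"
      by (auto simp: \<phi> far_fm_def holds_simps)
    with finite_multiples_near[OF c] show "finite {k. \<not> holds M ([mult M k (one M)] @ ds) \<phi>}"
      using finite_subset by blast
  qed
  then show ?thesis using realizes_far_fm[OF _ X(1)] by (auto simp: length_Suc_conv \<pi>_def)
qed

lemma Q_nonempty: "Q \<noteq> {}"
  using ex_far[OF C_sub C_less] by (auto simp: Q_def W_def)

lemma infinity_conditions_iff:
  assumes "x \<in> universe M"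
  shows "realizes M [x] (infinity_conditions C) \<longleftrightarrow> x \<in> Q"
  using realizes_far_fm[OF assms C_sub] assms
  unfolding infinity_conditions_def far_fm_def by (simp add: Q_def W_def)

text \<open>Beyond its length a list is unspecified under \<open>nth\<close> and may leave the
  universe. The default \<open>one M\<close> lies in every subspace, so total assignments with
  values in \<open>M\<close> or in \<open>C\<close> become available.\<close>

definition assign :: "'a list \<Rightarrow> nat \<Rightarrow> 'a" where
  "assign xs i = (if i < length xs then xs ! i else one M)"

lemma assign_simps [simp]:
  "assign (x # xs) 0 = x" "assign (x # xs) (Suc i) = assign xs i" "assign [] i = one M"
  by (auto simp: assign_def)

lemma assign_in: "\<lbrakk>set xs \<subseteq> X; one M \<in> X\<rbrakk> \<Longrightarrow> assign xs i \<in> X"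
  by (auto simp: assign_def subset_iff)

lemma holds_assign:
  "\<lbrakk>free_vars \<phi> \<subseteq> {..<length xs}; set xs \<subseteq> universe M\<rbrakk>
    \<Longrightarrow> holds M xs \<phi> \<longleftrightarrow> sat M (assign xs) (qe \<phi>)"
  unfolding holds_def
  by (subst sat_qe[OF model assign_in]) (auto simp: assign_def intro!: sat_cong)

text \<open>The right-hand side does not mention \<open>x\<close>, which is why \<open>p\<close> is
  complete. The entry \<open>zero M\<close> is the bounded part of \<open>x\<close> in
  \<open>x = 1 x + 0\<close>.\<close>

lemma holds_at_Q:
  assumes x: "x \<in> Q" and ds: "set ds \<subseteq> universe C" and fv: "free_vars \<phi> \<subseteq> {..<Suc (length ds)}"
  shows "holds M (x # ds) \<phi> \<longleftrightarrow> sat M (assign (zero M # ds)) (drop_unbounded (delta 0) (qe \<phi>))"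
proof -
  have xM: "x \<in> universe M" "x \<notin> nearby (universe C)" using x by (auto simp: Q_def W_def)
  have "holds M (x # ds) \<phi> \<longleftrightarrow> sat M (assign (x # ds)) (qe \<phi>)"
    using holds_assign[of \<phi> "x # ds"] fv ds C_sub xM by auto
  also have "\<dots> \<longleftrightarrow> sat M (assign (zero M # ds)) (drop_unbounded (delta 0) (qe \<phi>))"
  proof (rule sat_drop_unbounded[OF subspace_C xM])
    fix k
    show "assign (zero M # ds) k \<in> nearby (universe C)"
      using C_sub_W C_zero C_one ds by (intro subsetD[OF C_sub_W[unfolded W_def]] assign_in) auto
    show "assign (x # ds) k \<in> universe M"
      using xM ds C_sub by (intro assign_in) auto
    show "affine (assign (x # ds) k) (delta 0 k) x (assign (zero M # ds) k)"
      using ev_zero by (cases k) (auto simp: delta_def elim: eventually_mono)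
  qed simp
  finally show ?thesis .
qed

lemma type_of_Q:
  assumes "x \<in> Q" "x' \<in> Q"
  shows "type_of M (universe C) [x] = type_of M (universe C) [x']"
proof -
  have "holds M ([x] @ ds) \<phi> \<longleftrightarrow> holds M ([x'] @ ds) \<phi>" if "(\<phi>, ds) \<in> formulas_over 1 (universe C)" for \<phi> ds
    using holds_at_Q[OF assms(1), of ds \<phi>] holds_at_Q[OF assms(2), of ds \<phi>] formulas_overD[OF that]
    by simp
  then show ?thesis by (auto simp: type_of_def)
qed

text \<open>For uniqueness, a complete type containing the infinity conditions is realized in
  \<open>M\<close>, because \<open>C\<close> is small for \<open>\<kappa>'\<close>. The realization
  lies in \<open>Q\<close>, and all of \<open>Q\<close> has one type over \<open>C\<close>.\<close>

lemma type_at_infinity_eq: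
  assumes x: "x \<in> Q"
  shows "type_at_infinity C = type_of M (universe C) [x]"
  unfolding type_at_infinity_def
proof (rule the_equality)
  have xM: "x \<in> universe M" using x by (simp add: Q_def)
  have ct: "complete_types C 1 (universe C) = complete_types M 1 (universe C)"
    by (rule complete_types_elementary[OF el]) simp
  have ic: "infinity_conditions C \<subseteq> formulas_over 1 (universe C)"
    by (auto simp: infinity_conditions_def formulas_over_def)
  have "realizes M [x] (infinity_conditions C)" using infinity_conditions_iff[OF xM] x by simp
  with ic have "infinity_conditions C \<subseteq> type_of M (universe C) [x]"
    by (auto simp: type_of_def realizes_def)
  with type_of_complete[of "[x]" M "universe C"] xM ct
  show "type_of M (universe C) [x] \<in> complete_types C 1 (universe C) \<and>
      infinity_conditions C \<subseteq> type_of M (universe C) [x]" by simp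
  fix p assume p: "p \<in> complete_types C 1 (universe C) \<and> infinity_conditions C \<subseteq> p"
  then have pM: "p \<in> complete_types M 1 (universe C)" using ct by simp
  then obtain xs where "length xs = 1" "set xs \<subseteq> universe M" "realizes M xs p"
    using sat_M C_sub C_less unfolding saturated_def by blast
  then obtain y where y: "y \<in> universe M" "realizes M [y] p" by (auto simp: length_Suc_conv)
  then have "y \<in> Q" using infinity_conditions_iff[OF y(1)] realizes_mono p by blast
  with complete_type_realized[OF pM _ y(2)] type_of_Q[OF x] show "p = type_of M (universe C) [x]" by simp
qed

lemma realizations_eq_Q: "realizations M (type_at_infinity C) = Q"
proof -
  obtain x where x: "x \<in> Q" using Q_nonempty by blast
  have "realizes M [y] (type_of M (universe C) [x])" if "y \<in> Q" for y
    using type_of_Q[OF x that] by simp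
  moreover have "y \<in> Q" if "y \<in> universe M" "realizes M [y] (type_of M (universe C) [x])" for y
  proof -
    have "infinity_conditions C \<subseteq> type_of M (universe C) [x]"
      using x infinity_conditions_iff[of x]
      by (auto simp: Q_def type_of_def realizes_def infinity_conditions_def formulas_over_def)
    with that realizes_mono infinity_conditions_iff[of y] show ?thesis by blast
  qed
  ultimately show ?thesis
    unfolding type_at_infinity_eq[OF x] realizations_def by (auto simp: Q_def)
qed

end

section \<open>Cardinalities\<close>

instance posrat :: countable
  by (rule countable_classI[of "\<lambda>r. to_nat (Rep_posrat r)"]) (simp add: Rep_posrat_inject)

instance tm :: countable
  by countable_datatype

instance fm :: countable
  by countable_datatype

text \<open>Together with \<open>|T| <o \<kappa>\<close> this makes \<open>\<kappa>\<close>
  uncountable, so the countably many formulas of the language do not spoil smallness. Nested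
  conjunctions are told apart by their size.\<close>

lemma infinite_T: "infinite T"
proof
  assume fin: "finite T"
  have "(Conj (Eq One One) ^^ n) (Eq One One) \<in> T" for n
    by (induction n) (auto simp: T_def Th_def holds_def)
  then have "range (\<lambda>n. (Conj (Eq One One) ^^ n) (Eq One One)) \<subseteq> T" by blast
  with fin have "\<not> inj (\<lambda>n. (Conj (Eq One One) ^^ n) (Eq One One))"
    using finite_subset finite_imageD infinite_UNIV_nat by blast
  moreover have "size ((Conj (Eq One One) ^^ n) (Eq One One)) = n" for n
    by (induction n) auto
  then have "inj (\<lambda>n. (Conj (Eq One One) ^^ n) (Eq One One))"
    by (intro injI) metis
  ultimately show False ..
qed

lemma countable_card_ordLeq:
  assumes "countable B" "infinite A" shows "|B| \<le>o |A|"
proof -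
  obtain f :: "_ \<Rightarrow> nat" where "inj_on f B" using assms(1) by (auto simp: countable_def)
  then have "|B| \<le>o |UNIV :: nat set|" by (metis card_of_ordLeq subset_UNIV)
  with assms(2) show ?thesis using infinite_iff_card_of_nat ordLeq_transitive by blast
qed

lemma card_of_subset_image: "X \<subseteq> f ` Y \<Longrightarrow> |X| \<le>o |Y|"
  by (rule ordLeq_transitive[OF card_of_mono1 card_of_image])

lemma card_of_Times_ordLeq:
  assumes "|B| \<le>o |A|" "infinite A" shows "|A \<times> B| \<le>o |A|"
proof (cases "B = {}")
  case False
  with assms card_of_Times_infinite[of A B] show ?thesis using ordIso_iff_ordLeq by blast
qed (simp add: card_of_empty)

lemma card_of_insert_ordLess:
  assumes "Card_order \<kappa>" "infinite (Field \<kappa>)" "|A| <o \<kappa>"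
  shows "|insert x A| <o \<kappa>"
proof -
  have "|{x} <+> A| <o \<kappa>"
  proof (rule card_of_Plus_ordLess_infinite_Field[OF assms(2,1) _ assms(3)])
    show "|{x}| <o \<kappa>"
      using assms by (intro finite_ordLess_infinite)
        (auto simp: card_of_well_order_on Field_card_of intro: card_order_on_well_order_on)
  qed
  moreover have "|insert x A| \<le>o |{x} <+> A|"
    using card_of_Un_Plus_ordLeq[of "{x}" A] by simp
  ultimately show ?thesis using ordLeq_ordLess_trans by blast
qed

lemma card_of_lists_ordLeq:
  assumes "infinite K" "A \<subseteq> K"
  shows "|{xs. set xs \<subseteq> A}| \<le>o |K|"
proof -
  have n: "|{xs. set xs \<subseteq> A \<and> length xs = n}| \<le>o |K|" for n
  proof (induction n)
    case 0
    have "countable {xs. set xs \<subseteq> A \<and> length xs = 0}"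
      by (rule countable_subset[of _ "{[]}"]) auto
    then show ?case by (rule countable_card_ordLeq) fact
  next
    case (Suc n)
    let ?L = "{xs. set xs \<subseteq> A \<and> length xs = n}"
    have "{xs. set xs \<subseteq> A \<and> length xs = Suc n} \<subseteq> (\<lambda>(x, xs). x # xs) ` (K \<times> ?L)"
      using assms(2) by (auto simp: length_Suc_conv image_iff)
    then have "|{xs. set xs \<subseteq> A \<and> length xs = Suc n}| \<le>o |K \<times> ?L|"
      by (rule card_of_subset_image)
    also have "|K \<times> ?L| \<le>o |K|" by (rule card_of_Times_ordLeq[OF Suc assms(1)])
    finally show ?case .
  qed
  have "{xs. set xs \<subseteq> A} = (\<Union>n\<in>UNIV. {xs. set xs \<subseteq> A \<and> length xs = n})" by auto
  moreover have "|\<Union>n\<in>(UNIV :: nat set). {xs. set xs \<subseteq> A \<and> length xs = n}| \<le>o |K|"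
    by (rule card_of_UNION_ordLeq_infinite[OF assms(1)])
      (use n assms(1) in \<open>auto intro: countable_card_ordLeq\<close>)
  ultimately show ?thesis by metis
qed

text \<open>A copy of the naturals is added to \<open>A\<close> so that infinite cardinal arithmetic
  applies even when \<open>A\<close> is finite. Bounding by one infinite set \<open>K\<close> below
  \<open>\<kappa>\<close>, rather than by \<open>\<kappa>\<close>, also controls unions indexed by
  the formulas, without regularity of \<open>\<kappa>\<close>.\<close>

lemma card_of_formulas_over:
  fixes A :: "'a set" and \<kappa> :: "'k rel"
  assumes "Card_order \<kappa>" "infinite (Field \<kappa>)" "|T| <o \<kappa>" "|A| <o \<kappa>"
  shows "\<exists>K :: ('a + nat) set. infinite K \<and> |K| <o \<kappa> \<and> |formulas_over n A| \<le>o |K|"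
proof -
  define K :: "('a + nat) set" where "K = A <+> UNIV"
  have K: "infinite K" by (simp add: K_def)
  have "|UNIV :: nat set| <o \<kappa>"
    using infinite_T assms(3) infinite_iff_card_of_nat ordLeq_ordLess_trans by blast
  with assms have K': "|K| <o \<kappa>" unfolding K_def by (intro card_of_Plus_ordLess_infinite_Field)
  have "formulas_over n A \<subseteq> (\<lambda>(xs, \<phi>). (\<phi>, map projl xs)) ` ({xs. set xs \<subseteq> K} \<times> UNIV)"
  proof
    fix F assume "F \<in> formulas_over n A"
    then obtain \<phi> ds where F: "F = (\<phi>, ds)" "set ds \<subseteq> A" by (auto simp: formulas_over_def)
    then have "F = (\<lambda>(xs, \<phi>). (\<phi>, map projl xs)) (map Inl ds, \<phi>)" "set (map Inl ds) \<subseteq> K"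
      by (auto simp: K_def o_def)
    then show "F \<in> (\<lambda>(xs, \<phi>). (\<phi>, map projl xs)) ` ({xs. set xs \<subseteq> K} \<times> UNIV)" by blast
  qed
  then have "|formulas_over n A| \<le>o |{xs. set xs \<subseteq> K} \<times> (UNIV :: fm set)|"
    by (rule card_of_subset_image)
  also have "|{xs. set xs \<subseteq> K} \<times> (UNIV :: fm set)| \<le>o |K \<times> (UNIV :: fm set)|"
    by (rule card_of_Times_mono1[OF card_of_lists_ordLeq[OF K]]) simp
  also have "|K \<times> (UNIV :: fm set)| \<le>o |K|"
    by (rule card_of_Times_ordLeq[OF countable_card_ordLeq[OF _ K] K]) simp
  finally show ?thesis using K K' by blast
qed

section \<open>Type-definable equivalence relations\<close>

context saturated_pair
begin

text \<open>The coefficients of \<open>x\<close> when variable 0 is \<open>x\<close>, variable 1 is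
  \<open>y = a x + e\<close>, and all further variables are parameters from
  \<open>C\<close>.\<close>

definition line :: "rat \<Rightarrow> nat \<Rightarrow> rat" where
  "line a k = (if k = 0 then 1 else if k = 1 then a else 0)"

text \<open>Only \<open>a\<close> and \<open>e\<close> are left on the right, so the choice of
  \<open>x\<close> in \<open>Q\<close> is irrelevant. Apart from \<open>a\<close>, all information
  about the pair sits in its bounded part \<open>e\<close>.\<close>

lemma holds_line:
  assumes x: "x \<in> Q" and y: "y \<in> universe M" "affine y a x e"
    and e: "e \<in> W" and \<phi>: "(\<phi>, ds) \<in> formulas_over 2 (universe C)"
  shows "holds M ([x, y] @ ds) \<phi> \<longleftrightarrow> sat M (assign (zero M # e # ds)) (drop_unbounded (line a) (qe \<phi>))"
proof -
  have xM: "x \<in> universe M" "x \<notin> nearby (universe C)" using x by (auto simp: Q_def W_def)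
  note ds = formulas_overD[OF \<phi>]
  have "holds M ([x, y] @ ds) \<phi> \<longleftrightarrow> sat M (assign (x # y # ds)) (qe \<phi>)"
    using holds_assign[of \<phi> "x # y # ds"] ds y C_sub xM by auto
  also have "\<dots> \<longleftrightarrow> sat M (assign (zero M # e # ds)) (drop_unbounded (line a) (qe \<phi>))"
  proof (rule sat_drop_unbounded[OF subspace_C xM])
    fix k
    show "assign (zero M # e # ds) k \<in> nearby (universe C)"
      using C_sub_W C_zero C_one ds e unfolding W_def[symmetric] by (intro assign_in) auto
    show "assign (x # y # ds) k \<in> universe M"
      using xM y ds C_sub by (intro assign_in) auto
    show "affine (assign (x # y # ds) k) (line a k) x (assign (zero M # e # ds) k)"
    proof (cases k)
      case 0
      then show ?thesis using ev_zero by (auto simp: line_def elim: eventually_mono)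
    next
      case (Suc j)
      then show ?thesis using y(2) by (cases j) (auto simp: line_def)
    qed
  qed simp
  finally show ?thesis .
qed

lemma line_in_Q:
  assumes x: "x \<in> Q" and y: "y \<in> universe M" "affine y a x e"
    and e: "e \<in> W" and a: "a \<noteq> 0"
  shows "y \<in> Q"
proof -
  have "y \<notin> W"
  proof
    assume yW: "y \<in> W"
    have "lincomb x (1 / a) y (- 1 / a) e"
      using y(2) by eventually_elim (use a in \<open>simp add: of_rat_divide of_rat_minus field_simps\<close>)
    with subspaceD(3)[OF subspace_W yW e] x show False by (auto simp: Q_def)
  qed
  with y(1) show ?thesis by (simp add: Q_def)
qed

text \<open>The complete type of the pair of 0 and \<open>e\<close> over a small set is realized in
  \<open>C\<close> by saturation. The first component is carried along because the assignments of
  \<open>holds_line\<close> begin with \<open>zero M\<close>.\<close>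

lemma ex_in_C_same_type:
  assumes e: "e \<in> universe M" and D: "D \<subseteq> universe C" "|D| <o \<kappa>"
  shows "\<exists>c\<in>universe C. \<forall>\<chi> ds. set ds \<subseteq> D \<longrightarrow>
    (sat M (assign (zero M # e # ds)) \<chi> \<longleftrightarrow> sat M (assign (zero M # c # ds)) \<chi>)"
proof -
  define D' where "D' = insert (one M) D"
  have D': "D' \<subseteq> universe C" using D C_one by (simp add: D'_def)
  have D'_less: "|D'| <o \<kappa>" unfolding D'_def by (rule card_of_insert_ordLess[OF Card_\<kappa> D(2)])
  let ?p = "type_of M D' [zero M, e]"
  have p: "?p \<in> complete_types C 2 D'"
    using type_of_complete[of "[zero M, e]" M D'] complete_types_elementary[OF el D', of 2] e by (simp add: numeral_2_eq_2)
  then obtain xs where xs: "length xs = 2" "set xs \<subseteq> universe C" "realizes C xs ?p"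
    using sat_C D' D'_less unfolding saturated_def by blast
  then obtain z c where zc: "xs = [z, c]" "z \<in> universe C" "c \<in> universe C"
    by (auto simp: numeral_2_eq_2 length_Suc_conv)
  have "?p \<subseteq> formulas_over (length xs) (universe C)"
    using p D' xs(1) by (fastforce simp: complete_types_def partial_type_def formulas_over_def)
  with elementary_realizes[OF el xs(2)] xs(3) have real: "realizes M [z, c] ?p" by (simp add: zc)
  have same: "type_of M D' [z, c] = ?p"
    using complete_type_realized[of ?p M 2 D' "[z, c]"] real p complete_types_elementary[OF el D', of 2] by simp
  have "(Eq (Var 0) Zero, []) \<in> ?p" by (simp add: type_of_def formulas_over_def holds_simps)
  from realizesD[OF real this] have z: "z = zero M" by (simp add: holds_simps)
  have "sat M (assign (zero M # e # ds)) \<chi> \<longleftrightarrow> sat M (assign (zero M # c # ds)) \<chi>" if ds: "set ds \<subseteq> D" for \<chi> ds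
  proof -
    obtain m where m: "\<forall>i\<in>free_vars \<chi>. i < m" using finite_nat_set_iff_bounded finite_free_vars by blast
    \<comment> \<open>The variables of \<open>\<chi>\<close> may run past \<open>ds\<close>. Padding
      with the default of \<open>assign\<close> makes \<open>\<chi>\<close> a formula with
      parameters without changing its meaning.\<close>
    define es where "es = ds @ replicate m (one M)"
    have es: "(\<chi>, es) \<in> formulas_over 2 D'" using ds m by (auto simp: formulas_over_def es_def D'_def)
    have h: "holds M ([zero M, u] @ es) \<chi> \<longleftrightarrow> sat M (assign (zero M # u # ds)) \<chi>" for u
      unfolding holds_def by (rule sat_cong) (use m in \<open>auto simp: es_def assign_def nth_append nth_Cons' \<close>)
    have "(\<chi>, es) \<in> ?p \<longleftrightarrow> (\<chi>, es) \<in> type_of M D' [zero M, c]" using same z by simp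
    then show ?thesis using es h by (simp add: type_of_def numeral_2_eq_2)
  qed
  with zc(3) show ?thesis by blast
qed

section \<open>The order on the infinitesimals, and where a formula about them changes its truth
  value\<close>

definition mu :: "'a set" where
  "mu = {e \<in> universe M. \<forall>q>0. \<forall>\<^sub>F i in U. \<bar>\<rho> e i\<bar> \<le> of_rat q}"

lemma muD: "\<lbrakk>e \<in> mu; 0 < q\<rbrakk> \<Longrightarrow> \<forall>\<^sub>F i in U. \<bar>\<rho> e i\<bar> \<le> of_rat q" "e \<in> mu \<Longrightarrow> e \<in> universe M"
  by (auto simp: mu_def)

lemma mu_subset_W: "mu \<subseteq> W"
proof
  fix e assume e: "e \<in> mu"
  have "close e (zero M) 1"
    using muD(1)[OF e, of 1] ev_zero by simp (elim eventually_rev_mp, simp)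
  with C_zero muD(2)[OF e] show "e \<in> W" unfolding W_def nearby_def by blast
qed

lemma mu_between:
  assumes "e \<in> mu" "x \<in> universe M" "\<forall>\<^sub>F i in U. \<bar>\<rho> x i\<bar> \<le> \<bar>\<rho> e i\<bar>"
  shows "x \<in> mu"
  unfolding mu_def
proof (intro CollectI conjI allI impI)
  fix q :: rat assume "0 < q"
  from muD(1)[OF assms(1) this] assms(3) show "\<forall>\<^sub>F i in U. \<bar>\<rho> x i\<bar> \<le> of_rat q" by eventually_elim simp
qed fact

lemma mu_add:
  assumes "e \<in> mu" "f \<in> mu" shows "add M e f \<in> mu"
  unfolding mu_def
proof (intro CollectI conjI allI impI)
  show "add M e f \<in> universe M" using assms muD(2) by simp
  fix q :: rat assume "0 < q"
  then have "0 < q / 2" by simp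
  from muD(1)[OF assms(1) this] muD(1)[OF assms(2) this] ev_add[OF muD(2)[OF assms(1)] muD(2)[OF assms(2)]]
  show "\<forall>\<^sub>F i in U. \<bar>\<rho> (add M e f) i\<bar> \<le> of_rat q" by eventually_elim (simp add: of_rat_divide)
qed

abbreviation le :: "'a \<Rightarrow> 'a \<Rightarrow> bool" where "le x y \<equiv> \<forall>\<^sub>F i in U. \<rho> x i \<le> \<rho> y i"
abbreviation lt :: "'a \<Rightarrow> 'a \<Rightarrow> bool" where "lt x y \<equiv> \<forall>\<^sub>F i in U. \<rho> x i < \<rho> y i"

definition r1 :: posrat where "r1 = Abs_posrat 1"

lemma rad_r1 [simp]: "rad r1 = 1"
  by (simp add: rad_def r1_def Abs_posrat_inverse)

lemma mu_diff_le_1: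
  assumes "x \<in> mu" "y \<in> mu"
  shows "\<forall>\<^sub>F i in U. \<rho> y i - \<rho> x i \<le> 1"
  using muD(1)[OF assms(1), of "1 / 2", simplified] muD(1)[OF assms(2), of "1 / 2", simplified]
  by eventually_elim (simp add: of_rat_divide abs_le_iff)

text \<open>Differences of infinitesimals stay below the radius 1, so the local order is a full
  order on \<open>mu\<close>.\<close>

lemma rel_r1_iff_le:
  assumes "x \<in> mu" "y \<in> mu"
  shows "rel M r1 x y \<longleftrightarrow> le x y"
proof -
  have "\<forall>\<^sub>F i in U. \<rho> y i - \<rho> x i \<le> 1"
    by (rule mu_diff_le_1[OF assms])
  then show ?thesis
    unfolding rel_iff_ev[OF muD(2)[OF assms(1)] muD(2)[OF assms(2)]] rad_r1
    by (intro eventually_cong) (auto elim: eventually_mono)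
qed

text \<open>For a filter, failure of \<open>le x y\<close> alone need not give
  \<open>lt y x\<close>. The detour through \<open>rel\<close>, which the filter decides,
  does.\<close>

lemma le_or_lt:
  assumes "x \<in> mu" "y \<in> mu"
  shows "le x y \<or> lt y x"
proof (cases "rel M r1 x y")
  case True
  then show ?thesis using rel_r1_iff_le[OF assms] by simp
next
  case False
  have "\<forall>\<^sub>F i in U. \<rho> y i - \<rho> x i \<le> 1"
    by (rule mu_diff_le_1[OF assms])
  with ev_not_rel[OF muD(2)[OF assms(1)] muD(2)[OF assms(2)] False] have "lt y x"
    by eventually_elim auto
  then show ?thesis ..
qed

lemma not_le_lt: "\<lbrakk>le x y; lt y x\<rbrakk> \<Longrightarrow> False"
proof -
  assume "le x y" "lt y x"
  then have "\<forall>\<^sub>F i in U. False" by eventually_elim simp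
  then show False by simp
qed

text \<open>The critical points are the breakpoints of \<open>\<chi>\<close> in variable 1. They are
  rational combinations of parameters and of 1, hence lie in the subspace \<open>C\<close>.
  Betweenness is stated with \<open>rel\<close> because the filter decides it even for an
  \<open>s\<close> that is not infinitesimal.\<close>

lemma ex_critical_points:
  assumes ds: "set ds \<subseteq> universe C" and \<chi>: "qf \<chi>"
  shows "\<exists>S. finite S \<and> S \<subseteq> universe C \<and> (\<forall>e\<in>mu. \<forall>e'\<in>mu. le e e' \<and>
      (\<forall>s\<in>S. \<not> (rel M r1 e s \<and> rel M r1 s e')) \<longrightarrow>
      (sat M (assign (zero M # e # ds)) \<chi> \<longleftrightarrow> sat M (assign (zero M # e' # ds)) \<chi>))"
proof -
  obtain L where L: "breakpoints 1 \<chi> L" using ex_breakpoints[OF \<chi>] by blast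
  \<comment> \<open>Slot 1 belongs to the infinitesimal and is overwritten below; the value from
    \<open>C\<close> put there keeps the breakpoints in \<open>C\<close>.\<close>
  let ?b = "assign (zero M # zero M # ds)"
  have b: "?b k \<in> universe C" for k using ds C_zero C_one by (intro assign_in) auto
  then have bM: "?b k \<in> universe M" for k using C_sub by blast
  have "\<exists>s. s \<in> universe C \<and> (\<forall>\<^sub>F i in U. \<rho> s i = rval (\<lambda>k. \<rho> (?b k) i) (fst tk) / real (snd tk))" for tk
  proof -
    have t: "tm_val M ?b (fst tk) \<in> universe C" using subspace_tm_val[OF subspace_C] b by blast
    obtain s where s: "s \<in> universe C" "\<forall>\<^sub>F i in U. \<rho> s i =
        of_rat (1 / of_nat (snd tk)) * \<rho> (tm_val M ?b (fst tk)) i + of_rat 0 * \<rho> (tm_val M ?b (fst tk)) i"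
      using ex_comb_in[OF subspace_C t t] by blast
    have "\<forall>\<^sub>F i in U. \<rho> s i = rval (\<lambda>k. \<rho> (?b k) i) (fst tk) / real (snd tk)"
      using s(2) ev_tm_val[of ?b "fst tk", OF bM] by eventually_elim (simp add: of_rat_divide)
    with s(1) show ?thesis by blast
  qed
  then obtain s where s: "\<And>tk. s tk \<in> universe C"
    "\<And>tk. \<forall>\<^sub>F i in U. \<rho> (s tk) i = rval (\<lambda>k. \<rho> (?b k) i) (fst tk) / real (snd tk)" by metis
  have finL: "finite L" using L by (simp add: breakpoints_def)
  have "sat M (assign (zero M # e # ds)) \<chi> \<longleftrightarrow> sat M (assign (zero M # e' # ds)) \<chi>"
    if e: "e \<in> mu" "e' \<in> mu" "le e e'" and no: "\<And>tk. tk \<in> L \<Longrightarrow> \<not> (rel M r1 e (s tk) \<and> rel M r1 (s tk) e')" for e e'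
  proof -
    have eM: "e \<in> universe M" "e' \<in> universe M" using e by (auto simp: mu_def)
    have diff: "\<forall>\<^sub>F i in U. \<rho> e' i - \<rho> e i \<le> 1"
      by (rule mu_diff_le_1[OF e(1,2)])
    have "\<forall>\<^sub>F i in U. \<not> (\<rho> e i \<le> rval (\<lambda>k. \<rho> (?b k) i) (fst tk) / real (snd tk) \<and>
        rval (\<lambda>k. \<rho> (?b k) i) (fst tk) / real (snd tk) \<le> \<rho> e' i)" if tk: "tk \<in> L" for tk
    proof -
      have sM: "s tk \<in> universe M" using s(1) C_sub by blast
      from no[OF tk] consider "\<not> rel M r1 e (s tk)" | "\<not> rel M r1 (s tk) e'" by blast
      then show ?thesis
      proof cases
        case 1
        from ev_not_rel[OF eM(1) sM 1] diff s(2)[of tk] show ?thesis by eventually_elim auto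
      next
        case 2
        from ev_not_rel[OF sM eM(2) 2] diff s(2)[of tk] show ?thesis by eventually_elim auto
      qed
    qed
    then have "\<forall>\<^sub>F i in U. \<forall>tk\<in>L. \<not> (\<rho> e i \<le> rval (\<lambda>k. \<rho> (?b k) i) (fst tk) / real (snd tk) \<and>
        rval (\<lambda>k. \<rho> (?b k) i) (fst tk) / real (snd tk) \<le> \<rho> e' i)"
      using finL by (simp add: eventually_ball_finite)
    with e(3) have same: "\<forall>\<^sub>F i in U. rsat ((\<lambda>k. \<rho> (?b k) i)(1 := \<rho> e i)) \<chi> \<longleftrightarrow> rsat ((\<lambda>k. \<rho> (?b k) i)(1 := \<rho> e' i)) \<chi>"
    proof eventually_elim
      case (elim i)
      then show ?case using L unfolding breakpoints_def by (simp add: case_prod_unfold del: fun_upd_apply)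
    qed
    have upd: "(\<lambda>k. \<rho> (assign (zero M # u # ds) k) i) = (\<lambda>k. \<rho> (?b k) i)(1 := \<rho> u i)" for u i
      by (rule ext) (auto simp: assign_def nth_Cons')
    have "\<forall>\<^sub>F i in U. rsat ((\<lambda>k. \<rho> (?b k) i)(1 := \<rho> u i)) \<chi> \<longleftrightarrow> sat M (assign (zero M # u # ds)) \<chi>"
      if u: "u \<in> universe M" for u
    proof -
      have "assign (zero M # u # ds) k \<in> universe M" for k using ds C_sub u by (intro assign_in) auto
      from ev_rsat_iff_sat[of "assign (zero M # u # ds)", OF this] show ?thesis unfolding upd[symmetric] .
    qed
    from this[OF eM(1)] this[OF eM(2)] same
    have "\<forall>\<^sub>F i in U. sat M (assign (zero M # e # ds)) \<chi> \<longleftrightarrow> sat M (assign (zero M # e' # ds)) \<chi>"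
      by eventually_elim simp
    then show ?thesis by simp
  qed
  then show ?thesis using finL s(1) by (intro exI[of _ "s ` L"]) auto
qed

end

section \<open>Linear combinations of a pair, and generic pairs\<close>

definition Zmul :: "int \<Rightarrow> tm \<Rightarrow> tm" where
  "Zmul n t = (if 0 \<le> n then Nmul (nat n) t else Minus (Nmul (nat (- n)) t))"

lemma tm_vars_Zmul: "tm_vars (Zmul n t) \<subseteq> tm_vars t"
  by (auto simp: Zmul_def dest: subsetD[OF Nmul_simps(1)])

lemma rval_Zmul [simp]: "rval v (Zmul n t) = of_int n * rval v t"
  by (simp add: Zmul_def)

definition Far :: "int \<Rightarrow> int \<Rightarrow> posrat \<Rightarrow> fm" where
  "Far m n r = (let t = Plus (Zmul m (Var 0)) (Zmul n (Var 1)) in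
     Conj (Neg (Rel r t (Var 2))) (Neg (Rel r (Var 2) t)))"

lemma free_vars_Far: "free_vars (Far m n r) \<subseteq> {..<3}"
  using tm_vars_Zmul[of m "Var 0"] tm_vars_Zmul[of n "Var 1"] by (auto simp: Far_def Let_def)

context saturated_pair
begin

lemma holds_Far:
  assumes "x \<in> universe M" "y \<in> universe M" "d \<in> universe M"
  shows "holds M [x, y, d] (Far m n r) \<longleftrightarrow>
    \<not> (\<forall>\<^sub>F i in U. \<bar>of_int m * \<rho> x i + of_int n * \<rho> y i - \<rho> d i\<bar> \<le> rad r)"
proof -
  have v: "assign [x, y, d] k \<in> universe M" for k
    using assms by (intro assign_in) auto
  have "holds M [x, y, d] (Far m n r) \<longleftrightarrow> sat M (assign [x, y, d]) (Far m n r)"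
    unfolding holds_def using free_vars_Far[of m n r] by (intro sat_cong) (auto simp: assign_def)
  moreover have *: "\<forall>\<^sub>F i in U. sat M (assign [x, y, d]) (Far m n r) \<longleftrightarrow>
      \<not> (\<bar>of_int m * \<rho> x i + of_int n * \<rho> y i - \<rho> d i\<bar> \<le> rad r)"
    using ev_rsat_iff_sat[of "assign [x, y, d]" "Far m n r", OF v]
    by eventually_elim (auto simp: Far_def Let_def assign_def nth_Cons')
  have "\<not> sat M (assign [x, y, d]) (Far m n r) \<longleftrightarrow>
      (\<forall>\<^sub>F i in U. \<bar>of_int m * \<rho> x i + of_int n * \<rho> y i - \<rho> d i\<bar> \<le> rad r)"
  proof
    assume "\<not> sat M (assign [x, y, d]) (Far m n r)"
    with * show "\<forall>\<^sub>F i in U. \<bar>of_int m * \<rho> x i + of_int n * \<rho> y i - \<rho> d i\<bar> \<le> rad r"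
      by (auto elim: eventually_mono)
  next
    assume "\<forall>\<^sub>F i in U. \<bar>of_int m * \<rho> x i + of_int n * \<rho> y i - \<rho> d i\<bar> \<le> rad r"
    with * have "\<forall>\<^sub>F i in U. \<not> sat M (assign [x, y, d]) (Far m n r)" by eventually_elim simp
    then show "\<not> sat M (assign [x, y, d]) (Far m n r)" by simp
  qed
  ultimately show ?thesis by blast
qed

text \<open>The rational span of \<open>C\<close> and \<open>x\<close>. An element outside
  \<open>nearby (span1 x)\<close> is generic over \<open>x\<close>.\<close>

definition span1 :: "'a \<Rightarrow> 'a set" where
  "span1 x = {z \<in> universe M. \<exists>d\<in>universe C. \<exists>p. \<forall>\<^sub>F i in U. \<rho> z i = of_rat p * \<rho> x i + \<rho> d i}"

lemma span1_subset: "span1 x \<subseteq> universe M"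
  by (auto simp: span1_def)

lemma subspace_span1:
  assumes "x \<in> universe M"
  shows "subspace (span1 x)"
  unfolding subspace_def
proof (intro conjI ballI allI impI)
  have "affine (one M) 0 x (one M)" by simp
  with C_one show "one M \<in> span1 x" unfolding span1_def by (auto intro!: bexI[of _ "one M"] exI[of _ 0])
  fix u v z p q assume u: "u \<in> span1 x" and v: "v \<in> span1 x" and z: "z \<in> universe M"
    "lincomb z p u q v"
  from u obtain d a where d: "d \<in> universe C" "affine u a x d" by (auto simp: span1_def)
  from v obtain e b where e: "e \<in> universe C" "affine v b x e" by (auto simp: span1_def)
  obtain f where f: "f \<in> universe C" "lincomb f p d q e"
    using ex_comb_in[OF subspace_C d(1) e(1)] by blast
  have "affine z (p * a + q * b) x f"
    using z(2) d(2) e(2) f(2) by eventually_elim (simp add: of_rat_add of_rat_mult algebra_simps)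
  with f(1) z(1) show "z \<in> span1 x" by (auto simp: span1_def)
qed (auto simp: span1_def)

lemma C_subset_span1: "universe C \<subseteq> span1 x"
proof
  fix d assume d: "d \<in> universe C"
  have "affine d 0 x d" by simp
  with d C_sub show "d \<in> span1 x" unfolding span1_def by blast
qed

lemma in_span1: "x \<in> universe M \<Longrightarrow> x \<in> span1 x"
proof -
  assume x: "x \<in> universe M"
  have "affine x 1 x (zero M)" using ev_zero by eventually_elim simp
  with x C_zero show ?thesis unfolding span1_def by blast
qed

lemma nearby_mono: "X \<subseteq> Y \<Longrightarrow> nearby X \<subseteq> nearby Y"
  by (auto simp: nearby_def)

lemma outside_span1_in_Q: "\<lbrakk>y \<in> universe M; y \<notin> nearby (span1 x)\<rbrakk> \<Longrightarrow> y \<in> Q"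
  using nearby_mono[OF C_subset_span1] by (auto simp: Q_def W_def)

text \<open>Two steps of \<open>sat_drop_unbounded\<close>: \<open>y\<close> is infinite over the
  span of \<open>x\<close>, and then \<open>x\<close> is infinite over \<open>C\<close>. Nothing of
  the pair remains, so all generic pairs have one type.\<close>

lemma holds_generic:
  assumes x: "x \<in> Q" and y: "y \<in> universe M" "y \<notin> nearby (span1 x)"
    and \<phi>: "(\<phi>, ds) \<in> formulas_over 2 (universe C)"
  shows "holds M ([x, y] @ ds) \<phi> \<longleftrightarrow> sat M (assign (zero M # zero M # ds))
    (drop_unbounded (delta 0) (drop_unbounded (delta 1) (qe \<phi>)))"
proof -
  have xM: "x \<in> universe M" "x \<notin> nearby (universe C)" using x by (auto simp: Q_def W_def)
  note ds = formulas_overD[OF \<phi>]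
  have C: "universe C \<subseteq> nearby (span1 x)" "span1 x \<subseteq> nearby (span1 x)"
    using subset_trans[OF C_subset_span1] subset_nearby[OF span1_subset] by blast+
  have "holds M ([x, y] @ ds) \<phi> \<longleftrightarrow> sat M (assign (x # y # ds)) (qe \<phi>)"
    using holds_assign[of \<phi> "x # y # ds"] ds y C_sub xM by auto
  also have "\<dots> \<longleftrightarrow> sat M (assign (x # zero M # ds)) (drop_unbounded (delta 1) (qe \<phi>))"
  proof (rule sat_drop_unbounded[OF subspace_span1[OF xM(1)] y])
    fix k
    show "assign (x # zero M # ds) k \<in> nearby (span1 x)"
      using C C_zero C_one ds in_span1[OF xM(1)] by (intro assign_in) auto
    show "assign (x # y # ds) k \<in> universe M"
      using xM y ds C_sub by (intro assign_in) auto
    show "affine (assign (x # y # ds) k) (delta 1 k) y (assign (x # zero M # ds) k)"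
    proof (cases k)
      case (Suc j)
      then show ?thesis using ev_zero by (cases j) (auto simp: delta_def elim: eventually_mono)
    qed (simp add: delta_def)
  qed simp
  also have "\<dots> \<longleftrightarrow> sat M (assign (zero M # zero M # ds)) (drop_unbounded (delta 0) (drop_unbounded (delta 1) (qe \<phi>)))"
  proof (rule sat_drop_unbounded[OF subspace_C xM])
    fix k
    show "assign (zero M # zero M # ds) k \<in> nearby (universe C)"
      using C_sub_W C_zero C_one ds unfolding W_def[symmetric] by (intro assign_in) auto
    show "assign (x # zero M # ds) k \<in> universe M"
      using xM ds C_sub by (intro assign_in) auto
    show "affine (assign (x # zero M # ds) k) (delta 0 k) x (assign (zero M # zero M # ds) k)"
      using ev_zero by (cases k) (auto simp: delta_def elim: eventually_mono)
  qed simp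
  finally show ?thesis .
qed

lemma infinite_C: "infinite (universe C)"
proof
  assume "finite (universe C)"
  moreover have m: "mult M k (one M) \<in> universe C" for k
    by (induction k) (simp_all add: C_zero C_one subspace_add[OF subspace_C])
  ultimately have "\<not> inj (\<lambda>k. mult M k (one M))"
    by (metis finite_subset finite_imageD image_subsetI infinite_UNIV_nat)
  moreover have "inj (\<lambda>k. mult M k (one M))"
  proof (rule injI)
    fix k l assume eq: "mult M k (one M) = mult M l (one M)"
    have "\<forall>\<^sub>F i in U. real k = real l"
      using ev_mult[OF one_closed, of k, unfolded eq] ev_mult[OF one_closed, of l] ev_one
      by eventually_elim simp
    then show "k = l" by simp
  qed
  ultimately show False ..
qed

text \<open>The two spans together have no more elements than \<open>C\<close>, so saturation of
  \<open>M\<close> reaches beyond both.\<close>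

lemma ex_generic_over_pair:
  assumes "x \<in> universe M" "y \<in> universe M"
  shows "\<exists>z\<in>universe M. z \<notin> nearby (span1 x) \<and> z \<notin> nearby (span1 y)"
proof -
  \<comment> \<open>Eventually equal elements are equal, so an element of a span is determined by
    its coefficient \<open>p\<close> and its part \<open>d\<close> in \<open>C\<close>. The flag
    \<open>w\<close> says which of the two spans is meant.\<close>
  define g where "g = (\<lambda>(d, w, p). SOME z. z \<in> universe M \<and> (affine z p (if w then x else y) d))"
  have "z \<in> g ` (universe C \<times> (UNIV :: (bool \<times> rat) set))" if z: "z \<in> span1 (if w then x else y)" for z w
  proof -
    obtain d p where d: "d \<in> universe C" and z: "z \<in> universe M" "affine z p (if w then x else y) d"
      using z by (auto simp: span1_def)
    have "\<exists>z. z \<in> universe M \<and> (affine z p (if w then x else y) d)" using z by blast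
    from someI_ex[OF this] have "g (d, w, p) \<in> universe M"
      "affine (g (d, w, p)) p (if w then x else y) d"
      by (simp_all add: g_def)
    moreover from this(2) z(2) have "\<forall>\<^sub>F i in U. \<rho> z i = \<rho> (g (d, w, p)) i" by eventually_elim simp
    ultimately have "z = g (d, w, p)" using eq_if_ev_eq z(1) by blast
    with d show ?thesis by blast
  qed
  from this[of _ True] this[of _ False]
  have "span1 x \<union> span1 y \<subseteq> g ` (universe C \<times> (UNIV :: (bool \<times> rat) set))" by auto
  then have "|span1 x \<union> span1 y| \<le>o |universe C \<times> (UNIV :: (bool \<times> rat) set)|"
    by (rule card_of_subset_image)
  also have "|universe C \<times> (UNIV :: (bool \<times> rat) set)| \<le>o |universe C|"
    by (intro card_of_Times_ordLeq countable_card_ordLeq infinite_C) simp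
  finally have "|span1 x \<union> span1 y| <o \<kappa>'" using C_less ordLeq_ordLess_trans by blast
  then obtain z where "z \<in> universe M" "z \<notin> nearby (span1 x \<union> span1 y)"
    using ex_far[of "span1 x \<union> span1 y"] by (auto simp: span1_def)
  then show ?thesis using nearby_mono[of "span1 x" "span1 x \<union> span1 y"] nearby_mono[of "span1 y" "span1 x \<union> span1 y"] by blast
qed

end

section \<open>A definable equivalence relation that is not total is covered by finitely many
  lines\<close>

locale definable_equiv = saturated_pair C M U \<rho> \<kappa> \<kappa>'
  for C M :: "'a Lstruct" and U :: "'i filter" and \<rho> and \<kappa> :: "'k rel" and \<kappa>' :: "'l rel" +
  fixes F :: "('a \<times> 'a) set" and D :: "'a set" and \<pi> :: "'a pfm set"
  assumes equiv: "equiv Q F" and D: "D \<subseteq> universe C" "|D| <o \<kappa>"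
    and \<pi>: "partial_type M 2 D \<pi>" and F: "F = {(x, y) \<in> Q \<times> Q. realizes M [x, y] \<pi>}"
begin

lemma F_sym: "(x, y) \<in> F \<Longrightarrow> (y, x) \<in> F"
  and F_trans: "\<lbrakk>(x, y) \<in> F; (y, z) \<in> F\<rbrakk> \<Longrightarrow> (x, z) \<in> F"
  and F_refl: "x \<in> Q \<Longrightarrow> (x, x) \<in> F"
  and F_Q: "(x, y) \<in> F \<Longrightarrow> x \<in> Q" "(x, y) \<in> F \<Longrightarrow> y \<in> Q"
proof -
  show "(x, y) \<in> F \<Longrightarrow> (y, x) \<in> F" "\<lbrakk>(x, y) \<in> F; (y, z) \<in> F\<rbrakk> \<Longrightarrow> (x, z) \<in> F" "x \<in> Q \<Longrightarrow> (x, x) \<in> F"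
    using equiv by (auto simp: equiv_def refl_on_def dest: symD transD)
qed (auto simp: F)

lemma \<pi>_over: "(\<phi>, ds) \<in> \<pi> \<Longrightarrow> (\<phi>, ds) \<in> formulas_over 2 D" "(\<phi>, ds) \<in> \<pi> \<Longrightarrow> (\<phi>, ds) \<in> formulas_over 2 (universe C)"
  using \<pi> D by (fastforce simp: partial_type_def formulas_over_def)+

lemma F_iff: "\<lbrakk>x \<in> Q; y \<in> Q\<rbrakk> \<Longrightarrow> (x, y) \<in> F \<longleftrightarrow> (\<forall>(\<phi>, ds)\<in>\<pi>. holds M ([x, y] @ ds) \<phi>)"
  by (simp add: F realizes_def)

lemma total_if_generic:
  assumes xy: "(x, y) \<in> F" "y \<notin> nearby (span1 x)"
  shows "F = Q \<times> Q"
proof -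
  note Q = F_Q[OF xy(1)]
  have generic: "(x', y') \<in> F" if "x' \<in> Q" "y' \<in> universe M" "y' \<notin> nearby (span1 x')" for x' y'
  proof -
    have y'Q: "y' \<in> Q" using outside_span1_in_Q that by blast
    have "holds M ([x', y'] @ ds) \<phi>" if "(\<phi>, ds) \<in> \<pi>" for \<phi> ds
      using holds_generic[OF Q(1) Q_M[OF Q(2)] xy(2) \<pi>_over(2)[OF that]]
        holds_generic[OF \<open>x' \<in> Q\<close> \<open>y' \<in> universe M\<close> \<open>y' \<notin> nearby (span1 x')\<close> \<pi>_over(2)[OF that]]
        xy(1) that Q by (auto simp: F_iff)
    then show ?thesis using that(1) y'Q by (auto simp: F_iff)
  qed
  have "(u, v) \<in> F" if uv: "u \<in> Q" "v \<in> Q" for u v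
  proof -
    obtain z where "z \<in> universe M" "z \<notin> nearby (span1 u)" "z \<notin> nearby (span1 v)"
      using ex_generic_over_pair[OF Q_M[OF uv(1)] Q_M[OF uv(2)]] by blast
    then have "(u, z) \<in> F" "(v, z) \<in> F" using generic uv by auto
    then show ?thesis using F_sym F_trans by blast
  qed
  then show ?thesis unfolding F by blast
qed

definition covers :: "rat \<times> 'a \<times> nat \<Rightarrow> 'a \<Rightarrow> 'a \<Rightarrow> bool" where
  "covers = (\<lambda>(a, d, n) x y. \<forall>\<^sub>F i in U. \<bar>\<rho> y i - of_rat a * \<rho> x i - \<rho> d i\<bar> \<le> real n)"

text \<open>If exactly one coefficient vanished, a nonzero multiple of an element of
  \<open>Q\<close> would be close to \<open>C\<close>.\<close>

lemma near_line:
  assumes xy: "(x, y) \<in> F" and d: "d \<in> universe C" and mn: "(m, n) \<noteq> (0, 0)"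
    and bd: "\<forall>\<^sub>F i in U. \<bar>of_int m * \<rho> x i + of_int n * \<rho> y i - \<rho> d i\<bar> \<le> B"
  shows "m \<noteq> 0" "n \<noteq> 0"
proof -
  obtain k :: nat where k: "B \<le> real k" using real_arch_simple by blast
  have dM: "d \<in> universe M" using d C_sub by blast
  obtain d' where d': "d' \<in> universe C" "lincomb d' (-1) d 0 d"
    using ex_comb_in[OF subspace_C d d] by blast
  have d'W: "d' \<in> nearby (universe C)" using d' C_sub_W by (auto simp: W_def)
  have no: False if "z \<in> Q" "l \<noteq> 0" "\<forall>\<^sub>F i in U. \<bar>of_int l * \<rho> z i - \<rho> d i\<bar> \<le> B" for z l
  proof -
    have z: "z \<in> universe M" "z \<notin> nearby (universe C)" using that by (auto simp: Q_def W_def)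
    have "(of_int l :: rat) \<noteq> 0" using that(2) by simp
    from unbounded_outside_nearby[OF subspace_C z d'W this, of k] d'(2) that(3)
    have "\<forall>\<^sub>F i in U. False" by eventually_elim (use k in simp)
    then show False by simp
  qed
  show "m \<noteq> 0" using no[of y n] mn bd F_Q[OF xy] by auto
  show "n \<noteq> 0" using no[of x m] mn bd F_Q[OF xy] by auto
qed

text \<open>Otherwise compactness yields an equivalent pair in which no nontrivial combination is close to
  \<open>C\<close>. All such pairs have the same type, and two arbitrary elements of \<open>Q\<close> can be joined by
  two of them, so \<open>F\<close> would be total.\<close>

lemma ex_cover:
  assumes "F \<noteq> Q \<times> Q"
  shows "\<exists>L. finite L \<and> (\<forall>(a, d, n)\<in>L. a \<noteq> 0 \<and> d \<in> universe C) \<and> (\<forall>(x, y)\<in>F. \<exists>t\<in>L. covers t x y)"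
proof -
  \<comment> \<open>Slopes are rational, so integer coefficients \<open>m\<close> and
    \<open>n\<close> reach every line.\<close>
  define \<Sigma> where "\<Sigma> = \<pi> \<union> {(Far m n r, [d]) | m n r d. (m, n) \<noteq> (0, 0) \<and> d \<in> universe C}"
  have \<Sigma>: "\<Sigma> \<subseteq> formulas_over 2 (universe C)"
    using \<pi>_over(2) free_vars_Far by (fastforce simp: \<Sigma>_def formulas_over_def)
  have "\<not> partial_type M 2 (universe C) \<Sigma>"
  proof
    assume "partial_type M 2 (universe C) \<Sigma>"
    from saturated_realizes[OF sat_M C_sub C_less this]
    obtain x y where xy: "x \<in> universe M" "y \<in> universe M" "realizes M [x, y] \<Sigma>"
      by (auto simp: numeral_2_eq_2 length_Suc_conv)
    have far: "\<not> (\<forall>\<^sub>F i in U. \<bar>of_int m * \<rho> x i + of_int n * \<rho> y i - \<rho> d i\<bar> \<le> real B)"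
      if "(m, n) \<noteq> (0, 0)" "d \<in> universe C" for m n d B
    proof
      assume bd: "\<forall>\<^sub>F i in U. \<bar>of_int m * \<rho> x i + of_int n * \<rho> y i - \<rho> d i\<bar> \<le> real B"
      have pos: "0 < rat_of_nat B + 1" by (metis add_nonneg_pos of_nat_0_le_iff zero_less_one)
      obtain r where r: "rad r = of_rat (of_nat B + 1)" using obtain_rad[OF pos] by blast
      have "(Far m n r, [d]) \<in> \<Sigma>" using that by (auto simp: \<Sigma>_def)
      from realizesD[OF xy(3) this] holds_Far[OF xy(1,2), of d m n r] that C_sub
      have "\<not> (\<forall>\<^sub>F i in U. \<bar>of_int m * \<rho> x i + of_int n * \<rho> y i - \<rho> d i\<bar> \<le> rad r)" by auto
      moreover have "\<forall>\<^sub>F i in U. \<bar>of_int m * \<rho> x i + of_int n * \<rho> y i - \<rho> d i\<bar> \<le> rad r"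
        using bd by eventually_elim (simp add: r of_rat_add)
      ultimately show False ..
    qed
    have "x \<notin> nearby (universe C)"
      using far[of 1 0] by (auto simp: nearby_def)
    then have xQ: "x \<in> Q" using xy by (simp add: Q_def W_def)
    have y: "y \<notin> nearby (span1 x)"
    proof
      assume "y \<in> nearby (span1 x)"
      then obtain z B where z: "z \<in> span1 x" "close y z B" by (auto simp: nearby_def)
      then obtain d p where d: "d \<in> universe C" "affine z p x d" by (auto simp: span1_def)
      \<comment> \<open>Clearing the denominator of \<open>p\<close> turns closeness to
        \<open>p x + d\<close> into a bounded integer combination, which \<open>far\<close>
        excludes.\<close>
      obtain a b where ab: "quotient_of p = (a, b)" by fastforce
      then have b: "b > 0" and p: "p = of_int a / of_int b"
        using quotient_of_denom_pos quotient_of_div by auto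
      obtain d' where d': "d' \<in> universe C" "lincomb d' (of_int b) d 0 d"
        using ex_comb_in[OF subspace_C d(1) d(1)] by blast
      have "\<forall>\<^sub>F i in U. \<bar>of_int (- a) * \<rho> x i + of_int b * \<rho> y i - \<rho> d' i\<bar> \<le> real (nat b * B)"
        using z(2) d(2) d'(2)
      proof eventually_elim
        case (elim i)
        have "of_int (- a) * \<rho> x i + of_int b * \<rho> y i - \<rho> d' i = of_int b * (\<rho> y i - \<rho> z i)"
          using elim b by (simp add: p of_rat_divide field_simps)
        then show ?case using elim b by (simp add: abs_mult mult_left_mono)
      qed
      with far[of "- a" b d' "nat b * B"] b d'(1) show False by auto
    qed
    have yQ: "y \<in> Q" using outside_span1_in_Q[OF xy(2) y] .
    have "(x, y) \<in> F" using xQ yQ xy(3) realizes_mono[of M "[x, y]" \<Sigma> \<pi>] by (auto simp: F \<Sigma>_def)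
    with total_if_generic y assms show False by blast
  qed
  then obtain \<Sigma>0 where \<Sigma>0: "finite \<Sigma>0" "\<Sigma>0 \<subseteq> \<Sigma>"
    and none: "\<not> (\<exists>xs. length xs = 2 \<and> set xs \<subseteq> universe M \<and> realizes M xs \<Sigma>0)"
    using \<Sigma> unfolding partial_type_def by blast
  have unsat: "\<not> realizes M [x, y] \<Sigma>0" if "x \<in> universe M" "y \<in> universe M" for x y
    using none that by (metis empty_set empty_subsetI insert_subset length_Cons list.simps(15) list.size(3) numeral_2_eq_2)
  \<comment> \<open>Every pair in \<open>F\<close> violates some member of \<Sigma>0, and never one
    from \<open>\<pi>\<close>. What it violates is therefore a \<open>Far\<close> formula, whose
    failure places the pair in a bounded neighbourhood of a line.\<close>
  have "\<exists>t. fst t \<noteq> 0 \<and> fst (snd t) \<in> universe C \<and>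
      (\<forall>(x, y)\<in>F. \<not> holds M ([x, y] @ snd s) (fst s) \<longrightarrow> covers t x y)" if s: "s \<in> \<Sigma>0" for s
  proof (cases "\<exists>(x, y)\<in>F. \<not> holds M ([x, y] @ snd s) (fst s)")
    case False
    \<comment> \<open>No pair of \<open>F\<close> violates \<open>s\<close>, so any triple of the
      right shape serves.\<close>
    then show ?thesis using C_zero by (intro exI[of _ "(1, zero M, 0)"]) auto
  next
    case True
    then obtain x0 y0 where xy0: "(x0, y0) \<in> F" "\<not> holds M ([x0, y0] @ snd s) (fst s)" by blast
    then have "s \<notin> \<pi>" using F_iff[OF F_Q[OF xy0(1)]] by (auto simp: case_prod_unfold)
    then obtain m n r d where sd: "s = (Far m n r, [d])" and mn: "(m, n) \<noteq> (0, 0)" and d: "d \<in> universe C"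
      using s \<Sigma>0(2) by (auto simp: \<Sigma>_def)
    have dM: "d \<in> universe M" using d C_sub by blast
    have bd: "\<forall>\<^sub>F i in U. \<bar>of_int m * \<rho> x i + of_int n * \<rho> y i - \<rho> d i\<bar> \<le> rad r"
      if "(x, y) \<in> F" "\<not> holds M ([x, y] @ snd s) (fst s)" for x y
      using that(2) holds_Far[OF Q_M[OF F_Q(1)[OF that(1)]] Q_M[OF F_Q(2)[OF that(1)]] dM, of m n r] by (simp add: sd)
    note nz = near_line[OF xy0(1) d mn bd[OF xy0]]
    define a :: rat where "a = - of_int m / of_int n"
    obtain d' where d': "d' \<in> universe C" "lincomb d' (1 / of_int n) d 0 d"
      using ex_comb_in[OF subspace_C d d] by blast
    obtain k :: nat where k: "rad r \<le> real k" using real_arch_simple by blast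
    have "covers (a, d', k) x y" if "(x, y) \<in> F" "\<not> holds M ([x, y] @ snd s) (fst s)" for x y
      unfolding covers_def prod.case
      using bd[OF that] d'(2)
    proof eventually_elim
      case (elim i)
      have "of_int m * \<rho> x i + of_int n * \<rho> y i - \<rho> d i = of_int n * (\<rho> y i - of_rat a * \<rho> x i - \<rho> d' i)"
        using elim(2) nz by (simp add: a_def of_rat_divide of_rat_minus field_simps)
      then have "\<bar>of_int n\<bar> * \<bar>\<rho> y i - of_rat a * \<rho> x i - \<rho> d' i\<bar> \<le> rad r"
        using elim(1) by (simp add: abs_mult)
      moreover have "1 * \<bar>\<rho> y i - of_rat a * \<rho> x i - \<rho> d' i\<bar> \<le> \<bar>of_int n\<bar> * \<bar>\<rho> y i - of_rat a * \<rho> x i - \<rho> d' i\<bar>"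
        using nz by (intro mult_right_mono) linarith+
      ultimately have "1 * \<bar>\<rho> y i - of_rat a * \<rho> x i - \<rho> d' i\<bar> \<le> rad r"
        by (rule order_trans[rotated])
      with k show ?case by simp
    qed
    moreover have "a \<noteq> 0" using nz by (simp add: a_def)
    ultimately show ?thesis using d'(1) by (intro exI[of _ "(a, d', k)"]) auto
  qed
  then obtain g where g: "\<And>s. s \<in> \<Sigma>0 \<Longrightarrow> fst (g s) \<noteq> 0 \<and> fst (snd (g s)) \<in> universe C \<and>
      (\<forall>(x, y)\<in>F. \<not> holds M ([x, y] @ snd s) (fst s) \<longrightarrow> covers (g s) x y)"
    using bchoice[of \<Sigma>0 "\<lambda>s t. fst t \<noteq> 0 \<and> fst (snd t) \<in> universe C \<and>
      (\<forall>(x, y)\<in>F. \<not> holds M ([x, y] @ snd s) (fst s) \<longrightarrow> covers t x y)"] by blast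
  have "\<exists>t\<in>g ` \<Sigma>0. covers t x y" if xy: "(x, y) \<in> F" for x y
  proof -
    obtain s where "s \<in> \<Sigma>0" "\<not> holds M ([x, y] @ snd s) (fst s)"
      using unsat[OF Q_M[OF F_Q(1)[OF xy]] Q_M[OF F_Q(2)[OF xy]]] by (auto simp: realizes_def)
    with g xy show ?thesis by blast
  qed
  with \<Sigma>0(1) g show ?thesis by (intro exI[of _ "g ` \<Sigma>0"]) (auto simp: case_prod_unfold)
qed

end

lemma abs_diff_le_double: "\<lbrakk>\<bar>a - c\<bar> \<le> R; \<bar>b - c\<bar> \<le> R\<rbrakk> \<Longrightarrow> \<bar>b - a\<bar> \<le> 2 * (R :: real)"
  by linarith

section \<open>The group of affine maps that preserve the classes\<close>

context definable_equiv
begin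

text \<open>By quantifier elimination, whether \<open>x\<close> is equivalent to \<open>a x + e\<close> does not depend on \<open>x \<in> Q\<close>, so
  \<open>G\<close> is a group of affine maps under composition.\<close>

definition G :: "(rat \<times> 'a) set" where
  "G = {(a, e). a \<noteq> 0 \<and> e \<in> W \<and> (\<exists>x\<in>Q. \<exists>y\<in>universe M.
     (affine y a x e) \<and> (x, y) \<in> F)}"

lemma G_I:
  assumes "(x, y) \<in> F" "affine y a x e" "a \<noteq> 0" "e \<in> W"
  shows "(a, e) \<in> G"
  unfolding G_def using assms F_Q[OF assms(1)] Q_M by blast

lemma G_W: "(a, e) \<in> G \<Longrightarrow> e \<in> W" and G_M: "(a, e) \<in> G \<Longrightarrow> e \<in> universe M"
  and G_nonzero: "(a, e) \<in> G \<Longrightarrow> a \<noteq> 0"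
  using W_sub by (auto simp: G_def)

lemma G_iff:
  assumes x: "x \<in> Q" and y: "y \<in> universe M" "affine y a x e"
    and e: "e \<in> W" and a: "a \<noteq> 0"
  shows "(a, e) \<in> G \<longleftrightarrow>
    (\<forall>(\<phi>, ds)\<in>\<pi>. sat M (assign (zero M # e # ds)) (drop_unbounded (line a) (qe \<phi>)))"
    and "(a, e) \<in> G \<longleftrightarrow> (x, y) \<in> F"
proof -
  have F: "(x', y') \<in> F \<longleftrightarrow>
      (\<forall>(\<phi>, ds)\<in>\<pi>. sat M (assign (zero M # e # ds)) (drop_unbounded (line a) (qe \<phi>)))"
    if "x' \<in> Q" "y' \<in> universe M" "affine y' a x' e" for x' y'
    unfolding F_iff[OF that(1) line_in_Q[OF that e a]]
    using holds_line[OF that e \<pi>_over(2)] by fastforce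
  show "(a, e) \<in> G \<longleftrightarrow> (x, y) \<in> F"
  proof
    assume "(a, e) \<in> G"
    then obtain x' y' where "x' \<in> Q" "y' \<in> universe M" "affine y' a x' e" "(x', y') \<in> F"
      by (auto simp: G_def)
    with F[OF this(1-3)] F[OF x y] show "(x, y) \<in> F" by blast
  next
    assume "(x, y) \<in> F"
    from G_I[OF this y(2) a e] show "(a, e) \<in> G" .
  qed
  with F[OF x y] show "(a, e) \<in> G \<longleftrightarrow>
    (\<forall>(\<phi>, ds)\<in>\<pi>. sat M (assign (zero M # e # ds)) (drop_unbounded (line a) (qe \<phi>)))" by blast
qed

lemma ex_line:
  assumes "x \<in> Q" "e \<in> universe M"
  obtains y where "y \<in> universe M" "affine y a x e"
  using ex_comb[OF Q_M[OF assms(1)] assms(2), of a 1] by auto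

text \<open>The pair has disappeared: for a fixed slope, membership in \<open>G\<close> depends only
  on the type of \<open>e\<close> over \<open>D\<close>. This is what later permits the centre of a
  reflection to be replaced by an element of \<open>C\<close>.\<close>

lemma G_sat_iff:
  assumes "e \<in> W" "a \<noteq> 0"
  shows "(a, e) \<in> G \<longleftrightarrow>
    (\<forall>(\<phi>, ds)\<in>\<pi>. sat M (assign (zero M # e # ds)) (drop_unbounded (line a) (qe \<phi>)))"
proof -
  obtain x where x: "x \<in> Q" using Q_nonempty by blast
  obtain y where "y \<in> universe M" "affine y a x e"
    using ex_line[OF x] assms(1) W_sub by blast
  from G_iff(1)[OF x this assms] show ?thesis .
qed

lemma G_comp:
  assumes e: "(a, e) \<in> G" and f: "(b, f) \<in> G" and g: "g \<in> universe M"
    and eq: "affine g b e f"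
  shows "(b * a, g) \<in> G"
proof -
  obtain x where x: "x \<in> Q" using Q_nonempty by blast
  obtain y where y: "y \<in> universe M" "affine y a x e"
    using ex_line[OF x G_M[OF e]] by blast
  have yQ: "y \<in> Q" using line_in_Q[OF x y G_W[OF e] G_nonzero[OF e]] .
  obtain z where z: "z \<in> universe M" "affine z b y f"
    using ex_line[OF yQ G_M[OF f]] by blast
  have "(x, y) \<in> F" using G_iff(2)[OF x y G_W[OF e] G_nonzero[OF e]] e by simp
  moreover have "(y, z) \<in> F" using G_iff(2)[OF yQ z G_W[OF f] G_nonzero[OF f]] f by simp
  ultimately have "(x, z) \<in> F" by (rule F_trans)
  moreover have "affine z (b * a) x g"
    using y(2) z(2) eq by eventually_elim (simp add: of_rat_mult algebra_simps)
  moreover have "g \<in> W"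
    using subspaceD(3)[OF subspace_W G_W[OF e] G_W[OF f] g, of b 1] eq by simp
  ultimately show ?thesis using G_nonzero[OF e] G_nonzero[OF f] by (intro G_I) auto
qed

lemma G_one: "(1, zero M) \<in> G"
proof -
  obtain x where x: "x \<in> Q" using Q_nonempty by blast
  have "affine x 1 x (zero M)" using ev_zero by eventually_elim simp
  then show ?thesis using C_zero C_sub_W by (intro G_I[OF F_refl[OF x]]) auto
qed

definition H :: "'a set" where "H = {e. (1, e) \<in> G}"

lemma H_M: "e \<in> H \<Longrightarrow> e \<in> universe M"
  using G_M by (auto simp: H_def)

lemma zero_H: "zero M \<in> H"
  using G_one by (simp add: H_def)

lemma H_add: "\<lbrakk>e \<in> H; f \<in> H\<rbrakk> \<Longrightarrow> add M e f \<in> H"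
  using G_comp[of 1 e 1 f "add M e f"] G_M[of 1 e] G_M[of 1 f] ev_add[of e f] by (simp add: H_def)

lemma H_neg:
  assumes "e \<in> H" shows "neg M e \<in> H"
proof -
  have e: "(1, e) \<in> G" using assms by (simp add: H_def)
  obtain x where x: "x \<in> Q" using Q_nonempty by blast
  obtain y where y: "y \<in> universe M" "affine y 1 x e"
    using ex_line[OF x G_M[OF e]] by blast
  have "(x, y) \<in> F" using G_iff(2)[OF x y G_W[OF e]] e by simp
  moreover have "affine x 1 y (neg M e)"
    using y(2) ev_neg[OF G_M[OF e]] by eventually_elim simp
  moreover have "neg M e \<in> W" using subspace_neg[OF subspace_W G_W[OF e]] .
  ultimately have "(1, neg M e) \<in> G" by (intro G_I[OF F_sym]) auto
  then show ?thesis by (simp add: H_def)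
qed

lemma H_mult: "e \<in> H \<Longrightarrow> mult M n e \<in> H"
  by (induction n) (auto simp: zero_H H_add)

lemma F_if_diff_in_H:
  assumes "x \<in> Q" "y \<in> Q"
  shows "diff M x y \<in> H \<Longrightarrow> (x, y) \<in> F"
proof -
  note M = Q_M[OF assms(1)] Q_M[OF assms(2)]
  assume "diff M x y \<in> H"
  then have *: "(1, diff M x y) \<in> G" by (simp add: H_def)
  have "affine x 1 y (diff M x y)"
    using ev_diff[OF M] by eventually_elim simp
  with G_iff(2)[OF assms(2) M(1) _ G_W[OF *]] * have "(y, x) \<in> F" by simp
  then show "(x, y) \<in> F" by (rule F_sym)
qed

end

section \<open>Finiteness of the slopes and smallness of the translations\<close>

locale proper_definable_equiv = definable_equiv +
  assumes proper: "F \<noteq> Q \<times> Q"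
begin

definition L :: "(rat \<times> 'a \<times> nat) set" where
  "L = (SOME L. finite L \<and> (\<forall>(a, d, n)\<in>L. a \<noteq> 0 \<and> d \<in> universe C) \<and> (\<forall>(x, y)\<in>F. \<exists>t\<in>L. covers t x y))"

lemma finite_L: "finite L" and L_C: "(a, d, n) \<in> L \<Longrightarrow> a \<noteq> 0 \<and> d \<in> universe C"
  and L_cover: "(x, y) \<in> F \<Longrightarrow> \<exists>(a, d, n)\<in>L. \<forall>\<^sub>F i in U. \<bar>\<rho> y i - of_rat a * \<rho> x i - \<rho> d i\<bar> \<le> real n"
proof -
  note L = someI_ex[OF ex_cover[OF proper], folded L_def]
  show "finite L" using L by blast
  show "(a, d, n) \<in> L \<Longrightarrow> a \<noteq> 0 \<and> d \<in> universe C" using L by blast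
  assume "(x, y) \<in> F"
  with L have "\<exists>t\<in>L. covers t x y" by blast
  then show "\<exists>(a, d, n)\<in>L. \<forall>\<^sub>F i in U. \<bar>\<rho> y i - of_rat a * \<rho> x i - \<rho> d i\<bar> \<le> real n"
    by (simp add: covers_def case_prod_unfold)
qed

text \<open>The cover puts \<open>e = y - a x\<close> near some \<open>d\<close> in
  \<open>C\<close>, so no pair of \<open>F\<close> escapes the description by
  \<open>G\<close>.\<close>

lemma F_imp_G:
  assumes "(x, y) \<in> F"
  shows "\<exists>a e. (a, e) \<in> G \<and> (affine y a x e)"
proof -
  obtain a d n where L: "(a, d, n) \<in> L" and cov: "\<forall>\<^sub>F i in U. \<bar>\<rho> y i - of_rat a * \<rho> x i - \<rho> d i\<bar> \<le> real n"
    using L_cover[OF assms] by blast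
  obtain e where e: "e \<in> universe M" "lincomb e 1 y (- a) x"
    using ex_comb[of y x] Q_M F_Q[OF assms] by blast
  have "close e d n"
    using e(2) cov by eventually_elim (simp add: of_rat_minus)
  then have eW: "e \<in> W" using e(1) L_C[OF L] by (auto simp: W_def nearby_def)
  have eq: "affine y a x e"
    using e(2) by eventually_elim (simp add: of_rat_minus)
  with G_I[OF assms eq _ eW] L_C[OF L] show ?thesis by blast
qed

text \<open>The line \<open>y = a x + e\<close> cannot run close to a line of another slope
  \<open>a'\<close>, because \<open>(a - a') x\<close> is unbounded over \<open>W\<close>.\<close>

lemma G_cover:
  assumes G: "(a, e) \<in> G"
  shows "\<exists>(a', d, n)\<in>L. a' = a \<and> (close e d n)"
proof -
  obtain x where x: "x \<in> Q" using Q_nonempty by blast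
  obtain y where y: "y \<in> universe M" "affine y a x e"
    using ex_line[OF x G_M[OF G]] by blast
  have "(x, y) \<in> F" using G_iff(2)[OF x y G_W[OF G] G_nonzero[OF G]] G by simp
  then obtain a' d n where L: "(a', d, n) \<in> L"
    and cov: "\<forall>\<^sub>F i in U. \<bar>\<rho> y i - of_rat a' * \<rho> x i - \<rho> d i\<bar> \<le> real n"
    using L_cover by blast
  have dC: "d \<in> universe C" using L_C[OF L] by blast
  then have dW: "d \<in> W" using C_sub_W by blast
  obtain f where f: "f \<in> W" "lincomb f 1 e (- 1) d"
    using ex_comb_in[OF subspace_W G_W[OF G] dW] by blast
  have "a' = a"
  proof (rule ccontr)
    assume "a' \<noteq> a"
    then have "a - a' \<noteq> 0" by simp
    moreover have "x \<in> universe M" "x \<notin> nearby (universe C)" using x by (auto simp: Q_def W_def)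
    ultimately have "\<forall>\<^sub>F i in U. \<bar>of_rat (a - a') * \<rho> x i + \<rho> f i\<bar> > real n"
      using unbounded_outside_nearby[OF subspace_C] f(1) unfolding W_def by blast
    with cov y(2) f(2) have "\<forall>\<^sub>F i in U. False"
      by eventually_elim (simp add: of_rat_diff of_rat_minus algebra_simps)
    then show False by simp
  qed
  moreover have "close e d n"
    using cov y(2) by eventually_elim (simp add: \<open>a' = a\<close>)
  ultimately show ?thesis using L by blast
qed

lemma G_power: "(a, e) \<in> G \<Longrightarrow> \<exists>f. (a ^ k, f) \<in> G"
proof (induction k)
  case 0
  then show ?case using G_one by auto
next
  case (Suc k)
  then obtain f where f: "(a ^ k, f) \<in> G" by blast
  obtain g where "g \<in> universe M" "lincomb g a f 1 e"
    using ex_comb[OF G_M[OF f] G_M[OF Suc.prems]] by blast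
  then have "(a * a ^ k, g) \<in> G" using G_comp[OF f Suc.prems] by simp
  then show ?case by auto
qed

text \<open>The slopes form a finite subgroup of the nonzero rationals.\<close>

lemma G_slope:
  assumes "(a, e) \<in> G"
  shows "a = 1 \<or> a = - 1"
proof -
  have power: "a ^ k \<in> fst ` L" for k
  proof -
    obtain f where "(a ^ k, f) \<in> G" using G_power[OF assms] by blast
    from G_cover[OF this] show ?thesis by force
  qed
  have "finite (range (\<lambda>k. a ^ k))"
    by (rule finite_subset[OF _ finite_imageI[OF finite_L]]) (use power in blast)
  then have "\<not> inj (\<lambda>k. a ^ k)" using finite_imageD infinite_UNIV_nat by blast
  then obtain j k where jk: "j < k" "a ^ j = a ^ k" unfolding inj_def by (metis linorder_neqE_nat)
  have "a ^ k = a ^ j * a ^ (k - j)" using jk(1) by (simp flip: power_add)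
  with jk(2) have "a ^ j * (a ^ (k - j) - 1) = 0" by (simp add: right_diff_distrib)
  then have "a ^ (k - j) = 1" using G_nonzero[OF assms] by simp
  then have "\<bar>a\<bar> ^ (k - j) = 1" by (simp flip: power_abs)
  then have "\<bar>a\<bar> = 1" using jk(1) power_eq_iff_eq_base[of "k - j" "\<bar>a\<bar>" 1] by simp
  then show ?thesis by linarith
qed

text \<open>The elements \<open>N j e\<close> for all \<open>j\<close> lie in finitely many
  neighbourhoods, so two of them share one and differ by at most \<open>2 * R\<close>. Hence
  \<open>N |e|\<close> is at most \<open>2 * R\<close>, for every \<open>N\<close>.\<close>

lemma H_subset_mu: "H \<subseteq> mu"
proof
  fix e assume e: "e \<in> H"
  have eM: "e \<in> universe M" using H_M[OF e] .
  \<comment> \<open>The bound must be independent of \<open>N\<close>; it dominates the radii of the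
    whole cover.\<close>
  define R where "R = real (Max (insert 0 ((\<lambda>(a, d, n). n) ` L)))"
  have R: "real n \<le> R" if "(a, d, n) \<in> L" for a d n
    unfolding R_def using that finite_L by (auto intro!: Max_ge simp: image_iff)
  have small: "\<forall>\<^sub>F i in U. real N * \<bar>\<rho> e i\<bar> \<le> 2 * R" for N
  proof -
    have "\<exists>t\<in>L. \<forall>\<^sub>F i in U. \<bar>\<rho> (mult M (N * j) e) i - \<rho> (fst (snd t)) i\<bar> \<le> R" for j
    proof -
      have "(1, mult M (N * j) e) \<in> G" using H_mult[OF e] by (simp add: H_def)
      from G_cover[OF this] obtain d n where "(1, d, n) \<in> L"
        "close (mult M (N * j) e) d n" by auto
      then show ?thesis using R[of 1 d n] by (intro bexI[of _ "(1, d, n)"]) (auto elim: eventually_mono)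
    qed
    then obtain g where g: "\<And>j. g j \<in> L" "\<And>j. \<forall>\<^sub>F i in U. \<bar>\<rho> (mult M (N * j) e) i - \<rho> (fst (snd (g j))) i\<bar> \<le> R"
      by metis
    have "\<not> inj g" using g(1) finite_L
      by (metis finite_imageD finite_subset image_subsetI infinite_UNIV_nat)
    then obtain j k where jk: "j < k" "g j = g k" unfolding inj_def by (metis linorder_neqE_nat)
    show ?thesis
      using g(2)[of j] g(2)[of k] ev_mult[OF eM, of "N * j"] ev_mult[OF eM, of "N * k"]
    proof eventually_elim
      case (elim i)
      have "\<bar>real (N * k) * \<rho> e i - real (N * j) * \<rho> e i\<bar> \<le> 2 * R"
        using elim(1,2) unfolding jk(2) elim(3,4) by (rule abs_diff_le_double)
      also have "real (N * k) * \<rho> e i - real (N * j) * \<rho> e i = (real N * (real k - real j)) * \<rho> e i"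
        by (simp add: algebra_simps)
      finally have "(real k - real j) * (real N * \<bar>\<rho> e i\<bar>) \<le> 2 * R"
        using jk(1) by (simp add: abs_mult algebra_simps)
      moreover have "1 * (real N * \<bar>\<rho> e i\<bar>) \<le> (real k - real j) * (real N * \<bar>\<rho> e i\<bar>)"
        using jk(1) by (intro mult_right_mono) auto
      ultimately show ?case by simp
    qed
  qed
  show "e \<in> mu"
    unfolding mu_def
  proof (intro CollectI conjI allI impI eM)
    fix q :: rat assume q: "0 < q"
    obtain N :: nat where N: "2 * R < real N * of_rat q"
      using reals_Archimedean3[of "of_rat q"] q by auto
    show "\<forall>\<^sub>F i in U. \<bar>\<rho> e i\<bar> \<le> of_rat q"
      using small[of N]
    proof eventually_elim
      case (elim i)
      then have "real N * \<bar>\<rho> e i\<bar> < real N * of_rat q" using N by linarith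
      then show ?case by (simp add: mult_less_cancel_left)
    qed
  qed
qed

end

text \<open>Replaces the variable \<open>x\<^sub>1\<close> of \<open>\<phi>\<close> by \<open>x\<^sub>1 + x\<^sub>p\<close>, where \<open>x\<^sub>p\<close> is a parameter appended to the
  list of parameters of \<open>\<phi>\<close>.\<close>

definition shift_fm :: "nat \<Rightarrow> fm \<Rightarrow> fm" where
  "shift_fm p \<phi> = Ex (Suc p) (Conj (Eq (Var (Suc p)) (Plus (Var 1) (Var p)))
     (Ex 1 (Conj (Eq (Var 1) (Var (Suc p))) \<phi>)))"

text \<open>The sum mentions the old value of variable 1, so it is stored in the fresh variable
  \<open>Suc p\<close> before variable 1 is bound again.\<close>

lemma holds_shift_fm:
  assumes "free_vars \<phi> \<subseteq> {..<2 + length ds}" "add M v h \<in> universe M" "p = 2 + length ds"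
  shows "holds M ([x, v] @ ds @ [h]) (shift_fm p \<phi>) \<longleftrightarrow> holds M ([x, add M v h] @ ds) \<phi>"
proof -
  let ?w = "nth ([x, v] @ ds @ [h])"
  have w: "?w 1 = v" "?w p = h" using assms(3) by (auto simp: nth_append)
  have "sat M (?w(Suc p := add M v h, 1 := add M v h)) \<phi> \<longleftrightarrow> sat M (nth ([x, add M v h] @ ds)) \<phi>"
  proof (rule sat_cong)
    fix i assume "i \<in> free_vars \<phi>"
    then have "i < 2 + length ds" using assms(1) by auto
    then show "(?w(Suc p := add M v h, 1 := add M v h)) i = ([x, add M v h] @ ds) ! i"
      using assms(3) by (cases i; cases "i - 1") (auto simp: nth_append)
  qed
  moreover have "sat M ?w (shift_fm p \<phi>) \<longleftrightarrow> sat M (?w(Suc p := add M v h, 1 := add M v h)) \<phi>"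
    using assms(2,3) w by (simp add: shift_fm_def)
  ultimately show ?thesis by (simp add: holds_def)
qed

lemma finite_if_no_two:
  assumes "\<And>k l :: nat. \<lbrakk>k \<in> X; l \<in> X\<rbrakk> \<Longrightarrow> \<not> k < l"
  shows "finite X"
proof (cases "X = {}")
  case False
  then obtain k where k: "k \<in> X" by blast
  then have "X \<subseteq> {k}" using assms[OF k] assms[OF _ k] by (auto simp: not_less intro: antisym)
  then show ?thesis using finite_subset by blast
qed simp

section \<open>Convexity of the group of translations\<close>

context proper_definable_equiv
begin

text \<open>This is \<open>\<phi>\<close> at the pair of \<open>x\<close> and \<open>x + e\<close>,
  as a condition on \<open>e\<close> alone; see \<open>holds_near_fm\<close>.\<close>

definition near_fm :: "fm \<Rightarrow> fm" where
  "near_fm \<phi> = drop_unbounded (line 1) (qe \<phi>)"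

definition critical :: "'a pfm \<Rightarrow> 'a set" where
  "critical = (\<lambda>(\<phi>, ds). SOME S. finite S \<and> S \<subseteq> universe C \<and> (\<forall>e\<in>mu. \<forall>e'\<in>mu. le e e' \<and>
      (\<forall>s\<in>S. \<not> (rel M r1 e s \<and> rel M r1 s e')) \<longrightarrow>
      (sat M (assign (zero M # e # ds)) (near_fm \<phi>) \<longleftrightarrow> sat M (assign (zero M # e' # ds)) (near_fm \<phi>))))"

lemma critical:
  assumes "(\<phi>, ds) \<in> \<pi>"
  shows "finite (critical (\<phi>, ds))" "critical (\<phi>, ds) \<subseteq> universe C"
    "\<lbrakk>e \<in> mu; e' \<in> mu; le e e'; \<And>s. s \<in> critical (\<phi>, ds) \<Longrightarrow> \<not> (rel M r1 e s \<and> rel M r1 s e')\<rbrakk> \<Longrightarrow>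
      sat M (assign (zero M # e # ds)) (near_fm \<phi>) \<longleftrightarrow> sat M (assign (zero M # e' # ds)) (near_fm \<phi>)"
proof -
  have "set ds \<subseteq> universe C" using formulas_overD(1)[OF \<pi>_over(2)[OF assms]] .
  moreover have "qf (near_fm \<phi>)" by (simp add: near_fm_def)
  ultimately have c: "finite (critical (\<phi>, ds)) \<and> critical (\<phi>, ds) \<subseteq> universe C \<and> (\<forall>e\<in>mu. \<forall>e'\<in>mu. le e e' \<and>
      (\<forall>s\<in>critical (\<phi>, ds). \<not> (rel M r1 e s \<and> rel M r1 s e')) \<longrightarrow>
      (sat M (assign (zero M # e # ds)) (near_fm \<phi>) \<longleftrightarrow> sat M (assign (zero M # e' # ds)) (near_fm \<phi>)))"
    unfolding critical_def prod.case using someI_ex[OF ex_critical_points] by meson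
  show "finite (critical (\<phi>, ds))" "critical (\<phi>, ds) \<subseteq> universe C" using c by blast+
  show "sat M (assign (zero M # e # ds)) (near_fm \<phi>) \<longleftrightarrow> sat M (assign (zero M # e' # ds)) (near_fm \<phi>)"
    if "e \<in> mu" "e' \<in> mu" "le e e'" "\<And>s. s \<in> critical (\<phi>, ds) \<Longrightarrow> \<not> (rel M r1 e s \<and> rel M r1 s e')"
    using c that by blast
qed

lemma H_iff: "e \<in> W \<Longrightarrow> e \<in> H \<longleftrightarrow> (\<forall>(\<phi>, ds)\<in>\<pi>. sat M (assign (zero M # e # ds)) (near_fm \<phi>))"
  unfolding H_def near_fm_def using G_sat_iff[of e 1] by simp

lemma holds_near_fm:
  assumes "x \<in> Q" "e \<in> W" "(\<phi>, ds) \<in> \<pi>"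
  shows "holds M ([x, add M x e] @ ds) \<phi> \<longleftrightarrow> sat M (assign (zero M # e # ds)) (near_fm \<phi>)"
  unfolding near_fm_def
proof (rule holds_line[OF assms(1) _ _ assms(2) \<pi>_over(2)[OF assms(3)]])
  have e: "e \<in> universe M" using assms W_sub by blast
  show "add M x e \<in> universe M" using e Q_M[OF assms(1)] by simp
  show "affine (add M x e) 1 x e" using ev_add[OF Q_M[OF assms(1)] e] by simp
qed

lemma add_in_Q: "\<lbrakk>x \<in> Q; e \<in> W\<rbrakk> \<Longrightarrow> add M x e \<in> Q"
  using line_in_Q[of x "add M x e" 1 e] ev_add[of x e] Q_M W_sub by auto

lemma H_W: "e \<in> H \<Longrightarrow> e \<in> W"
  using H_subset_mu mu_subset_W by blast

lemma add_H_in_F: "\<lbrakk>x \<in> Q; e \<in> H\<rbrakk> \<Longrightarrow> (x, add M x e) \<in> F"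
  using F_iff[OF _ add_in_Q] H_iff holds_near_fm H_W by fastforce

lemma in_H_if_F:
  assumes "(x, add M x e) \<in> F" "e \<in> W" shows "e \<in> H"
proof -
  have "e \<in> universe M" using assms(2) W_sub by blast
  then have "(1, e) \<in> G" using ev_add[OF Q_M[OF F_Q(1)[OF assms(1)]]] assms by (intro G_I[OF assms(1)]) auto
  then show ?thesis by (simp add: H_def)
qed

text \<open>All but finitely many of the disjoint intervals \<open>[k h, k h + h']\<close> avoid the critical points of any
  given formula of \<open>\<pi>\<close>. By compactness there are equivalent \<open>u\<close>, \<open>v\<close> in \<open>Q\<close> with \<open>u\<close> equivalent
  to \<open>v + h'\<close> as well, which puts \<open>h'\<close> into \<open>H\<close>.\<close>

lemma H_convex:
  assumes h: "h \<in> H" and h': "h' \<in> universe M" "\<forall>\<^sub>F i in U. 0 \<le> \<rho> h' i" "le h' h"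
  shows "h' \<in> H"
proof (cases "h' = h")
  case False
  have hM: "h \<in> universe M" and hmu: "h \<in> mu" using H_M[OF h] H_subset_mu h by auto
  have h'mu: "h' \<in> mu" by (rule mu_between[OF hmu h'(1)]) (use h'(2,3) in \<open>eventually_elim, simp\<close>)
  \<comment> \<open>Strictness is what makes the intervals disjoint.\<close>
  have lt: "lt h' h" using ev_neq[OF h'(1) hM False] h'(3) by eventually_elim simp
  obtain x where x: "x \<in> Q" using Q_nonempty by blast
  have xM: "x \<in> universe M" by (rule Q_M[OF x])
  define kh where "kh = (\<lambda>k. mult M k h)"
  have kh: "kh k \<in> H" "kh k \<in> mu" "kh k \<in> W" "kh k \<in> universe M" "\<forall>\<^sub>F i in U. \<rho> (kh k) i = real k * \<rho> h i" for k
    using H_mult[OF h, of k] H_subset_mu H_W H_M ev_mult[OF hM, of k] by (auto simp: kh_def)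
  have kh': "add M (kh k) h' \<in> mu" for k using mu_add[OF kh(2) h'mu] .
  \<comment> \<open>The type is realized somewhere in \<open>M\<close>, so membership of both
    components in \<open>Q\<close> has to be part of it.\<close>
  define inf where "inf = (\<lambda>j r. Conj (Neg (Rel r (Var j) (Var 2))) (Neg (Rel r (Var 2) (Var j))))"
  define \<Sigma> where "\<Sigma> = \<pi> \<union> {(shift_fm (2 + length ds) \<phi>, ds @ [h']) | \<phi> ds. (\<phi>, ds) \<in> \<pi>}
    \<union> {(inf j r, [c]) | j r c. j < 2 \<and> c \<in> universe C}"
  have not_inf: "holds M [u, v, c] (inf j r)" if "u \<in> Q" "v \<in> Q" "c \<in> universe C" "j < 2" for u v c j r
  proof -
    have "\<not> rel M r z c \<and> \<not> rel M r c z" if "z \<in> Q" for z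
      using infinity_conditions_iff[OF Q_M[OF that]] that \<open>c \<in> universe C\<close>
      by (force simp: realizes_def infinity_conditions_def holds_simps)
    then show ?thesis using that by (cases "j = 0") (auto simp: inf_def holds_simps less_2_cases_iff)
  qed
  have "\<exists>xs. length xs = 2 \<and> set xs \<subseteq> universe M \<and> realizes M xs \<Sigma>"
  \<comment> \<open>The pairs of \<open>x\<close> and \<open>x + k h\<close> lie in \<open>F\<close>
    and in \<open>Q\<close> outright, so only the shifted formulas can fail, and each of them fails
    for finitely many \<open>k\<close>.\<close>
  proof (rule saturated_realizes_limit[OF sat_M, where A = "insert h' (universe C)" and f = "\<lambda>k. [x, add M x (kh k)]"])
    show "insert h' (universe C) \<subseteq> universe M" using h' C_sub by blast
    show "|insert h' (universe C)| <o \<kappa>'"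
      by (rule card_of_insert_ordLess[OF Card_\<kappa>' C_less])
    show "\<Sigma> \<subseteq> formulas_over 2 (insert h' (universe C))"
    proof -
      have "(shift_fm (2 + length ds) \<phi>, ds @ [h']) \<in> formulas_over 2 (insert h' (universe C))" if "(\<phi>, ds) \<in> \<pi>" for \<phi> ds
        using formulas_overD[OF \<pi>_over(2)[OF that]] by (fastforce simp: shift_fm_def formulas_over_def)
      moreover have "\<pi> \<subseteq> formulas_over 2 (insert h' (universe C))"
        using \<pi>_over(2) by (fastforce simp: formulas_over_def)
      ultimately show ?thesis by (auto simp: \<Sigma>_def) (auto simp: inf_def formulas_over_def)
    qed
    show "length [x, add M x (kh k)] = 2 \<and> set [x, add M x (kh k)] \<subseteq> universe M" for k
      using xM kh by simp
    fix \<psi> es assume "(\<psi>, es) \<in> \<Sigma>"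
    then consider (1) "(\<psi>, es) \<in> \<pi>" | (2) \<phi> ds where "\<psi> = shift_fm (2 + length ds) \<phi>" "es = ds @ [h']" "(\<phi>, ds) \<in> \<pi>"
      | (3) j r c where "\<psi> = inf j r" "es = [c]" "j < 2" "c \<in> universe C"
      by (auto simp: \<Sigma>_def)
    then show "finite {k. \<not> holds M ([x, add M x (kh k)] @ es) \<psi>}"
    proof cases
      case 1
      have "holds M ([x, add M x (kh k)] @ es) \<psi>" for k
        using add_H_in_F[OF x kh(1)] F_iff[OF x add_in_Q[OF x kh(3)]] 1 by blast
      then show ?thesis by simp
    next
      case 3
      then show ?thesis using not_inf[OF x add_in_Q[OF x kh(3)]] by simp
    next
      case 2
      have fv: "free_vars \<phi> \<subseteq> {..<2 + length ds}" using formulas_overD(2)[OF \<pi>_over(2)[OF 2(3)]] .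
      have e: "add M (kh k) h' \<in> W" for k using kh' mu_subset_W by blast
      have assoc: "add M (add M x (kh k)) h' = add M x (add M (kh k) h')" for k
      proof (rule eq_if_ev_eq)
        show "\<forall>\<^sub>F i in U. \<rho> (add M (add M x (kh k)) h') i = \<rho> (add M x (add M (kh k) h')) i"
          using ev_add[OF add_closed[OF xM kh(4)] h'(1), of k] ev_add[OF xM kh(4), of k]
            ev_add[OF xM add_closed[OF kh(4) h'(1)], of k] ev_add[OF kh(4) h'(1), of k]
          by eventually_elim simp
      qed (use xM kh h' in auto)
      have sat_k: "sat M (assign (zero M # kh k # ds)) (near_fm \<phi>)" for k
        using H_iff[OF kh(3)] kh(1) 2(3) by blast
      have bad: "\<exists>s\<in>critical (\<phi>, ds). rel M r1 (kh k) s \<and> rel M r1 s (add M (kh k) h')"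
        if "\<not> holds M ([x, add M x (kh k)] @ es) \<psi>" for k
      proof (rule ccontr)
        assume "\<not> ?thesis"
        moreover have "le (kh k) (add M (kh k) h')"
          using ev_add[OF kh(4) h'(1), of k] h'(2) by eventually_elim simp
        ultimately have "sat M (assign (zero M # add M (kh k) h' # ds)) (near_fm \<phi>)"
          using critical(3)[OF 2(3) kh(2) kh', of k k] sat_k by blast
        then have "holds M ([x, add M x (add M (kh k) h')] @ ds) \<phi>"
          using holds_near_fm[OF x e 2(3)] by simp
        with that holds_shift_fm[OF fv, of M "add M x (kh k)" h' _ x] show False
          using xM kh h' by (simp add: 2 assoc)
      qed
      \<comment> \<open>For \<open>k < l\<close> in this set,
        \<open>(k + 1) h <= l h <= s <= k h + h'\<close>, against \<open>h' < h\<close>. So the set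
        has at most one element.\<close>
      have "finite {k. rel M r1 (kh k) s \<and> rel M r1 s (add M (kh k) h')}" if "s \<in> critical (\<phi>, ds)" for s
      proof (rule finite_if_no_two, safe)
        fix k l assume a: "rel M r1 s (add M (kh k) h')" "rel M r1 (kh l) s" "k < l"
        have sM: "s \<in> universe M" using that critical(2)[OF 2(3)] C_sub by blast
        have "\<forall>\<^sub>F i in U. False"
          using ev_rel[OF sM add_closed[OF kh(4) h'(1)] a(1)] ev_rel[OF kh(4) sM a(2)]
            ev_add[OF kh(4) h'(1), of k] kh(5)[of k] kh(5)[of l] lt h'(2)
        proof eventually_elim
          case (elim i)
          have "real l * \<rho> h i \<le> real k * \<rho> h i + \<rho> h' i" using elim by linarith
          moreover have "(real k + 1) * \<rho> h i \<le> real l * \<rho> h i"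
            using a(3) elim by (intro mult_right_mono) auto
          ultimately show False using elim by (simp add: algebra_simps)
        qed
        then show False by simp
      qed
      then have "finite (\<Union>s\<in>critical (\<phi>, ds). {k. rel M r1 (kh k) s \<and> rel M r1 s (add M (kh k) h')})"
        using critical(1)[OF 2(3)] by blast
      then show ?thesis by (rule finite_subset[rotated]) (use bad in blast)
    qed
  qed
  then obtain u v where uv: "u \<in> universe M" "v \<in> universe M" "realizes M [u, v] \<Sigma>"
    by (auto simp: numeral_2_eq_2 length_Suc_conv)
  have "realizes M [[u, v] ! j] (infinity_conditions C)" if "j < 2" for j
  proof -
    have "holds M ([[u, v] ! j] @ [c]) (Conj (Neg (Rel r (Var 0) (Var 1))) (Neg (Rel r (Var 1) (Var 0))))"
      if "c \<in> universe C" for r c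
    proof -
      have "(inf j r, [c]) \<in> \<Sigma>" using \<open>j < 2\<close> that by (auto simp: \<Sigma>_def)
      from realizesD[OF uv(3) this] show ?thesis
        using \<open>j < 2\<close> by (auto simp: inf_def holds_simps less_2_cases_iff)
    qed
    then show ?thesis by (auto simp: realizes_def infinity_conditions_def)
  qed
  from this[of 0] this[of 1] have Q: "u \<in> Q" "v \<in> Q"
    using infinity_conditions_iff uv by auto
  have "(u, v) \<in> F"
    using Q uv(3) realizes_mono[of M "[u, v]" \<Sigma> \<pi>] by (auto simp: F \<Sigma>_def)
  moreover have vh: "add M v h' \<in> Q" using add_in_Q[OF Q(2)] h'mu mu_subset_W by blast
  have "(u, add M v h') \<in> F"
  proof -
    have "holds M ([u, add M v h'] @ ds) \<phi>" if "(\<phi>, ds) \<in> \<pi>" for \<phi> ds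
    proof -
      have "(shift_fm (2 + length ds) \<phi>, ds @ [h']) \<in> \<Sigma>" using that by (auto simp: \<Sigma>_def)
      from realizesD[OF uv(3) this] show ?thesis
        using holds_shift_fm[OF formulas_overD(2)[OF \<pi>_over(2)[OF that]] Q_M[OF vh] refl] by simp
    qed
    then show ?thesis using F_iff[OF Q(1) vh] by auto
  qed
  ultimately have "(v, add M v h') \<in> F" using F_sym F_trans by blast
  then show ?thesis using in_H_if_F h'mu mu_subset_W by blast
qed (use h in simp)

end

section \<open>The given notions of infinitesimal in terms of the order on \<open>mu\<close>\<close>

context saturated_pair
begin

lemma lt_trans_le: "\<lbrakk>lt x y; le y z\<rbrakk> \<Longrightarrow> lt x z"
  by (elim eventually_rev_mp) (auto intro!: always_eventually)

lemma zero_mu: "zero M \<in> mu"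
  unfolding mu_def using ev_zero by (auto elim: eventually_mono)

lemma mu_neg: "e \<in> mu \<Longrightarrow> neg M e \<in> mu"
proof -
  assume e: "e \<in> mu"
  have "\<forall>\<^sub>F i in U. \<bar>\<rho> (neg M e) i\<bar> \<le> \<bar>\<rho> e i\<bar>"
    using ev_neg[OF muD(2)[OF e]] by eventually_elim simp
  with mu_between[OF e] muD(2)[OF e] show ?thesis by simp
qed

lemma mu_mult: "e \<in> mu \<Longrightarrow> mult M n e \<in> mu"
  by (induction n) (auto simp: zero_mu mu_add)

lemma neg_neg: "x \<in> universe M \<Longrightarrow> neg M (neg M x) = x"
  using ev_neg[of x] ev_neg[of "neg M x"]
  by (intro eq_if_ev_eq) (auto elim: eventually_elim2)

lemma mu_abs:
  assumes "e \<in> mu"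
  obtains f where "f = e \<or> f = neg M e" "f \<in> mu" "\<forall>\<^sub>F i in U. \<rho> f i = \<bar>\<rho> e i\<bar>"
proof (cases "le (zero M) e")
  case True
  with ev_zero have "\<forall>\<^sub>F i in U. \<rho> e i = \<bar>\<rho> e i\<bar>" by eventually_elim simp
  with assms that show ?thesis by blast
next
  case False
  then have "lt e (zero M)" using le_or_lt[OF zero_mu assms] by blast
  with ev_zero ev_neg[OF muD(2)[OF assms]] have "\<forall>\<^sub>F i in U. \<rho> (neg M e) i = \<bar>\<rho> e i\<bar>" by eventually_elim simp
  with mu_neg[OF assms] that show ?thesis by blast
qed

lemma infinitesimals_eq_mu: "infinitesimals M = mu"
proof (intro equalityI subsetI)
  fix e assume e: "e \<in> infinitesimals M"
  then have eM: "e \<in> universe M" by (simp add: infinitesimals_def)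
  show "e \<in> mu"
    unfolding mu_def
  proof (intro CollectI conjI allI impI eM)
    fix q :: rat assume "0 < q"
    then obtain r where r: "rad r = of_rat q" using obtain_rad by blast
    from e have "rel M r e (zero M) \<or> rel M r (zero M) e" by (auto simp: infinitesimals_def S_def)
    then show "\<forall>\<^sub>F i in U. \<bar>\<rho> e i\<bar> \<le> of_rat q"
    proof
      assume "rel M r e (zero M)"
      from ev_rel[OF eM zero_closed this] ev_zero show ?thesis by eventually_elim (use r in auto)
    next
      assume "rel M r (zero M) e"
      from ev_rel[OF zero_closed eM this] ev_zero show ?thesis by eventually_elim (use r in auto)
    qed
  qed
next
  fix e assume e: "e \<in> mu"
  have eM: "e \<in> universe M" by (rule muD(2)[OF e])
  have "S M r e (zero M)" for r
  proof -
    have "0 < Rep_posrat r" using Rep_posrat[of r] by simp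
    from muD(1)[OF e this] have small: "\<forall>\<^sub>F i in U. \<bar>\<rho> e i\<bar> \<le> rad r" by (simp add: rad_def)
    from le_or_lt[OF zero_mu e] show ?thesis
    proof
      assume "le (zero M) e"
      with small ev_zero have "\<forall>\<^sub>F i in U. 0 \<le> \<rho> e i - \<rho> (zero M) i \<and> \<rho> e i - \<rho> (zero M) i \<le> rad r"
        by eventually_elim auto
      then show ?thesis unfolding S_def using rel_iff_ev[OF zero_closed eM] by blast
    next
      assume "lt e (zero M)"
      with small ev_zero have "\<forall>\<^sub>F i in U. 0 \<le> \<rho> (zero M) i - \<rho> e i \<and> \<rho> (zero M) i - \<rho> e i \<le> rad r"
        by eventually_elim auto
      then show ?thesis unfolding S_def using rel_iff_ev[OF eM zero_closed] by blast
    qed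
  qed
  with eM show "e \<in> infinitesimals M" by (simp add: infinitesimals_def)
qed

lemma zero_C_eq: "zero C = zero M"
  using elementaryD(2-4)[OF el] C_one subspace_neg[OF subspace_C C_one] by (simp add: zero_def)

lemma positive_infinitesimals_iff:
  "a \<in> positive_infinitesimals C \<longleftrightarrow> a \<in> universe C \<and> a \<in> mu \<and> lt (zero M) a"
proof
  assume a: "a \<in> positive_infinitesimals C"
  then have aC: "a \<in> universe C" and aM: "a \<in> universe M" and ne: "a \<noteq> zero M"
    using C_sub zero_C_eq by (auto simp: positive_infinitesimals_def)
  have rel: "rel M r (zero M) a" for r
    using a elementaryD(5)[OF el C_zero aC] zero_C_eq by (simp add: positive_infinitesimals_def)
  then have "a \<in> infinitesimals M" using aM by (auto simp: infinitesimals_def S_def)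
  moreover have "lt (zero M) a"
    using ev_rel[OF zero_closed aM rel[of r1]] ev_neq[OF zero_closed aM ne[symmetric]] by eventually_elim simp
  ultimately show "a \<in> universe C \<and> a \<in> mu \<and> lt (zero M) a" using aC infinitesimals_eq_mu by simp
next
  assume a: "a \<in> universe C \<and> a \<in> mu \<and> lt (zero M) a"
  then have aM: "a \<in> universe M" using C_sub by blast
  have "\<not> lt (zero M) (zero M)" by simp
  with a have ne: "a \<noteq> zero M" by blast
  have "rel M r (zero M) a" for r
  proof -
    have "0 < Rep_posrat r" using Rep_posrat[of r] by simp
    from muD(1)[OF _ this, of a] a have small: "\<forall>\<^sub>F i in U. \<bar>\<rho> a i\<bar> \<le> rad r" by (simp add: rad_def)
    have "\<forall>\<^sub>F i in U. 0 \<le> \<rho> a i - \<rho> (zero M) i \<and> \<rho> a i - \<rho> (zero M) i \<le> rad r"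
      using small ev_zero conjunct2[OF conjunct2[OF a]] by eventually_elim auto
    then show ?thesis using rel_iff_ev[OF zero_closed aM] by blast
  qed
  with a ne show "a \<in> positive_infinitesimals C"
    using elementaryD(5)[OF el C_zero] zero_C_eq by (auto simp: positive_infinitesimals_def)
qed

text \<open>An element of a nonempty \<open>A\<close> bounds \<open>e\<close>, which puts
  \<open>e\<close> into \<open>mu\<close>. There \<open>R_1\<close> is the order, and the two
  conditions on \<open>n e\<close> and \<open>- n e\<close> say that \<open>n |e|\<close> is at most
  \<open>a\<close>.\<close>

lemma infinitesimals_below_eq:
  assumes A: "A \<noteq> {}" "A \<subseteq> positive_infinitesimals C"
  shows "infinitesimals_below M A = {e \<in> mu. \<forall>a\<in>A. \<forall>n\<ge>1. \<forall>\<^sub>F i in U. real n * \<bar>\<rho> e i\<bar> \<le> \<rho> a i}"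
proof (intro equalityI subsetI)
  have Amu: "a \<in> mu" "a \<in> universe M" if "a \<in> A" for a
    using A(2) that positive_infinitesimals_iff muD(2) by auto
  {
    fix e assume e: "e \<in> infinitesimals_below M A"
    then have eM: "e \<in> universe M" by (simp add: infinitesimals_below_def)
    have bd: "\<forall>\<^sub>F i in U. real n * \<bar>\<rho> e i\<bar> \<le> \<rho> a i" if a: "a \<in> A" and n: "1 \<le> n" for a n
    proof -
      have rel: "rel M r1 (mult M n e) a" "rel M r1 (neg M (mult M n e)) a"
        using e a n by (auto simp: infinitesimals_below_def r1_def)
      have me: "mult M n e \<in> universe M" using eM by simp
      show ?thesis
        using ev_rel[OF me Amu(2)[OF a] rel(1)] ev_rel[OF neg_closed[OF me] Amu(2)[OF a] rel(2)]
          ev_mult[OF eM, of n] ev_neg[OF me]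
        by eventually_elim (auto simp: abs_if)
    qed
    obtain a where a: "a \<in> A" using A(1) by blast
    have "\<forall>\<^sub>F i in U. \<bar>\<rho> e i\<bar> \<le> \<bar>\<rho> a i\<bar>" using bd[OF a, of 1] by (auto elim: eventually_mono)
    then have "e \<in> mu" using mu_between[OF Amu(1)[OF a] eM] by blast
    with bd show "e \<in> {e \<in> mu. \<forall>a\<in>A. \<forall>n\<ge>1. \<forall>\<^sub>F i in U. real n * \<bar>\<rho> e i\<bar> \<le> \<rho> a i}" by blast
  next
    fix e assume e: "e \<in> {e \<in> mu. \<forall>a\<in>A. \<forall>n\<ge>1. \<forall>\<^sub>F i in U. real n * \<bar>\<rho> e i\<bar> \<le> \<rho> a i}"
    then have emu: "e \<in> mu" and eM: "e \<in> universe M" using muD(2) by auto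
    have "rel M r1 (mult M n e) a \<and> rel M r1 (neg M (mult M n e)) a" if a: "a \<in> A" and n: "1 \<le> n" for a n
    proof -
      have bd: "\<forall>\<^sub>F i in U. real n * \<bar>\<rho> e i\<bar> \<le> \<rho> a i" using e a n by blast
      have "real n * \<rho> e i \<le> real n * \<bar>\<rho> e i\<bar>" "- (real n * \<rho> e i) \<le> real n * \<bar>\<rho> e i\<bar>" for i
        using mult_left_mono[of "\<rho> e i" "\<bar>\<rho> e i\<bar>" "real n"] mult_left_mono[of "- \<rho> e i" "\<bar>\<rho> e i\<bar>" "real n"]
        by auto
      note le = this
      have "le (mult M n e) a"
        using bd ev_mult[OF eM, of n] by eventually_elim (metis le(1) order_trans)
      moreover have "le (neg M (mult M n e)) a"
        using bd ev_mult[OF eM, of n] ev_neg[OF mult_closed[OF eM, of n]]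
        by eventually_elim (metis le(2) order_trans)
      ultimately show ?thesis
        using rel_r1_iff_le Amu(1)[OF a] mu_mult[OF emu, of n] mu_neg by blast
    qed
    with eM show "e \<in> infinitesimals_below M A" by (simp add: infinitesimals_below_def r1_def)
  }
qed

end

section \<open>Classification\<close>

context proper_definable_equiv
begin

text \<open>The parameter set \<open>A\<close> with \<open>H = infinitesimals_below M A\<close>, unless \<open>H\<close> is trivial or everything.
  Taking only critical points of \<open>\<pi>\<close> keeps it small.\<close>

definition gaps :: "'a set" where
  "gaps = {s \<in> positive_infinitesimals C. s \<notin> H \<and> (\<exists>p\<in>\<pi>. s \<in> critical p)}"

text \<open>Every formula of \<open>\<pi>\<close> contributes a finite set, and there are at most as
  many formulas as elements of an infinite set below \<open>\<kappa>\<close>.\<close>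

lemma card_gaps: "|gaps| <o \<kappa>"
proof -
  obtain K :: "('a + nat) set" where K: "infinite K" "|K| <o \<kappa>" "|formulas_over 2 D| \<le>o |K|"
    using card_of_formulas_over[OF Card_\<kappa> T_less D(2)] by blast
  have "\<pi> \<subseteq> formulas_over 2 D" using \<pi> by (simp add: partial_type_def)
  then have "|\<pi>| \<le>o |K|" using card_of_mono1 K(3) ordLeq_transitive by blast
  moreover have "\<forall>p\<in>\<pi>. |critical p| \<le>o |K|"
    using critical(1) K(1) by (auto intro!: countable_card_ordLeq countable_finite)
  ultimately have "|\<Union>p\<in>\<pi>. critical p| \<le>o |K|" by (rule card_of_UNION_ordLeq_infinite[OF K(1)])
  moreover have "gaps \<subseteq> (\<Union>p\<in>\<pi>. critical p)" by (auto simp: gaps_def)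
  ultimately have "|gaps| \<le>o |K|" using card_of_mono1 ordLeq_transitive by blast
  then show ?thesis using K(2) ordLeq_ordLess_trans by blast
qed

text \<open>Adding a nonnegative \<open>s\<close> of \<open>H\<close> to a positive \<open>m\<close>
  of \<open>H\<close> gives an element of \<open>H\<close> strictly above both. With
  \<open>X\<close> a set of critical points, \<open>m\<close> leaves behind all of them that belong
  to \<open>H\<close>.\<close>

lemma H_upper_bound:
  assumes h: "h \<in> H" "lt (zero M) h" and "finite X"
  shows "\<exists>m\<in>H. lt (zero M) m \<and> (\<forall>s\<in>X \<inter> H. lt s m)"
  using assms(3)
proof (induction X)
  case empty
  then show ?case using h by blast
next
  case (insert s X)
  then obtain m where m: "m \<in> H" "lt (zero M) m" "\<forall>s\<in>X \<inter> H. lt s m" by blast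
  show ?case
  proof (cases "s \<in> H \<and> le (zero M) s")
    case True
    then have s: "s \<in> H" "le (zero M) s" by auto
    have add: "\<forall>\<^sub>F i in U. \<rho> (add M m s) i = \<rho> m i + \<rho> s i" using ev_add H_M m(1) s(1) by blast
    have "lt (zero M) (add M m s)" using add m(2) s(2) ev_zero by eventually_elim simp
    moreover have "lt s (add M m s)" using add m(2) ev_zero by eventually_elim simp
    moreover have "lt t (add M m s)" if "t \<in> X \<inter> H" for t
      using add bspec[OF m(3) that] s(2) ev_zero by eventually_elim simp
    ultimately show ?thesis using H_add[OF m(1) s(1)] by blast
  next
    case False
    have "lt s m" if "s \<in> H"
    proof -
      have "lt s (zero M)" using le_or_lt[OF zero_mu, of s] False that H_subset_mu by blast
      with m(2) show ?thesis by eventually_elim simp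
    qed
    with m show ?thesis by blast
  qed
qed

text \<open>Some formula of \<open>\<pi>\<close> fails at \<open>e\<close> but holds at the
  \<open>m\<close> supplied by \<open>H_upper_bound\<close>. Convexity gives \<open>m <= e\<close>,
  so a critical point \<open>s\<close> lies between them. It is not in \<open>H\<close>, since
  otherwise \<open>s < m\<close> by the choice of \<open>m\<close>.\<close>

lemma ex_gap_below:
  assumes H: "H \<noteq> {zero M}" and e: "e \<in> mu" "lt (zero M) e" "e \<notin> H"
  shows "\<exists>s\<in>gaps. le s e"
proof -
  obtain h0 where h0: "h0 \<in> H" "h0 \<noteq> zero M" using H zero_H by blast
  have h0mu: "h0 \<in> mu" using h0 H_subset_mu by blast
  obtain h where h: "h = h0 \<or> h = neg M h0" "h \<in> mu" "\<forall>\<^sub>F i in U. \<rho> h i = \<bar>\<rho> h0 i\<bar>"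
    using mu_abs[OF h0mu] by blast
  have hH: "h \<in> H" using h(1) h0(1) H_neg by blast
  have hpos: "lt (zero M) h"
    using ev_neq[OF muD(2)[OF h0mu] zero_closed h0(2)] h(3) ev_zero by eventually_elim simp
  obtain x where x: "x \<in> Q" using Q_nonempty by blast
  obtain \<phi> ds where p: "(\<phi>, ds) \<in> \<pi>" and unsat: "\<not> sat M (assign (zero M # e # ds)) (near_fm \<phi>)"
    using H_iff e mu_subset_W by blast
  obtain m where m: "m \<in> H" "lt (zero M) m" "\<forall>s\<in>critical (\<phi>, ds) \<inter> H. lt s m"
    using H_upper_bound[OF hH hpos critical(1)[OF p]] by blast
  have mmu: "m \<in> mu" using m(1) H_subset_mu by blast
  have "\<not> lt e m"
  proof
    assume "lt e m"
    then have "le e m" by (auto elim: eventually_mono)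
    moreover have "\<forall>\<^sub>F i in U. 0 \<le> \<rho> e i" using e(2) ev_zero by eventually_elim simp
    ultimately show False using H_convex[OF m(1) muD(2)[OF e(1)]] e(3) by blast
  qed
  then have le: "le m e" using le_or_lt[OF mmu e(1)] by blast
  have "sat M (assign (zero M # m # ds)) (near_fm \<phi>)"
    using H_iff m(1) p mmu mu_subset_W by blast
  with unsat obtain s where s: "s \<in> critical (\<phi>, ds)" "rel M r1 m s" "rel M r1 s e"
    using critical(3)[OF p mmu e(1) le] by blast
  have sC: "s \<in> universe C" and sM: "s \<in> universe M" using s(1) critical(2)[OF p] C_sub by auto
  have ms: "le m s" using ev_rel[OF muD(2)[OF mmu] sM s(2)] by eventually_elim simp
  have se: "le s e" using ev_rel[OF sM muD(2)[OF e(1)] s(3)] by eventually_elim simp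
  have spos: "lt (zero M) s" using lt_trans_le[OF m(2) ms] .
  have "\<forall>\<^sub>F i in U. \<bar>\<rho> s i\<bar> \<le> \<bar>\<rho> e i\<bar>" using spos se ev_zero by eventually_elim simp
  then have smu: "s \<in> mu" using mu_between[OF e(1) sM] by blast
  have "s \<notin> H" using m(3) s(1) not_le_lt[OF ms] by blast
  then have "s \<in> gaps" using sC smu spos s(1) p by (auto simp: gaps_def positive_infinitesimals_iff)
  with se show ?thesis by blast
qed

lemma ex_gap_below_abs:
  assumes H: "H \<noteq> {zero M}" and e: "e \<in> mu" "e \<notin> H"
  shows "\<exists>s\<in>gaps. \<forall>\<^sub>F i in U. \<rho> s i \<le> \<bar>\<rho> e i\<bar>"
proof -
  obtain f where f: "f = e \<or> f = neg M e" "f \<in> mu" "\<forall>\<^sub>F i in U. \<rho> f i = \<bar>\<rho> e i\<bar>"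
    using mu_abs[OF e(1)] by blast
  have "f \<notin> H" using f(1) e(2) H_neg[of f] neg_neg[OF muD(2)[OF e(1)]] by auto
  moreover have "e \<noteq> zero M" using e(2) zero_H by blast
  from ev_neq[OF muD(2)[OF e(1)] zero_closed this] have "lt (zero M) f"
    using f(3) ev_zero by eventually_elim simp
  ultimately obtain s where "s \<in> gaps" "le s f" using ex_gap_below[OF H f(2)] by blast
  moreover from this(2) f(3) have "\<forall>\<^sub>F i in U. \<rho> s i \<le> \<bar>\<rho> e i\<bar>" by eventually_elim simp
  ultimately show ?thesis by blast
qed

lemma gap_above_H:
  assumes s: "s \<in> gaps" and e: "e \<in> H"
  shows "\<forall>\<^sub>F i in U. \<bar>\<rho> e i\<bar> \<le> \<rho> s i"
proof -
  have emu: "e \<in> mu" using e H_subset_mu by blast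
  have s': "s \<in> mu" "lt (zero M) s" "s \<notin> H" using s by (auto simp: gaps_def positive_infinitesimals_iff)
  obtain f where f: "f = e \<or> f = neg M e" "f \<in> mu" "\<forall>\<^sub>F i in U. \<rho> f i = \<bar>\<rho> e i\<bar>"
    using mu_abs[OF emu] by blast
  have fH: "f \<in> H" using f(1) e H_neg by blast
  have "\<not> lt s f"
  proof
    assume "lt s f"
    then have "le s f" by (auto elim: eventually_mono)
    moreover have "\<forall>\<^sub>F i in U. 0 \<le> \<rho> s i" using s'(2) ev_zero by eventually_elim simp
    ultimately show False using H_convex[OF fH muD(2)[OF s'(1)]] s'(3) by blast
  qed
  then have "le f s" using le_or_lt[OF f(2) s'(1)] by blast
  with f(3) show ?thesis by eventually_elim simp
qed

text \<open>Without gaps no infinitesimal escapes a nontrivial \<open>H\<close>. With gaps,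
  \<open>H\<close> lies below each of them, and being closed under multiples also below their
  integer fractions.\<close>

lemma H_cases:
  "H = {zero M} \<or> H = infinitesimals M \<or>
    (\<exists>A. A \<noteq> {} \<and> A \<subseteq> positive_infinitesimals C \<and> |A| <o \<kappa> \<and> H = infinitesimals_below M A)"
proof (cases "H = {zero M} \<or> gaps = {}")
  case True
  have "H = mu" if "H \<noteq> {zero M}" "gaps = {}"
    using ex_gap_below_abs[OF that(1)] that(2) H_subset_mu by blast
  with True show ?thesis using infinitesimals_eq_mu by blast
next
  case False
  then have H: "H \<noteq> {zero M}" and ne: "gaps \<noteq> {}" by auto
  have sub: "gaps \<subseteq> positive_infinitesimals C" by (auto simp: gaps_def)
  have "e \<in> infinitesimals_below M gaps" if e: "e \<in> H" for e
  proof -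
    have "\<forall>\<^sub>F i in U. real n * \<bar>\<rho> e i\<bar> \<le> \<rho> a i" if "a \<in> gaps" for a n
      using gap_above_H[OF that H_mult[OF e, of n]] ev_mult[OF H_M[OF e], of n]
      by eventually_elim (simp add: abs_mult)
    with e H_subset_mu show ?thesis unfolding infinitesimals_below_eq[OF ne sub] by blast
  qed
  moreover have "e \<in> H" if e: "e \<in> infinitesimals_below M gaps" for e
  proof (rule ccontr)
    assume eH: "e \<notin> H"
    have e': "e \<in> mu" "\<And>a n. \<lbrakk>a \<in> gaps; 1 \<le> n\<rbrakk> \<Longrightarrow> \<forall>\<^sub>F i in U. real n * \<bar>\<rho> e i\<bar> \<le> \<rho> a i"
      using e unfolding infinitesimals_below_eq[OF ne sub] by auto
    obtain s where s: "s \<in> gaps" "\<forall>\<^sub>F i in U. \<rho> s i \<le> \<bar>\<rho> e i\<bar>"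
      using ex_gap_below_abs[OF H e'(1) eH] by blast
    have "lt (zero M) s" using s(1) sub positive_infinitesimals_iff by blast
    \<comment> \<open>The multiple 2 suffices: \<open>2 |e| <= s <= |e|\<close> contradicts
      \<open>0 < s\<close>.\<close>
    moreover have "\<forall>\<^sub>F i in U. real 2 * \<bar>\<rho> e i\<bar> \<le> \<rho> s i" by (rule e'(2)[OF s(1)]) simp
    ultimately have "\<forall>\<^sub>F i in U. False" using s(2) ev_zero by eventually_elim simp
    then show False by simp
  qed
  ultimately have "H = infinitesimals_below M gaps" by blast
  with ne sub card_gaps show ?thesis by blast
qed

text \<open>Two reflections in \<open>G\<close> differ by a translation in \<open>H\<close>. Once
  one of them has its centre \<open>c\<close> in \<open>C\<close>, the centres of all others lie in
  the coset of \<open>c\<close>.\<close>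

lemma F_cases:
  "F = {(x, y) \<in> Q \<times> Q. diff M x y \<in> H} \<or>
    (\<exists>c\<in>universe C. F = {(x, y) \<in> Q \<times> Q. diff M x y \<in> H \<or> diff M (add M x y) c \<in> H})"
proof -
  have slope1: "diff M x y \<in> H" if "(1, e) \<in> G" "x \<in> Q" "y \<in> Q" "affine y 1 x e" for x y e
  proof -
    have "e \<in> H" using that(1) by (simp add: H_def)
    have M: "x \<in> universe M" "y \<in> universe M" "e \<in> universe M" using that Q_M G_M by auto
    have "\<forall>\<^sub>F i in U. \<rho> (diff M x y) i = \<rho> (neg M e) i"
      using ev_diff[OF M(1,2)] ev_neg[OF M(3)] that(4) by eventually_elim simp
    then have "diff M x y = neg M e" using M by (intro eq_if_ev_eq) auto
    with H_neg[OF \<open>e \<in> H\<close>] show ?thesis by simp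
  qed
  show ?thesis
  proof (cases "\<exists>c0. (- 1, c0) \<in> G")
    case False
    have "diff M x y \<in> H" if xy: "(x, y) \<in> F" for x y
    proof -
      obtain a e where ae: "(a, e) \<in> G" "affine y a x e"
        using F_imp_G[OF xy] by blast
      have "a = 1" using G_slope[OF ae(1)] ae(1) False by auto
      then show ?thesis using slope1 ae F_Q[OF xy] by blast
    qed
    then have "F = {(x, y) \<in> Q \<times> Q. diff M x y \<in> H}" using F_if_diff_in_H unfolding F by blast
    then show ?thesis ..
  next
    case True
    then obtain c0 where c0: "(- 1, c0) \<in> G" by blast
    \<comment> \<open>Membership in \<open>G\<close> is decided by the type over \<open>D\<close>,
      so \<open>c0\<close> may be replaced by an element of \<open>C\<close> of the same
      type.\<close>
    obtain c where c: "c \<in> universe C" "\<And>\<chi> ds. set ds \<subseteq> D \<Longrightarrow>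
        sat M (assign (zero M # c0 # ds)) \<chi> \<longleftrightarrow> sat M (assign (zero M # c # ds)) \<chi>"
      using ex_in_C_same_type[OF G_M[OF c0] D] by blast
    have cM: "c \<in> universe M" and cW: "c \<in> W" using c(1) C_sub C_sub_W by auto
    have cG: "(- 1, c) \<in> G"
    proof -
      have "\<forall>(\<phi>, ds)\<in>\<pi>. sat M (assign (zero M # c0 # ds)) (drop_unbounded (line (- 1)) (qe \<phi>))"
        using G_sat_iff[OF G_W[OF c0], of "- 1"] c0 by simp
      then have "\<forall>(\<phi>, ds)\<in>\<pi>. sat M (assign (zero M # c # ds)) (drop_unbounded (line (- 1)) (qe \<phi>))"
        using c(2)[OF formulas_overD(1)[OF \<pi>_over(1)]] by auto
      then show ?thesis using G_sat_iff[OF cW, of "- 1"] by simp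
    qed
    have "diff M x y \<in> H \<or> diff M (add M x y) c \<in> H" if xy: "(x, y) \<in> F" for x y
    proof -
      obtain a e where ae: "(a, e) \<in> G" "affine y a x e"
        using F_imp_G[OF xy] by blast
      have M: "x \<in> universe M" "y \<in> universe M" using F_Q[OF xy] Q_M by auto
      from G_slope[OF ae(1)] show ?thesis
      proof
        assume "a = 1"
        then show ?thesis using slope1 ae F_Q[OF xy] by blast
      next
        assume a: "a = - 1"
        \<comment> \<open>Reflecting with centre \<open>c\<close> and then with centre
          \<open>e = x + y\<close> translates by \<open>e - c\<close>.\<close>
        have "affine (diff M (add M x y) c) (- 1) c e"
          using ae(2) ev_diff[OF add_closed[OF M] cM] ev_add[OF M] by eventually_elim (simp add: a of_rat_minus)
        from G_comp[OF cG ae(1)[unfolded a] _ this] have "(1, diff M (add M x y) c) \<in> G" using M cM by simp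
        then show ?thesis by (simp add: H_def)
      qed
    qed
    moreover have "(x, y) \<in> F" if xy: "x \<in> Q" "y \<in> Q" "diff M (add M x y) c \<in> H" for x y
    proof -
      have M: "x \<in> universe M" "y \<in> universe M" using xy Q_M by auto
      have h: "(1, diff M (add M x y) c) \<in> G" using xy(3) by (simp add: H_def)
      have "affine (add M x y) 1 c (diff M (add M x y) c)"
        using ev_diff[OF add_closed[OF M] cM] by eventually_elim simp
      from G_comp[OF cG h _ this] M have G: "(- 1, add M x y) \<in> G" by simp
      have "affine y (- 1) x (add M x y)"
        using ev_add[OF M] by eventually_elim (simp add: of_rat_minus)
      from G_iff(2)[OF xy(1) M(2) this G_W[OF G]] G show ?thesis by simp
    qed
    ultimately have "F = {(x, y) \<in> Q \<times> Q. diff M x y \<in> H \<or> diff M (add M x y) c \<in> H}"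
      using F_if_diff_in_H unfolding F by blast
    with c(1) show ?thesis by blast
  qed
qed

end

section \<open>The listed relations are type-definable equivalence relations\<close>

context saturated_pair
begin

text \<open>Linear identities transfer from the reals, which replaces calculating from the laws of
  an abelian group.\<close>

lemma tm_identity:
  assumes "\<And>w. rval w s = rval w t" "set xs \<subseteq> universe M"
  shows "tm_val M (assign xs) s = tm_val M (assign xs) t"
proof -
  have "sat M (assign xs) (Eq s t)"
    by (rule transfer[OF model]) (use assms in \<open>auto intro: assign_in\<close>)
  then show ?thesis by simp
qed

definition subgroup :: "'a set \<Rightarrow> bool" where
  "subgroup K \<longleftrightarrow> K \<subseteq> universe M \<and> zero M \<in> K \<and> (\<forall>x\<in>K. neg M x \<in> K) \<and> (\<forall>x\<in>K. \<forall>y\<in>K. add M x y \<in> K)"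

definition cosets :: "'a set \<Rightarrow> ('a \<times> 'a) set" where
  "cosets K = {(x, y) \<in> Q \<times> Q. diff M x y \<in> K}"

definition reflected_cosets :: "'a set \<Rightarrow> 'a \<Rightarrow> ('a \<times> 'a) set" where
  "reflected_cosets K c = {(x, y) \<in> Q \<times> Q. diff M x y \<in> K \<or> diff M (add M x y) c \<in> K}"

context
  fixes x y z c
  assumes M: "x \<in> universe M" "y \<in> universe M" "z \<in> universe M" "c \<in> universe M"
begin

lemma diff_identities:
  "diff M x x = zero M"
  "diff M y x = neg M (diff M x y)"
  "diff M x z = add M (diff M x y) (diff M y z)"
  "add M y x = add M x y"
  "diff M (add M x z) c = add M (diff M x y) (diff M (add M y z) c)"
  "diff M (add M x z) c = add M (diff M (add M x y) c) (neg M (diff M y z))"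
  "diff M x z = add M (diff M (add M x y) c) (neg M (diff M (add M y z) c))"
proof -
  have id: "tm_val M (assign [x, y, z, c]) s = tm_val M (assign [x, y, z, c]) t" if "\<And>w. rval w s = rval w t" for s t
    by (rule tm_identity[OF that]) (use M in auto)
  note simps = assign_def nth_Cons'
  show "diff M x x = zero M"
    using id[of "Diff (Var 0) (Var 0)" Zero] by (simp add: simps)
  show "diff M y x = neg M (diff M x y)"
    using id[of "Diff (Var 1) (Var 0)" "Minus (Diff (Var 0) (Var 1))"] by (simp add: simps)
  show "diff M x z = add M (diff M x y) (diff M y z)"
    using id[of "Diff (Var 0) (Var 2)" "Plus (Diff (Var 0) (Var 1)) (Diff (Var 1) (Var 2))"] by (simp add: simps)
  show "add M y x = add M x y"
    using id[of "Plus (Var 1) (Var 0)" "Plus (Var 0) (Var 1)"] by (simp add: simps)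
  show "diff M (add M x z) c = add M (diff M x y) (diff M (add M y z) c)"
    using id[of "Diff (Plus (Var 0) (Var 2)) (Var 3)" "Plus (Diff (Var 0) (Var 1)) (Diff (Plus (Var 1) (Var 2)) (Var 3))"]
    by (simp add: simps)
  show "diff M (add M x z) c = add M (diff M (add M x y) c) (neg M (diff M y z))"
    using id[of "Diff (Plus (Var 0) (Var 2)) (Var 3)" "Plus (Diff (Plus (Var 0) (Var 1)) (Var 3)) (Minus (Diff (Var 1) (Var 2)))"]
    by (simp add: simps)
  show "diff M x z = add M (diff M (add M x y) c) (neg M (diff M (add M y z) c))"
    using id[of "Diff (Var 0) (Var 2)" "Plus (Diff (Plus (Var 0) (Var 1)) (Var 3)) (Minus (Diff (Plus (Var 1) (Var 2)) (Var 3)))"]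
    by (simp add: simps)
qed

end

lemma diff_self: "x \<in> universe M \<Longrightarrow> diff M x x = zero M"
  using diff_identities(1) by blast

lemma equiv_cosets:
  assumes "subgroup K" shows "equiv Q (cosets K)"
proof (rule equivI)
  show "cosets K \<subseteq> Q \<times> Q" by (auto simp: cosets_def)
  show "refl_on Q (cosets K)"
    using assms diff_self Q_M by (auto simp: refl_on_def cosets_def subgroup_def)
  show "sym (cosets K)"
  proof (rule symI)
    fix x y assume xy: "(x, y) \<in> cosets K"
    then have "x \<in> universe M" "y \<in> universe M" using Q_M by (auto simp: cosets_def)
    from diff_identities(2)[OF this one_closed one_closed] xy assms
    show "(y, x) \<in> cosets K" by (auto simp: cosets_def subgroup_def)
  qed
  show "trans (cosets K)"
  proof (rule transI)
    fix x y z assume xyz: "(x, y) \<in> cosets K" "(y, z) \<in> cosets K"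
    then have "x \<in> universe M" "y \<in> universe M" "z \<in> universe M" using Q_M by (auto simp: cosets_def)
    from diff_identities(3)[OF this one_closed] xyz assms
    show "(x, z) \<in> cosets K" by (auto simp: cosets_def subgroup_def)
  qed
qed

text \<open>Transitivity is the composition table: two translations or two reflections compose to a
  translation, one of each to a reflection.\<close>

lemma equiv_reflected_cosets:
  assumes K: "subgroup K" and c: "c \<in> universe M" shows "equiv Q (reflected_cosets K c)"
proof (rule equivI)
  show "reflected_cosets K c \<subseteq> Q \<times> Q" by (auto simp: reflected_cosets_def)
  show "refl_on Q (reflected_cosets K c)"
    using K diff_self Q_M by (auto simp: refl_on_def reflected_cosets_def subgroup_def)
  show "sym (reflected_cosets K c)"
  proof (rule symI)
    fix x y assume xy: "(x, y) \<in> reflected_cosets K c"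
    then have "x \<in> universe M" "y \<in> universe M" using Q_M by (auto simp: reflected_cosets_def)
    from diff_identities(2,4)[OF this one_closed c] xy K
    show "(y, x) \<in> reflected_cosets K c" by (auto simp: reflected_cosets_def subgroup_def)
  qed
  show "trans (reflected_cosets K c)"
  proof (rule transI)
    fix x y z assume xyz: "(x, y) \<in> reflected_cosets K c" "(y, z) \<in> reflected_cosets K c"
    then have "x \<in> universe M" "y \<in> universe M" "z \<in> universe M" using Q_M by (auto simp: reflected_cosets_def)
    note id = diff_identities[OF this c]
    from xyz consider "diff M x y \<in> K" "diff M y z \<in> K" | "diff M x y \<in> K" "diff M (add M y z) c \<in> K"
      | "diff M (add M x y) c \<in> K" "diff M y z \<in> K" | "diff M (add M x y) c \<in> K" "diff M (add M y z) c \<in> K"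
      by (auto simp: reflected_cosets_def)
    then have "diff M x z \<in> K \<or> diff M (add M x z) c \<in> K"
    proof cases
      case 1
      then show ?thesis using K id(3) by (auto simp: subgroup_def)
    next
      case 2
      then show ?thesis using K id(5) by (auto simp: subgroup_def)
    next
      case 3
      then show ?thesis using K id(6) by (auto simp: subgroup_def)
    next
      case 4
      then show ?thesis using K id(7) by (auto simp: subgroup_def)
    qed
    with xyz show "(x, z) \<in> reflected_cosets K c" by (auto simp: reflected_cosets_def)
  qed
qed

text \<open>\<open>J\<close> consists of formulas \<open>\<chi>\<close>, given as functions of two terms, with a parameter \<open>a\<close> for the
  second term and the property of the value of the first term that is then expressed.\<close>

definition defined_by :: "((tm \<Rightarrow> tm \<Rightarrow> fm) \<times> 'a \<times> ('a \<Rightarrow> bool)) set \<Rightarrow> 'a set \<Rightarrow> 'a set \<Rightarrow> bool" where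
  "defined_by J B K \<longleftrightarrow> B \<subseteq> universe C \<and> |B| <o \<kappa> \<and> zero M \<in> K \<and>
     K = {e \<in> universe M. \<forall>(\<chi>, a, R)\<in>J. R e} \<and>
     (\<forall>(\<chi>, a, R)\<in>J. a \<in> B \<and> (\<forall>s t. free_vars (\<chi> s t) \<subseteq> tm_vars s \<union> tm_vars t \<and>
        (\<forall>v. tm_val M v t = a \<longrightarrow> (sat M v (\<chi> s t) \<longleftrightarrow> R (tm_val M v s)))))"

lemma defined_byD:
  assumes "defined_by J B K"
  shows "B \<subseteq> universe C" "|B| <o \<kappa>" "zero M \<in> K" "K = {e \<in> universe M. \<forall>(\<chi>, a, R)\<in>J. R e}"
    "(\<chi>, a, R) \<in> J \<Longrightarrow> a \<in> B"
    "(\<chi>, a, R) \<in> J \<Longrightarrow> free_vars (\<chi> s t) \<subseteq> tm_vars s \<union> tm_vars t"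
    "\<lbrakk>(\<chi>, a, R) \<in> J; tm_val M v t = a\<rbrakk> \<Longrightarrow> sat M v (\<chi> s t) \<longleftrightarrow> R (tm_val M v s)"
  using assms unfolding defined_by_def by fast+

lemma cosets_definable:
  assumes J: "defined_by J B K"
  shows "rel_type_definable M Q B (cosets K)"
proof -
  define \<pi> where "\<pi> = {(\<chi> (Diff (Var 0) (Var 1)) (Var 2), [a]) | \<chi> a R. (\<chi>, a, R) \<in> J}"
  have real: "realizes M [x, y] \<pi> \<longleftrightarrow> diff M x y \<in> K" if "x \<in> universe M" "y \<in> universe M" for x y
  proof -
    have "holds M ([x, y] @ [a]) (\<chi> (Diff (Var 0) (Var 1)) (Var 2)) \<longleftrightarrow> R (diff M x y)" if "(\<chi>, a, R) \<in> J" for \<chi> a R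
      using defined_byD(7)[OF J that, of "nth [x, y, a]" "Var 2" "Diff (Var 0) (Var 1)"] by (simp add: holds_def)
    then have "realizes M [x, y] \<pi> \<longleftrightarrow> (\<forall>(\<chi>, a, R)\<in>J. R (diff M x y))"
      unfolding \<pi>_def realizes_def by fastforce
    then show ?thesis using that defined_byD(4)[OF J] by auto
  qed
  have "\<pi> \<subseteq> formulas_over 2 B"
  proof -
    have "(\<chi> (Diff (Var 0) (Var 1)) (Var 2), [a]) \<in> formulas_over 2 B" if "(\<chi>, a, R) \<in> J" for \<chi> a R
      using defined_byD(5)[OF J that] subset_trans[OF defined_byD(6)[OF J that]] by (auto simp: formulas_over_def)
    then show ?thesis by (auto simp: \<pi>_def)
  qed
  \<comment> \<open>A partial type must be consistent in \<open>M\<close>, not in \<open>Q\<close>,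
    so the pair of zeros is a sufficient witness.\<close>
  moreover have "realizes M [zero M, zero M] \<pi>" using real defined_byD(3)[OF J] by (simp add: diff_self)
  ultimately have "partial_type M 2 B \<pi>"
    unfolding partial_type_def using realizes_mono[of M "[zero M, zero M]" \<pi>]
    by (auto intro!: exI[of _ "[zero M, zero M]"])
  moreover have "cosets K = {(x, y) \<in> Q \<times> Q. realizes M [x, y] \<pi>}"
    using real Q_M by (auto simp: cosets_def)
  ultimately show ?thesis unfolding rel_type_definable_def by blast
qed

text \<open>A union of two type-definable sets is type-definable: the disjunction of two infinite
  conjunctions is the conjunction of all pairwise disjunctions.\<close>

lemma reflected_cosets_definable:
  assumes J: "defined_by J B K" and c: "c \<in> universe C"
  shows "rel_type_definable M Q (insert c B) (reflected_cosets K c)"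
proof -
  define \<psi> where "\<psi> = (\<lambda>\<chi> \<chi>'. Disj (\<chi> (Diff (Var 0) (Var 1)) (Var 2)) (\<chi>' (Diff (Plus (Var 0) (Var 1)) (Var 4)) (Var 3)))"
  define \<pi> where "\<pi> = {(\<psi> \<chi> \<chi>', [a, a', c]) | \<chi> a R \<chi>' a' R'. (\<chi>, a, R) \<in> J \<and> (\<chi>', a', R') \<in> J}"
  have cM: "c \<in> universe M" using c C_sub by blast
  have real: "realizes M [x, y] \<pi> \<longleftrightarrow> diff M x y \<in> K \<or> diff M (add M x y) c \<in> K"
    if "x \<in> universe M" "y \<in> universe M" for x y
  proof -
    have one: "holds M ([x, y] @ [a, a', c]) (\<psi> \<chi> \<chi>') \<longleftrightarrow> R (diff M x y) \<or> R' (diff M (add M x y) c)"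
      if "(\<chi>, a, R) \<in> J" "(\<chi>', a', R') \<in> J" for \<chi> a R \<chi>' a' R'
      using defined_byD(7)[OF J that(1), of "nth [x, y, a, a', c]" "Var 2" "Diff (Var 0) (Var 1)"]
        defined_byD(7)[OF J that(2), of "nth [x, y, a, a', c]" "Var 3" "Diff (Plus (Var 0) (Var 1)) (Var 4)"]
      by (simp add: holds_def \<psi>_def)
    have "realizes M [x, y] \<pi> \<longleftrightarrow>
        (\<forall>(\<chi>, a, R)\<in>J. \<forall>(\<chi>', a', R')\<in>J. R (diff M x y) \<or> R' (diff M (add M x y) c))"
    proof
      assume real: "realizes M [x, y] \<pi>"
      have "R (diff M x y) \<or> R' (diff M (add M x y) c)"
        if "(\<chi>, a, R) \<in> J" "(\<chi>', a', R') \<in> J" for \<chi> a R \<chi>' a' R'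
      proof -
        have "(\<psi> \<chi> \<chi>', [a, a', c]) \<in> \<pi>" using that unfolding \<pi>_def by blast
        from realizesD[OF real this] one[OF that] show ?thesis by simp
      qed
      then show "\<forall>(\<chi>, a, R)\<in>J. \<forall>(\<chi>', a', R')\<in>J. R (diff M x y) \<or> R' (diff M (add M x y) c)" by blast
    next
      assume *: "\<forall>(\<chi>, a, R)\<in>J. \<forall>(\<chi>', a', R')\<in>J. R (diff M x y) \<or> R' (diff M (add M x y) c)"
      have "holds M ([x, y] @ ds) \<phi>" if mem: "(\<phi>, ds) \<in> \<pi>" for \<phi> ds
      proof -
        obtain \<chi> a R \<chi>' a' R' where J': "(\<chi>, a, R) \<in> J" "(\<chi>', a', R') \<in> J" and "\<phi> = \<psi> \<chi> \<chi>'" "ds = [a, a', c]"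
          using mem unfolding \<pi>_def by blast
        moreover have "R (diff M x y) \<or> R' (diff M (add M x y) c)"
          using bspec[OF * J'(1)] bspec[OF _ J'(2)] by auto
        ultimately show ?thesis using one[OF J'] by simp
      qed
      then show "realizes M [x, y] \<pi>" unfolding realizes_def by blast
    qed
    also have "\<dots> \<longleftrightarrow> (\<forall>(\<chi>, a, R)\<in>J. R (diff M x y)) \<or> (\<forall>(\<chi>, a, R)\<in>J. R (diff M (add M x y) c))"
      by fast
    finally show ?thesis using that cM defined_byD(4)[OF J] by auto
  qed
  have "\<pi> \<subseteq> formulas_over 2 (insert c B)"
  proof -
    have "(\<psi> \<chi> \<chi>', [a, a', c]) \<in> formulas_over 2 (insert c B)" if "(\<chi>, a, R) \<in> J" "(\<chi>', a', R') \<in> J" for \<chi> a R \<chi>' a' R'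
      using defined_byD(5)[OF J that(1)] defined_byD(5)[OF J that(2)]
        subset_trans[OF defined_byD(6)[OF J that(1)]] subset_trans[OF defined_byD(6)[OF J that(2)]]
      by (auto simp: formulas_over_def \<psi>_def)
    then show ?thesis by (auto simp: \<pi>_def)
  qed
  moreover have "realizes M [zero M, zero M] \<pi>" using real defined_byD(3)[OF J] by (simp add: diff_self)
  ultimately have "partial_type M 2 (insert c B) \<pi>"
    unfolding partial_type_def using realizes_mono[of M "[zero M, zero M]" \<pi>]
    by (auto intro!: exI[of _ "[zero M, zero M]"])
  moreover have "reflected_cosets K c = {(x, y) \<in> Q \<times> Q. realizes M [x, y] \<pi>}"
    using real Q_M by (auto simp: reflected_cosets_def)
  ultimately show ?thesis unfolding rel_type_definable_def by blast
qed

lemma small_insert: "|A| <o \<kappa> \<Longrightarrow> |insert x A| <o \<kappa>"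
  by (rule card_of_insert_ordLess[OF Card_\<kappa>])

lemma small_empty: "|{} :: 'b set| <o \<kappa>"
  using Card_\<kappa> by (intro finite_ordLess_infinite)
    (auto simp: card_of_well_order_on Field_card_of intro: card_order_on_well_order_on)

definition definable_equiv_relation :: "('a \<times> 'a) set \<Rightarrow> bool" where
  "definable_equiv_relation F \<longleftrightarrow>
     equiv Q F \<and> (\<exists>D. D \<subseteq> universe C \<and> |D| <o \<kappa> \<and> rel_type_definable M Q D F)"

lemma cosets_definable_equiv:
  "\<lbrakk>subgroup K; defined_by J B K\<rbrakk> \<Longrightarrow> definable_equiv_relation (cosets K)"
  unfolding definable_equiv_relation_def
  by (intro conjI exI[of _ B] equiv_cosets cosets_definable[of J] defined_byD(1,2)[of J B K])

lemma reflected_cosets_definable_equiv: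
  assumes "subgroup K" "defined_by J B K" "c \<in> universe C"
  shows "definable_equiv_relation (reflected_cosets K c)"
  unfolding definable_equiv_relation_def
proof (intro conjI exI)
  show "equiv Q (reflected_cosets K c)" using equiv_reflected_cosets[OF assms(1)] assms(3) C_sub by blast
  show "insert c B \<subseteq> universe C" using defined_byD(1)[OF assms(2)] assms(3) by blast
  show "|insert c B| <o \<kappa>" by (rule small_insert[OF defined_byD(2)[OF assms(2)]])
  show "rel_type_definable M Q (insert c B) (reflected_cosets K c)"
    by (rule reflected_cosets_definable[OF assms(2,3)])
qed

lemma total_definable_equiv: "definable_equiv_relation (Q \<times> Q)"
proof -
  have "partial_type M 2 {} {}"
    by (auto simp: partial_type_def intro!: exI[of _ "[zero M, zero M]"])
  then have "rel_type_definable M Q {} (Q \<times> Q)"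
    unfolding rel_type_definable_def by (intro exI[of _ "{}"]) auto
  moreover have "equiv Q (Q \<times> Q)" by (auto simp: equiv_def refl_on_def sym_def trans_def)
  ultimately show ?thesis unfolding definable_equiv_relation_def using small_empty by blast
qed

lemma subgroup_zero: "subgroup {zero M}"
proof -
  have "neg M (zero M) = zero M" "add M (zero M) (zero M) = zero M"
    using ev_neg[OF zero_closed] ev_add[OF zero_closed zero_closed] ev_zero
    by (intro eq_if_ev_eq; simp; elim eventually_rev_mp; simp)+
  then show ?thesis by (simp add: subgroup_def)
qed

text \<open>\<open>defined_by\<close> attaches a parameter to every formula; here
  \<open>one M\<close> is a dummy.\<close>

lemma zero_defined_by: "\<exists>J B. defined_by J B {zero M}"
  using C_one small_insert[OF small_empty]
  by (intro exI[of _ "{(\<lambda>s t. Eq s Zero, one M, \<lambda>e. e = zero M)}"] exI[of _ "{one M}"])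
    (auto simp: defined_by_def)

lemma subgroup_infinitesimals: "subgroup (infinitesimals M)"
  unfolding infinitesimals_eq_mu subgroup_def using zero_mu mu_neg mu_add muD(2) by auto

lemma infinitesimals_defined_by: "\<exists>J B. defined_by J B (infinitesimals M)"
proof -
  define J where "J = {(\<lambda>s t :: tm. Disj (Rel r s Zero) (Rel r Zero s), one M, \<lambda>e. S M r e (zero M)) | r. True}"
  have "infinitesimals M = {e \<in> universe M. \<forall>(\<chi>, a, R)\<in>J. R e}"
    unfolding infinitesimals_def J_def by fastforce
  moreover have "zero M \<in> infinitesimals M" using zero_mu infinitesimals_eq_mu by simp
  moreover have "\<forall>(\<chi>, a, R)\<in>J. a \<in> {one M} \<and> (\<forall>s t. free_vars (\<chi> s t) \<subseteq> tm_vars s \<union> tm_vars t \<and>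
      (\<forall>v. tm_val M v t = a \<longrightarrow> (sat M v (\<chi> s t) \<longleftrightarrow> R (tm_val M v s))))"
    by (auto simp: J_def S_def)
  moreover have "{one M} \<subseteq> universe C" using C_one by simp
  ultimately have "defined_by J {one M} (infinitesimals M)"
    using small_insert[OF small_empty, of "one M"] unfolding defined_by_def by (intro conjI)
  then show ?thesis by blast
qed

lemma subgroup_infinitesimals_below:
  assumes A: "A \<noteq> {}" "A \<subseteq> positive_infinitesimals C"
  shows "subgroup (infinitesimals_below M A)"
  unfolding infinitesimals_below_eq[OF A] subgroup_def
proof (intro conjI ballI subsetI)
  let ?K = "{e \<in> mu. \<forall>a\<in>A. \<forall>n\<ge>1. \<forall>\<^sub>F i in U. real n * \<bar>\<rho> e i\<bar> \<le> \<rho> a i}"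
  show "e \<in> universe M" if "e \<in> ?K" for e using that muD(2) by blast
  have pos: "lt (zero M) a" if "a \<in> A" for a using that A(2) positive_infinitesimals_iff by blast
  have "\<forall>\<^sub>F i in U. real n * \<bar>\<rho> (zero M) i\<bar> \<le> \<rho> a i" if "a \<in> A" for a n
    using pos[OF that] ev_zero by eventually_elim simp
  then show "zero M \<in> ?K" using zero_mu by blast
  fix e assume e: "e \<in> ?K"
  have eM: "e \<in> universe M" using e muD(2) by blast
  have "\<forall>\<^sub>F i in U. real n * \<bar>\<rho> (neg M e) i\<bar> \<le> \<rho> a i" if "a \<in> A" "n \<ge> 1" for a n
  proof -
    have "\<forall>\<^sub>F i in U. real n * \<bar>\<rho> e i\<bar> \<le> \<rho> a i" using e that by blast
    with ev_neg[OF eM] show ?thesis by eventually_elim simp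
  qed
  then show "neg M e \<in> ?K" using mu_neg e by blast
  fix f assume f: "f \<in> ?K"
  have fM: "f \<in> universe M" using f muD(2) by blast
  have "\<forall>\<^sub>F i in U. real n * \<bar>\<rho> (add M e f) i\<bar> \<le> \<rho> a i" if a: "a \<in> A" "n \<ge> 1" for a n
  proof -
    \<comment> \<open>The conditions for \<open>2 * n\<close> on both summands add up to the
      condition for \<open>n\<close> on the sum.\<close>
    have "1 \<le> 2 * n" using a by simp
    then have "\<forall>\<^sub>F i in U. real (2 * n) * \<bar>\<rho> e i\<bar> \<le> \<rho> a i" "\<forall>\<^sub>F i in U. real (2 * n) * \<bar>\<rho> f i\<bar> \<le> \<rho> a i"
      using e f a(1) by blast+
    with ev_add[OF eM fM] show ?thesis
    proof eventually_elim
      case (elim i)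
      have "real n * \<bar>\<rho> e i + \<rho> f i\<bar> \<le> real n * (\<bar>\<rho> e i\<bar> + \<bar>\<rho> f i\<bar>)"
        by (intro mult_left_mono abs_triangle_ineq) simp
      then show ?case using elim by (simp add: algebra_simps)
    qed
  qed
  then show "add M e f \<in> ?K" using mu_add e f by blast
qed

lemma infinitesimals_below_defined_by:
  assumes A: "A \<noteq> {}" "A \<subseteq> positive_infinitesimals C" "|A| <o \<kappa>"
  shows "\<exists>J B. defined_by J B (infinitesimals_below M A)"
proof -
  define J where "J = {(\<lambda>s t :: tm. Conj (Rel r1 (Nmul n s) t) (Rel r1 (Minus (Nmul n s)) t), a,
      \<lambda>e. rel M r1 (mult M n e) a \<and> rel M r1 (neg M (mult M n e)) a) | n a. 1 \<le> n \<and> a \<in> A}"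
  have "infinitesimals_below M A = {e \<in> universe M. \<forall>(\<chi>, a, R)\<in>J. R e}"
    unfolding infinitesimals_below_def J_def r1_def by fastforce
  moreover have "zero M \<in> infinitesimals_below M A"
    using subgroup_infinitesimals_below[OF A(1,2)] by (simp add: subgroup_def)
  moreover have "A \<subseteq> universe C" using A(2) by (auto simp: positive_infinitesimals_def)
  moreover have "\<forall>(\<chi>, a, R)\<in>J. a \<in> A \<and> (\<forall>s t. free_vars (\<chi> s t) \<subseteq> tm_vars s \<union> tm_vars t \<and>
      (\<forall>v. tm_val M v t = a \<longrightarrow> (sat M v (\<chi> s t) \<longleftrightarrow> R (tm_val M v s))))"
    by (auto simp: J_def dest: subsetD[OF Nmul_simps(1)])
  ultimately have "defined_by J A (infinitesimals_below M A)"
    using A(3) unfolding defined_by_def by (intro conjI)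
  then show ?thesis by blast
qed

lemma listed_relations:
  "Id_on Q = cosets {zero M}" "E_inf M Q = cosets (infinitesimals M)"
  "c \<in> universe C \<Longrightarrow> E_refl M Q c = reflected_cosets {zero M} c"
  "E_inf_refl M Q c = reflected_cosets (infinitesimals M) c"
  "E_below M Q A = cosets (infinitesimals_below M A)"
  "E_below_refl M Q A c = reflected_cosets (infinitesimals_below M A) c"
proof -
  have diff0: "diff M x y = zero M \<longleftrightarrow> x = y" if "x \<in> universe M" "y \<in> universe M" for x y
  proof
    assume "diff M x y = zero M"
    then have "\<forall>\<^sub>F i in U. \<rho> x i = \<rho> y i"
      using ev_diff[OF that] ev_zero by simp (elim eventually_rev_mp, simp)
    then show "x = y" using eq_if_ev_eq that by blast
  qed (use diff_self that in simp)
  show "Id_on Q = cosets {zero M}" using diff0 Q_M by (auto simp: cosets_def)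
  show "E_refl M Q c = reflected_cosets {zero M} c" if "c \<in> universe C"
  proof -
    have "c \<in> universe M" using that C_sub by blast
    then show ?thesis using diff0 Q_M unfolding E_refl_def reflected_cosets_def by auto
  qed
qed (auto simp: E_inf_def E_inf_refl_def E_below_def E_below_refl_def cosets_def reflected_cosets_def)

section \<open>The classification for a given representation of the large model\<close>

lemma classification:
  "definable_equiv_relation F \<longleftrightarrow> F = Q \<times> Q \<or> F = Id_on Q \<or> F = E_inf M Q
    \<or> (\<exists>c\<in>universe C. F = E_refl M Q c)
    \<or> (\<exists>c\<in>universe C. F = E_inf_refl M Q c)
    \<or> (\<exists>A. A \<noteq> {} \<and> A \<subseteq> positive_infinitesimals C \<and> |A| <o \<kappa> \<and> F = E_below M Q A)
    \<or> (\<exists>A. A \<noteq> {} \<and> A \<subseteq> positive_infinitesimals C \<and> |A| <o \<kappa>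
         \<and> (\<exists>c\<in>universe C. F = E_below_refl M Q A c))" (is "?L \<longleftrightarrow> ?R")
proof
  assume ?L
  then obtain D \<pi> where F: "equiv Q F" "D \<subseteq> universe C" "|D| <o \<kappa>" "partial_type M 2 D \<pi>"
    "F = {(x, y) \<in> Q \<times> Q. realizes M [x, y] \<pi>}"
    unfolding definable_equiv_relation_def rel_type_definable_def by blast
  show ?R
  proof (cases "F = Q \<times> Q")
    case False
    interpret proper_definable_equiv C M U \<rho> \<kappa> \<kappa>' F D \<pi>
      by unfold_locales (use F False in auto)
    have FH: "F = cosets H \<or> (\<exists>c\<in>universe C. F = reflected_cosets H c)"
      using F_cases unfolding cosets_def reflected_cosets_def .
    from H_cases consider "H = {zero M}" | "H = infinitesimals M"
      | A where "A \<noteq> {}" "A \<subseteq> positive_infinitesimals C" "|A| <o \<kappa>" "H = infinitesimals_below M A" by blast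
    then show ?thesis
    proof cases
      case 1
      have "F = Id_on Q \<or> (\<exists>c\<in>universe C. F = E_refl M Q c)"
        using FH listed_relations(1,3) unfolding 1 by auto
      then show ?thesis by iprover
    next
      case 2
      have "F = E_inf M Q \<or> (\<exists>c\<in>universe C. F = E_inf_refl M Q c)"
        using FH listed_relations(2,4) unfolding 2 by auto
      then show ?thesis by iprover
    next
      case (3 A)
      have "F = E_below M Q A \<or> (\<exists>c\<in>universe C. F = E_below_refl M Q A c)"
        using FH listed_relations(5,6) unfolding 3(4) by auto
      then show ?thesis using 3(1-3) by iprover
    qed
  qed simp
next
  have Id: "definable_equiv_relation (Id_on Q)"
    using cosets_definable_equiv[OF subgroup_zero] zero_defined_by unfolding listed_relations by auto
  have refl: "definable_equiv_relation (E_refl M Q c)" if "c \<in> universe C" for c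
    using reflected_cosets_definable_equiv[OF subgroup_zero _ that] zero_defined_by
    unfolding listed_relations(3)[OF that] by auto
  have inf: "definable_equiv_relation (E_inf M Q)"
    using cosets_definable_equiv[OF subgroup_infinitesimals] infinitesimals_defined_by
    unfolding listed_relations by auto
  have inf_refl: "definable_equiv_relation (E_inf_refl M Q c)" if "c \<in> universe C" for c
    using reflected_cosets_definable_equiv[OF subgroup_infinitesimals _ that] infinitesimals_defined_by
    unfolding listed_relations by auto
  have below: "definable_equiv_relation (E_below M Q A)"
      "\<And>c. c \<in> universe C \<Longrightarrow> definable_equiv_relation (E_below_refl M Q A c)"
    if A: "A \<noteq> {}" "A \<subseteq> positive_infinitesimals C" "|A| <o \<kappa>" for A
    using cosets_definable_equiv[OF subgroup_infinitesimals_below[OF A(1,2)]]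
      reflected_cosets_definable_equiv[OF subgroup_infinitesimals_below[OF A(1,2)]]
      infinitesimals_below_defined_by[OF A]
    unfolding listed_relations by auto
  assume ?R
  then show ?L
    by (elim disjE exE conjE bexE) (simp_all add: total_definable_equiv Id refl inf inf_refl below)
qed

end

theorem theorem4p7:
  fixes C C' :: "'a Lstruct" and \<kappa> :: "'k rel" and \<kappa>' :: "'l rel"
    and P :: "'a set" and F :: "('a \<times> 'a) set"
  assumes "is_model C T" and "is_model C' T"
    and "elementary_substructure C C'"
    and "strong_limit \<kappa>" and "|T| <o \<kappa>" and "saturated C \<kappa>"
    and "strong_limit \<kappa>'" and "|universe C| <o \<kappa>'"
    and "saturated C' \<kappa>'" and "strongly_homogeneous C' \<kappa>'"
    and "P = realizations C' (type_at_infinity C)"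
  shows "(equiv P F \<and> (\<exists>D. D \<subseteq> universe C \<and> |D| <o \<kappa> \<and> rel_type_definable C' P D F))
    \<longleftrightarrow> (F = P \<times> P
       \<or> F = Id_on P
       \<or> F = E_inf C' P
       \<or> (\<exists>c\<in>universe C. F = E_refl C' P c)
       \<or> (\<exists>c\<in>universe C. F = E_inf_refl C' P c)
       \<or> (\<exists>A. A \<noteq> {} \<and> A \<subseteq> positive_infinitesimals C \<and> |A| <o \<kappa> \<and> F = E_below C' P A)
       \<or> (\<exists>A. A \<noteq> {} \<and> A \<subseteq> positive_infinitesimals C \<and> |A| <o \<kappa>
            \<and> (\<exists>c\<in>universe C. F = E_below_refl C' P A c)))"
proof -
  \<comment> \<open>The statement does not mention \<open>U\<close> and \<open>\<rho>\<close>, so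
    any representation of \<open>C'\<close> serves.\<close>
  obtain U :: "('a \<times> posrat) set filter" and \<rho> where "hyperreal C' U \<rho>"
    using ex_hyperreal[OF assms(2)] by blast
  then interpret hyperreal C' U \<rho> .
  interpret saturated_pair C C' U \<rho> \<kappa> \<kappa>'
    by unfold_locales (use assms in \<open>auto simp: strong_limit_def\<close>)
  have "P = Q" using assms(11) realizations_eq_Q by simp
  then show ?thesis using classification[of F] unfolding definable_equiv_relation_def by simp
qed

end
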